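(* Let $H\Gamma=(V,E,r,s)$ be a finite hypergraph with only quasi perfect paths and no sinks, and such that $C^*(H\Gamma)$ is generated by $\{s_e\mid e\in E\}$. Let $\{P_v,S_e\}$ be a Cuntz-Krieger $H\Gamma$-family in a $C^*$-algebra $B$ with $P_v\neq0$ for every $v\in V$, and let $\pi:C^*(H\Gamma)\to B$ be the canonical $*$-homomorphism with $\pi(p_v)=P_v$ and $\pi(s_e)=S_e$. If there is a continuous action $\beta:\mathbb T\to\mathrm{Aut}(B)$ such that $\pi\circ\gamma_z=\beta_z\circ\pi$ for all $z\in\mathbb T$, where $\gamma$ is the gauge action on $C^*(H\Gamma)$, then $\pi$ is injective.
   Context: A (finite directed) hypergraph $H\Gamma=(V,E,r,s)$ consists of finite sets $V$ (vertices) and $E$ (edges) and maps $r,s:E\to\mathcal P(V)\setminus\{\emptyset\}$ (range and source), where $\mathcal P(V)$ is the power set. A vertex $v$ is a sink if $v\notin s(e)$ for all $e\in E$. The hypergraph $C^*$-algebra $C^*(H\Gamma)$ is the universal $C^*$-algebra generated by mutually orthogonal projections $p_v$ ($v\in V$) and partial isometries $s_e$ ($e\in E$) such that: (HR1) $s_e^*s_f=\delta_{ef}\sum_{v\in r(e)}p_v$ for all $e,f\in E$; (HR2a) $s_es_e^*\le\sum_{v\in s(e)}p_v$ for all $e\in E$; (HR2b) $p_v\le\sum_{e\in E,\,v\in s(e)}s_es_e^*$ for all $v\in V$ that are not sinks. Mutually orthogonal projections $P_v$ and partial isometries $S_e$ in a $C^*$-algebra satisfying these relations form a Cuntz-Krieger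 $H\Gamma$-family. $H\Gamma$ has only quasi perfect paths if for all $e,f\in E$, $s(f)\cap r(e)\ne\emptyset$ implies $s(f)\subseteq r(e)$. The gauge action is the continuous action $\gamma$ of the circle group $\mathbb T$ on $C^*(H\Gamma)$ determined by $\gamma_z(s_e)=zs_e$ for $e\in E$ and $\gamma_z(p_v)=p_v$ for $v\in V$. *)

theory Defs
  imports "HOL-Algebra.Module" "HOL-Library.Poly_Mapping" Complex_Main
begin

section \<open>C*-algebras\<close>

text \<open>C*-algebras are carrier based and not assumed unital (nor non-zero).  The record extends
  the module record of the algebra library in order to inherit its notation and the theory of
  \<^locale>\<open>abelian_group\<close> (in particular finite sums); the inherited field \<^const>\<open>one\<close> is
  meaningless here and is never referred to.\<close>

record 'a cstar = "(complex, 'a) module" +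
  adj :: "'a \<Rightarrow> 'a"
  cnorm :: "'a \<Rightarrow> real"

locale cstar_algebra = abelian_group A for A :: "('a, 'm) cstar_scheme" (structure) +
  assumes smult_closed: "x \<in> carrier A \<Longrightarrow> c \<odot> x \<in> carrier A"
    and smult_l_distr: "x \<in> carrier A \<Longrightarrow> (c + d) \<odot> x = c \<odot> x \<oplus> d \<odot> x"
    and smult_r_distr:
      "x \<in> carrier A \<Longrightarrow> y \<in> carrier A \<Longrightarrow> c \<odot> (x \<oplus> y) = c \<odot> x \<oplus> c \<odot> y"
    and smult_assoc: "x \<in> carrier A \<Longrightarrow> (c * d) \<odot> x = c \<odot> (d \<odot> x)"
    and smult_one: "x \<in> carrier A \<Longrightarrow> 1 \<odot> x = x"
    and mult_closed: "x \<in> carrier A \<Longrightarrow> y \<in> carrier A \<Longrightarrow> x \<otimes> y \<in> carrier A"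
    and mult_assoc:
      "x \<in> carrier A \<Longrightarrow> y \<in> carrier A \<Longrightarrow> z \<in> carrier A \<Longrightarrow> (x \<otimes> y) \<otimes> z = x \<otimes> (y \<otimes> z)"
    and mult_l_distr:
      "x \<in> carrier A \<Longrightarrow> y \<in> carrier A \<Longrightarrow> z \<in> carrier A \<Longrightarrow>
        (x \<oplus> y) \<otimes> z = x \<otimes> z \<oplus> y \<otimes> z"
    and mult_r_distr:
      "x \<in> carrier A \<Longrightarrow> y \<in> carrier A \<Longrightarrow> z \<in> carrier A \<Longrightarrow>
        z \<otimes> (x \<oplus> y) = z \<otimes> x \<oplus> z \<otimes> y"
    and smult_mult_l:
      "x \<in> carrier A \<Longrightarrow> y \<in> carrier A \<Longrightarrow> (c \<odot> x) \<otimes> y = c \<odot> (x \<otimes> y)"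
    and smult_mult_r:
      "x \<in> carrier A \<Longrightarrow> y \<in> carrier A \<Longrightarrow> x \<otimes> (c \<odot> y) = c \<odot> (x \<otimes> y)"
    and adj_closed: "x \<in> carrier A \<Longrightarrow> adj A x \<in> carrier A"
    and adj_adj: "x \<in> carrier A \<Longrightarrow> adj A (adj A x) = x"
    and adj_add:
      "x \<in> carrier A \<Longrightarrow> y \<in> carrier A \<Longrightarrow> adj A (x \<oplus> y) = adj A x \<oplus> adj A y"
    and adj_smult: "x \<in> carrier A \<Longrightarrow> adj A (c \<odot> x) = cnj c \<odot> adj A x"
    and adj_mult:
      "x \<in> carrier A \<Longrightarrow> y \<in> carrier A \<Longrightarrow> adj A (x \<otimes> y) = adj A y \<otimes> adj A x"
    and cnorm_nonneg: "x \<in> carrier A \<Longrightarrow> 0 \<le> cnorm A x"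
    and cnorm_eq_0: "x \<in> carrier A \<Longrightarrow> cnorm A x = 0 \<longleftrightarrow> x = \<zero>"
    and cnorm_triangle:
      "x \<in> carrier A \<Longrightarrow> y \<in> carrier A \<Longrightarrow> cnorm A (x \<oplus> y) \<le> cnorm A x + cnorm A y"
    and cnorm_smult: "x \<in> carrier A \<Longrightarrow> cnorm A (c \<odot> x) = cmod c * cnorm A x"
    and cnorm_mult:
      "x \<in> carrier A \<Longrightarrow> y \<in> carrier A \<Longrightarrow> cnorm A (x \<otimes> y) \<le> cnorm A x * cnorm A y"
    and cstar_identity: "x \<in> carrier A \<Longrightarrow> cnorm A (adj A x \<otimes> x) = (cnorm A x)\<^sup>2"
    and complete:
      "(\<And>n. X n \<in> carrier A) \<Longrightarrow>
        (\<And>\<epsilon>. \<epsilon> > 0 \<Longrightarrow> \<exists>N. \<forall>m\<ge>N. \<forall>n\<ge>N. cnorm A (X m \<ominus> X n) < \<epsilon>) \<Longrightarrow>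
        \<exists>l\<in>carrier A. (\<lambda>n. cnorm A (X n \<ominus> l)) \<longlonglongrightarrow> 0"

definition cstar_projection :: "('a, 'm) cstar_scheme \<Rightarrow> 'a \<Rightarrow> bool" where
  "cstar_projection A p \<longleftrightarrow> p \<in> carrier A \<and> adj A p = p \<and> p \<otimes>\<^bsub>A\<^esub> p = p"

definition cstar_partial_isometry :: "('a, 'm) cstar_scheme \<Rightarrow> 'a \<Rightarrow> bool" where
  "cstar_partial_isometry A s \<longleftrightarrow> s \<in> carrier A \<and> s \<otimes>\<^bsub>A\<^esub> adj A s \<otimes>\<^bsub>A\<^esub> s = s"

text \<open>The order is the usual one of a C*-algebra; positive elements are those of the form \<open>z* z\<close>.\<close>

definition cstar_positive :: "('a, 'm) cstar_scheme \<Rightarrow> 'a \<Rightarrow> bool" where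
  "cstar_positive A x \<longleftrightarrow> (\<exists>z\<in>carrier A. x = adj A z \<otimes>\<^bsub>A\<^esub> z)"

definition cstar_le :: "('a, 'm) cstar_scheme \<Rightarrow> 'a \<Rightarrow> 'a \<Rightarrow> bool" where
  "cstar_le A x y \<longleftrightarrow> x \<in> carrier A \<and> y \<in> carrier A \<and> cstar_positive A (y \<ominus>\<^bsub>A\<^esub> x)"

definition cstar_subalgebra :: "('a, 'm) cstar_scheme \<Rightarrow> 'a set \<Rightarrow> bool" where
  "cstar_subalgebra A D \<longleftrightarrow>
     D \<subseteq> carrier A \<and> \<zero>\<^bsub>A\<^esub> \<in> D \<and>
     (\<forall>x\<in>D. \<forall>y\<in>D. x \<oplus>\<^bsub>A\<^esub> y \<in> D \<and> x \<otimes>\<^bsub>A\<^esub> y \<in> D) \<and>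
     (\<forall>x\<in>D. adj A x \<in> D \<and> (\<forall>c. c \<odot>\<^bsub>A\<^esub> x \<in> D)) \<and>
     (\<forall>X l. (\<forall>n. X n \<in> D) \<longrightarrow> l \<in> carrier A \<longrightarrow>
        (\<lambda>n. cnorm A (X n \<ominus>\<^bsub>A\<^esub> l)) \<longlonglongrightarrow> 0 \<longrightarrow> l \<in> D)"

definition cstar_generated :: "('a, 'm) cstar_scheme \<Rightarrow> 'a set \<Rightarrow> 'a set" where
  "cstar_generated A X = \<Inter>{D. cstar_subalgebra A D \<and> X \<subseteq> D}"

definition star_hom :: "('a, 'm) cstar_scheme \<Rightarrow> ('b, 'n) cstar_scheme \<Rightarrow> ('a \<Rightarrow> 'b) set" where
  "star_hom A B = {\<phi>. \<phi> \<in> carrier A \<rightarrow> carrier B \<and>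
     (\<forall>x\<in>carrier A. \<forall>y\<in>carrier A.
        \<phi> (x \<oplus>\<^bsub>A\<^esub> y) = \<phi> x \<oplus>\<^bsub>B\<^esub> \<phi> y \<and> \<phi> (x \<otimes>\<^bsub>A\<^esub> y) = \<phi> x \<otimes>\<^bsub>B\<^esub> \<phi> y) \<and>
     (\<forall>x\<in>carrier A. \<phi> (adj A x) = adj B (\<phi> x) \<and> (\<forall>c. \<phi> (c \<odot>\<^bsub>A\<^esub> x) = c \<odot>\<^bsub>B\<^esub> \<phi> x))}"

definition star_aut :: "('a, 'm) cstar_scheme \<Rightarrow> ('a \<Rightarrow> 'a) set" where
  "star_aut A = {\<phi> \<in> star_hom A A. bij_betw \<phi> (carrier A) (carrier A)}"

definition circle :: "complex set" where
  "circle = {z. cmod z = 1}"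

text \<open>Continuity of an action is, as usual for C*-algebras, continuity of all orbit maps.\<close>

definition circle_action :: "('a, 'm) cstar_scheme \<Rightarrow> (complex \<Rightarrow> 'a \<Rightarrow> 'a) \<Rightarrow> bool" where
  "circle_action A \<beta> \<longleftrightarrow>
     (\<forall>z\<in>circle. \<beta> z \<in> star_aut A) \<and>
     (\<forall>x\<in>carrier A. \<beta> 1 x = x) \<and>
     (\<forall>z\<in>circle. \<forall>w\<in>circle. \<forall>x\<in>carrier A. \<beta> (z * w) x = \<beta> z (\<beta> w x)) \<and>
     (\<forall>x\<in>carrier A. \<forall>z\<in>circle.
        ((\<lambda>w. cnorm A (\<beta> w x \<ominus>\<^bsub>A\<^esub> \<beta> z x)) \<longlongrightarrow> 0) (at z within circle))"


section \<open>Hypergraphs and Cuntz-Krieger families\<close>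

record ('v, 'e) hypergraph =
  hverts :: "'v set"
  hedges :: "'e set"
  hrange :: "'e \<Rightarrow> 'v set"
  hsource :: "'e \<Rightarrow> 'v set"

definition finite_hypergraph :: "('v, 'e) hypergraph \<Rightarrow> bool" where
  "finite_hypergraph H \<longleftrightarrow> finite (hverts H) \<and> finite (hedges H) \<and>
     (\<forall>e\<in>hedges H. hrange H e \<in> Pow (hverts H) - {{}} \<and> hsource H e \<in> Pow (hverts H) - {{}})"

definition hsink :: "('v, 'e) hypergraph \<Rightarrow> 'v \<Rightarrow> bool" where
  "hsink H v \<longleftrightarrow> v \<in> hverts H \<and> (\<forall>e\<in>hedges H. v \<notin> hsource H e)"

definition only_quasi_perfect_paths :: "('v, 'e) hypergraph \<Rightarrow> bool" where
  "only_quasi_perfect_paths H \<longleftrightarrow>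
     (\<forall>e\<in>hedges H. \<forall>f\<in>hedges H.
        hsource H f \<inter> hrange H e \<noteq> {} \<longrightarrow> hsource H f \<subseteq> hrange H e)"

definition ck_family ::
  "('v, 'e) hypergraph \<Rightarrow> ('a, 'm) cstar_scheme \<Rightarrow> ('v \<Rightarrow> 'a) \<Rightarrow> ('e \<Rightarrow> 'a) \<Rightarrow> bool" where
  "ck_family H A P S \<longleftrightarrow>
     (\<forall>v\<in>hverts H. cstar_projection A (P v)) \<and>
     (\<forall>v\<in>hverts H. \<forall>w\<in>hverts H. v \<noteq> w \<longrightarrow> P v \<otimes>\<^bsub>A\<^esub> P w = \<zero>\<^bsub>A\<^esub>) \<and>
     (\<forall>e\<in>hedges H. cstar_partial_isometry A (S e)) \<and>
     (\<forall>e\<in>hedges H. \<forall>f\<in>hedges H.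
        adj A (S e) \<otimes>\<^bsub>A\<^esub> S f = (if e = f then \<Oplus>\<^bsub>A\<^esub>v\<in>hrange H e. P v else \<zero>\<^bsub>A\<^esub>)) \<and>
     (\<forall>e\<in>hedges H.
        cstar_le A (S e \<otimes>\<^bsub>A\<^esub> adj A (S e)) (\<Oplus>\<^bsub>A\<^esub>v\<in>hsource H e. P v)) \<and>
     (\<forall>v\<in>hverts H. \<not> hsink H v \<longrightarrow>
        cstar_le A (P v)
          (\<Oplus>\<^bsub>A\<^esub>e\<in>{e \<in> hedges H. v \<in> hsource H e}. S e \<otimes>\<^bsub>A\<^esub> adj A (S e)))"


section \<open>The universal C*-algebra of a hypergraph\<close>

text \<open>The universal C*-algebra is constructed in the standard way: take the free (non-unital)
  *-algebra on the generators, equip it with the supremum of all C*-seminorms for which the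
  relations hold in the resulting Hausdorff completion, and complete.

  The free *-algebra consists of the elements of the monoid algebra of words over the letters
  \<open>(x, False)\<close>, standing for the generator \<open>x\<close>, and \<open>(x, True)\<close>, standing for its adjoint, which
  are supported on non-empty words.  A separate type of words is used because lists are not
  declared as an additive monoid in the library.\<close>

datatype 'x fword = FWord (letters: "('x \<times> bool) list")

instantiation fword :: (type) monoid_add
begin

definition zero_fword :: "'a fword" where
  "0 = FWord []"

definition plus_fword :: "'a fword \<Rightarrow> 'a fword \<Rightarrow> 'a fword" where
  "u + w = FWord (letters u @ letters w)"

instance
  by standard (simp_all add: zero_fword_def plus_fword_def)

end

type_synonym 'x free_star = "'x fword \<Rightarrow>\<^sub>0 complex"

definition free_carrier :: "'x set \<Rightarrow> 'x free_star set" where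
  "free_carrier G =
     {a. \<forall>w\<in>Poly_Mapping.keys a. letters w \<noteq> [] \<and> set (letters w) \<subseteq> G \<times> UNIV}"

definition free_gen :: "'x \<Rightarrow> 'x free_star" where
  "free_gen x = Poly_Mapping.single (FWord [(x, False)]) 1"

definition free_smult :: "complex \<Rightarrow> 'x free_star \<Rightarrow> 'x free_star" where
  "free_smult c a = Poly_Mapping.map (\<lambda>b. c * b) a"

definition fword_adj :: "'x fword \<Rightarrow> 'x fword" where
  "fword_adj w = FWord (rev (map (\<lambda>(x, b). (x, \<not> b)) (letters w)))"

text \<open>As \<^const>\<open>fword_adj\<close> is an involution, the coefficient of \<open>free_adj a\<close> at \<open>w\<close> is the
  conjugate of the coefficient of \<open>a\<close> at \<open>fword_adj w\<close>.\<close>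

definition free_adj :: "'x free_star \<Rightarrow> 'x free_star" where
  "free_adj a = Poly_Mapping.map cnj (Poly_Mapping.map_key fword_adj a)"

definition cstar_seminorm :: "'x set \<Rightarrow> ('x free_star \<Rightarrow> real) \<Rightarrow> bool" where
  "cstar_seminorm G q \<longleftrightarrow>
     (\<forall>a\<in>free_carrier G. 0 \<le> q a \<and> (\<forall>c. q (free_smult c a) = cmod c * q a) \<and>
        q (free_adj a * a) = (q a)\<^sup>2) \<and>
     (\<forall>a\<in>free_carrier G. \<forall>b\<in>free_carrier G. q (a + b) \<le> q a + q b \<and> q (a * b) \<le> q a * q b)"

text \<open>Hausdorff completion of the free *-algebra: Cauchy sequences modulo null sequences.\<close>

definition free_cauchy :: "'x set \<Rightarrow> ('x free_star \<Rightarrow> real) \<Rightarrow> (nat \<Rightarrow> 'x free_star) set" where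
  "free_cauchy G q = {X. (\<forall>n. X n \<in> free_carrier G) \<and>
     (\<forall>\<epsilon>>0. \<exists>N. \<forall>m\<ge>N. \<forall>n\<ge>N. q (X m - X n) < \<epsilon>)}"

definition free_null :: "'x set \<Rightarrow> ('x free_star \<Rightarrow> real) \<Rightarrow>
    ((nat \<Rightarrow> 'x free_star) \<times> (nat \<Rightarrow> 'x free_star)) set" where
  "free_null G q = {(X, Y). X \<in> free_cauchy G q \<and> Y \<in> free_cauchy G q \<and>
     (\<lambda>n. q (X n - Y n)) \<longlonglongrightarrow> 0}"

definition free_class :: "'x set \<Rightarrow> ('x free_star \<Rightarrow> real) \<Rightarrow>
    (nat \<Rightarrow> 'x free_star) \<Rightarrow> (nat \<Rightarrow> 'x free_star) set" where
  "free_class G q X = free_null G q `` {X}"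

definition free_rep :: "(nat \<Rightarrow> 'x free_star) set \<Rightarrow> nat \<Rightarrow> 'x free_star" where
  "free_rep C = (SOME X. X \<in> C)"

definition free_completion ::
  "'x set \<Rightarrow> ('x free_star \<Rightarrow> real) \<Rightarrow> (nat \<Rightarrow> 'x free_star) set cstar" where
  "free_completion G q =
     \<lparr>carrier = free_cauchy G q // free_null G q,
      mult = \<lambda>C D. free_class G q (\<lambda>n. free_rep C n * free_rep D n),
      one = undefined,
      zero = free_class G q (\<lambda>n. 0),
      add = \<lambda>C D. free_class G q (\<lambda>n. free_rep C n + free_rep D n),
      smult = \<lambda>c C. free_class G q (\<lambda>n. free_smult c (free_rep C n)),
      adj = \<lambda>C. free_class G q (\<lambda>n. free_adj (free_rep C n)),
      cnorm = \<lambda>C. lim (\<lambda>n. q (free_rep C n))\<rparr>"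

definition completion_gen ::
  "'x set \<Rightarrow> ('x free_star \<Rightarrow> real) \<Rightarrow> 'x \<Rightarrow> (nat \<Rightarrow> 'x free_star) set" where
  "completion_gen G q x = free_class G q (\<lambda>n. free_gen x)"

definition hgens :: "('v, 'e) hypergraph \<Rightarrow> ('v + 'e) set" where
  "hgens H = hverts H <+> hedges H"

definition hadmissible :: "('v, 'e) hypergraph \<Rightarrow> (('v + 'e) free_star \<Rightarrow> real) set" where
  "hadmissible H = {q. cstar_seminorm (hgens H) q \<and>
     ck_family H (free_completion (hgens H) q)
       (\<lambda>v. completion_gen (hgens H) q (Inl v)) (\<lambda>e. completion_gen (hgens H) q (Inr e))}"

text \<open>The supremum is over a non-empty set (the zero seminorm is admissible) that is bounded on
  the free *-algebra, because generators are sent to projections and partial isometries.\<close>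

definition huniv_norm :: "('v, 'e) hypergraph \<Rightarrow> ('v + 'e) free_star \<Rightarrow> real" where
  "huniv_norm H a = (SUP q\<in>hadmissible H. q a)"

type_synonym ('v, 'e) hcstar_elem = "(nat \<Rightarrow> ('v + 'e) free_star) set"

definition hcstar :: "('v, 'e) hypergraph \<Rightarrow> ('v, 'e) hcstar_elem cstar" where
  "hcstar H = free_completion (hgens H) (huniv_norm H)"

definition hproj :: "('v, 'e) hypergraph \<Rightarrow> 'v \<Rightarrow> ('v, 'e) hcstar_elem" where
  "hproj H v = completion_gen (hgens H) (huniv_norm H) (Inl v)"

definition hiso :: "('v, 'e) hypergraph \<Rightarrow> 'e \<Rightarrow> ('v, 'e) hcstar_elem" where
  "hiso H e = completion_gen (hgens H) (huniv_norm H) (Inr e)"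

definition canonical_hom :: "('v, 'e) hypergraph \<Rightarrow> ('b, 'm) cstar_scheme \<Rightarrow>
    ('v \<Rightarrow> 'b) \<Rightarrow> ('e \<Rightarrow> 'b) \<Rightarrow> (('v, 'e) hcstar_elem \<Rightarrow> 'b) \<Rightarrow> bool" where
  "canonical_hom H B P S \<pi> \<longleftrightarrow> \<pi> \<in> star_hom (hcstar H) B \<and>
     (\<forall>v\<in>hverts H. \<pi> (hproj H v) = P v) \<and> (\<forall>e\<in>hedges H. \<pi> (hiso H e) = S e)"

definition gauge_action :: "('v, 'e) hypergraph \<Rightarrow>
    (complex \<Rightarrow> ('v, 'e) hcstar_elem \<Rightarrow> ('v, 'e) hcstar_elem) \<Rightarrow> bool" where
  "gauge_action H \<gamma> \<longleftrightarrow> circle_action (hcstar H) \<gamma> \<and>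
     (\<forall>z\<in>circle. (\<forall>e\<in>hedges H. \<gamma> z (hiso H e) = z \<odot>\<^bsub>hcstar H\<^esub> hiso H e) \<and>
        (\<forall>v\<in>hverts H. \<gamma> z (hproj H v) = hproj H v))"

end

theory Submission
  imports Defs "HOL-Computational_Algebra.Polynomial"
begin

text \<open>With only quasi perfect paths and no sinks, the relations of a Cuntz-Krieger family become
  Cuntz-Krieger relations \<open>s\<^sub>e* s\<^sub>e = \<Sum>\<^sub>f T(e,f) s\<^sub>f s\<^sub>f*\<close> between the edges alone.  Compressing an
  element of degree 0 by long paths lands in the span of the projections \<open>s\<^sub>f s\<^sub>f*\<close>, none of which is
  annihilated by \<open>\<pi>\<close>; so \<open>\<pi>\<close> is bounded below on each finite stage of the core.  By the C*-identity
  a homomorphism that is bounded below on a *-subalgebra is isometric there.  Averaging \<open>\<beta>\<close>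
  over roots of unity bounds each homogeneous component of \<open>x\<close> by \<open>\<parallel>\<pi> x\<parallel>\<close>, whence
  \<open>\<parallel>x\<parallel> \<le> (2 n + 1) \<parallel>\<pi> x\<parallel>\<close> if the degrees are at most \<open>n\<close>.  As the constant grows only linearly,
  the same argument with powers of \<open>x* x\<close> makes \<open>\<pi>\<close> isometric on a dense subalgebra, and no
  conditional expectation is needed.\<close>

section \<open>C*-algebras and operator bounds\<close>

text \<open>Two obstacles shape the development. First, HR2a and HR2b are order relations, and the
  witness of positivity may change with the admissible seminorm, so nothing follows directly for the
  completion under the supremum. In the completion of each single seminorm they are therefore turned
  into equations \<open>y x = x\<close>. This needs the fact that \<open>w = 0\<close> if w* w is
  negative, usually proved with spectra and functional calculus in a unitization. Here both are
  replaced by norm bounds for polynomials acting by left multiplication, and by one principle: a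
  self-adjoint operator whose powers with exponents \<open>2 ^ m\<close> grow at most linearly is a
  contraction. Second, the lower bounds on the stages of the core deteriorate by a factor
  \<open>card E\<close> for each edge stripped off. This is harmless because \<open>K n n\<close> is
  closed under multiplication: all powers of x* x stay in one stage, so the constant is fixed while
  the norms are raised to powers. The vertices matter afterwards only through the ranges of edges:
  these are non-empty, so no image of an edge vanishes. Generation by the edges makes the sums of
  homogeneous elements dense.\<close>

lemma exceeds_linear:
  fixes L c :: real
  assumes "L > 1"
  shows "\<exists>m. c * 2 ^ m \<le> L ^ (2 ^ m)"
proof -
  \<comment> \<open>The square root allows Bernoulli's linear bound for \<open>sqrt L\<close> to be
    squared: the result grows like \<open>4 ^ n\<close> and beats \<open>c * 2 ^ n\<close> as soon
    as \<open>2 ^ n\<close> exceeds \<open>c / d\<^sup>2\<close>.\<close>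
  define d where "d = sqrt L - 1"
  have d: "d > 0" using assms by (simp add: d_def)
  obtain n :: nat where n: "c / d\<^sup>2 \<le> real n" using real_arch_simple by blast
  have "real n \<le> 2 ^ n" using of_nat_less_two_power[of n, where ?'a=real] by simp
  with n have "c / d\<^sup>2 \<le> 2 ^ n" by linarith
  then have "c \<le> 2 ^ n * d\<^sup>2" using d by (simp add: divide_simps)
  then have "c * 2 ^ n \<le> (2 ^ n * d)\<^sup>2"
    by (simp add: power_mult_distrib power2_eq_square algebra_simps)
  also have "\<dots> \<le> (1 + 2 ^ n * d)\<^sup>2" using d by (intro power_mono) auto
  also have "\<dots> \<le> ((1 + d) ^ (2 ^ n))\<^sup>2"
    using Bernoulli_inequality[of d "2 ^ n"] d by (intro power_mono) auto
  also have "\<dots> = L ^ (2 ^ n)"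
    using assms by (simp add: d_def power_mult [symmetric] mult.commute[of _ 2]) (simp add: power_mult)
  finally show ?thesis by blast
qed

text \<open>If \<open>t > s\<close>, the powers of \<open>t / s\<close> outgrow every multiple of
  \<open>2 ^ m\<close>. The case \<open>m = 0\<close> of the hypothesis excludes
  \<open>s = 0\<close>, so the quotient makes sense.\<close>

lemma power_trick_real:
  fixes s t c :: real
  assumes "s \<ge> 0" and le: "\<And>m. t ^ (2 ^ m) \<le> c * 2 ^ m * s ^ (2 ^ m)"
  shows "t \<le> s"
proof (rule ccontr)
  assume "\<not> t \<le> s"
  then have ts: "t > s" by simp
  have "c * 2 ^ 0 * s ^ (2 ^ 0) > 0" using le[of 0] ts assms(1) by simp
  then have s: "s > 0" using assms(1) by (cases "s = 0") auto
  have L: "t / s > 1" using ts s by simp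
  \<comment> \<open>\<open>c + 1\<close> instead of \<open>c\<close> makes the final contradiction
    strict.\<close>
  then obtain m where m: "(c + 1) * 2 ^ m \<le> (t / s) ^ (2 ^ m)" using exceeds_linear by blast
  have "t ^ (2 ^ m) \<le> c * 2 ^ m * s ^ (2 ^ m)" by (rule le)
  then have "(t / s) ^ (2 ^ m) \<le> c * 2 ^ m"
    using s by (simp add: power_divide divide_simps)
  with m have "(c + 1) * 2 ^ m \<le> c * (2::real) ^ m" by linarith
  moreover have "(2::real) ^ m > 0" by simp
  ultimately show False by (simp only: distrib_right)
qed

text \<open>Orthogonality of the characters of the cyclic group of order \<open>M\<close>. Exponents
  are natural numbers, so negative degrees have to be shifted by multiples of \<open>M\<close>
  first.\<close>

lemma sum_root_of_unity_powers:
  fixes M m :: nat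
  assumes "M > 0"
  shows "(\<Sum>j<M. (cis (2 * pi / real M) ^ m) ^ j) = (if M dvd m then of_nat M else 0)"
proof -
  define w where "w = cis (2 * pi / real M) ^ m"
  \<comment> \<open>Reduction modulo \<open>M\<close> puts \<open>w\<close> into the standard list
    of roots of unity, whose injectivity decides whether \<open>w = 1\<close>.\<close>
  have w: "w = cis (2 * pi * real (m mod M) / real M)"
  proof -
    have "real m = real M * real (m div M) + real (m mod M)"
      by (metis mult_div_mod_eq of_nat_add of_nat_mult)
    then have "real m * (2 * pi / real M) = 2 * pi * real (m div M) + 2 * pi * real (m mod M) / real M"
      using assms by (simp add: divide_simps algebra_simps)
    then have "w = cis (2 * pi * real (m div M)) * cis (2 * pi * real (m mod M) / real M)"
      by (simp only: w_def DeMoivre cis_mult)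
    then show ?thesis by (simp add: cis_multiple_2pi)
  qed
  have wM: "w ^ M = 1"
  proof -
    have "w ^ M = cis (2 * pi * real m)"
      using assms by (simp add: w_def power_mult [symmetric] DeMoivre field_simps)
    then show ?thesis by (simp add: cis_multiple_2pi)
  qed
  show ?thesis
  proof (cases "M dvd m")
    case True
    then have "w = 1" by (simp add: w mod_eq_0_iff_dvd)
    then show ?thesis using True by (simp add: w_def)
  next
    case False
    have "w \<noteq> 1"
    proof
      assume "w = 1"
      then have "cis (2 * pi * real (m mod M) / real M) = cis (2 * pi * real 0 / real M)"
        by (simp add: w)
      moreover have "inj_on (\<lambda>k. cis (2 * pi * real k / real M)) {..<M}"
        using bij_betw_roots_unity[OF assms] by (simp add: bij_betw_def)
      ultimately have "m mod M = 0" using assms inj_onD[of "\<lambda>k. cis (2 * pi * real k / real M)" "{..<M}" "m mod M" 0] by auto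
      then show False using False by (simp add: mod_eq_0_iff_dvd)
    qed
    then show ?thesis using False geometric_sum[of w M] wM by (simp add: w_def)
  qed
qed

section \<open>Elementary calculus in a C*-algebra without unit\<close>

context cstar_algebra
begin

lemmas closed_simps [simp] = smult_closed mult_closed adj_closed a_closed zero_closed a_inv_closed

lemma add_idem_eq_zero: "x \<in> carrier A \<Longrightarrow> x \<oplus> x = x \<Longrightarrow> x = \<zero>"
  using add.l_cancel_one by blast

lemma mult_zero_r [simp]: "x \<in> carrier A \<Longrightarrow> x \<otimes> \<zero> = \<zero>"
  using mult_r_distr[of \<zero> \<zero> x] by (intro add_idem_eq_zero) auto

lemma mult_zero_l [simp]: "x \<in> carrier A \<Longrightarrow> \<zero> \<otimes> x = \<zero>"
  using mult_l_distr[of \<zero> \<zero> x] by (intro add_idem_eq_zero) auto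

lemma smult_zero_r [simp]: "c \<odot> \<zero> = \<zero>"
  using smult_r_distr[of \<zero> \<zero> c] by (intro add_idem_eq_zero) auto

lemma smult_zero_l [simp]: "x \<in> carrier A \<Longrightarrow> 0 \<odot> x = \<zero>"
  using smult_l_distr[of x 0 0] by (intro add_idem_eq_zero) auto

lemma adj_zero [simp]: "adj A \<zero> = \<zero>"
  using adj_smult[of \<zero> 0] by simp

lemma minus_smult: "x \<in> carrier A \<Longrightarrow> \<ominus> x = (-1) \<odot> x"
proof -
  assume x: "x \<in> carrier A"
  have "(-1) \<odot> x \<oplus> 1 \<odot> x = \<zero>" using x smult_l_distr[of x "-1" 1] by simp
  then show ?thesis using x by (simp add: smult_one add.inv_equality)
qed

lemma mult_minus_r: "x \<in> carrier A \<Longrightarrow> y \<in> carrier A \<Longrightarrow> x \<otimes> (\<ominus> y) = \<ominus> (x \<otimes> y)"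
  by (simp add: minus_smult smult_mult_r)

lemma mult_minus_l: "x \<in> carrier A \<Longrightarrow> y \<in> carrier A \<Longrightarrow> (\<ominus> x) \<otimes> y = \<ominus> (x \<otimes> y)"
  by (simp add: minus_smult smult_mult_l)

lemma adj_minus: "x \<in> carrier A \<Longrightarrow> adj A (\<ominus> x) = \<ominus> (adj A x)"
  by (simp add: minus_smult adj_smult)

lemma smult_minus: "x \<in> carrier A \<Longrightarrow> c \<odot> (\<ominus> x) = \<ominus> (c \<odot> x)"
  by (simp add: minus_smult smult_assoc [symmetric])

lemma smult_minus_l: "x \<in> carrier A \<Longrightarrow> (- c) \<odot> x = \<ominus> (c \<odot> x)"
  by (simp add: minus_smult smult_assoc [symmetric])

lemma minus_zero [simp]: "\<ominus> \<zero> = \<zero>"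
  by (simp add: minus_smult)

lemmas distribs = mult_l_distr mult_r_distr smult_r_distr mult_minus_l mult_minus_r
  smult_minus adj_add adj_mult adj_smult adj_minus smult_mult_l smult_mult_r
  smult_assoc [symmetric] smult_one adj_adj mult_assoc minus_eq minus_add

text \<open>In a sorted, right-nested sum a term and its inverse can be separated by other summands.
  These rules cancel across a gap of one or two, inside or at the end of the sum; with
  \<open>distribs\<close> and \<open>group_simps\<close> the simplifier then decides the polynomial
  identities used later.\<close>

lemma cancel_spread:
  assumes "x \<in> carrier A" "y \<in> carrier A"
  shows "x \<oplus> (y \<oplus> (\<ominus> x)) = y" "\<ominus> x \<oplus> (y \<oplus> x) = y"
    "z \<in> carrier A \<Longrightarrow> x \<oplus> (y \<oplus> (\<ominus> x \<oplus> z)) = y \<oplus> z"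
    "z \<in> carrier A \<Longrightarrow> \<ominus> x \<oplus> (y \<oplus> (x \<oplus> z)) = y \<oplus> z"
    "z \<in> carrier A \<Longrightarrow> x \<oplus> (y \<oplus> (z \<oplus> (\<ominus> x))) = y \<oplus> z"
    "z \<in> carrier A \<Longrightarrow> \<ominus> x \<oplus> (y \<oplus> (z \<oplus> x)) = y \<oplus> z"
    "z \<in> carrier A \<Longrightarrow> w \<in> carrier A \<Longrightarrow> x \<oplus> (y \<oplus> (z \<oplus> (\<ominus> x \<oplus> w))) = y \<oplus> (z \<oplus> w)"
    "z \<in> carrier A \<Longrightarrow> w \<in> carrier A \<Longrightarrow> \<ominus> x \<oplus> (y \<oplus> (z \<oplus> (x \<oplus> w))) = y \<oplus> (z \<oplus> w)"
proof -
  have c: "x \<oplus> (y' \<oplus> (\<ominus> x)) = y'" "\<ominus> x \<oplus> (y' \<oplus> x) = y'" if "y' \<in> carrier A" for y'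
    using assms that by (simp_all add: a_comm[of y'] r_neg1 r_neg2)
  show "x \<oplus> (y \<oplus> (\<ominus> x)) = y" "\<ominus> x \<oplus> (y \<oplus> x) = y" using c assms by auto
  { assume z: "z \<in> carrier A"
    have "\<ominus> x \<oplus> z = z \<oplus> (\<ominus> x)" "x \<oplus> z = z \<oplus> x" using z assms by (auto intro: a_comm)
    then show "x \<oplus> (y \<oplus> (\<ominus> x \<oplus> z)) = y \<oplus> z" "\<ominus> x \<oplus> (y \<oplus> (x \<oplus> z)) = y \<oplus> z"
      "x \<oplus> (y \<oplus> (z \<oplus> (\<ominus> x))) = y \<oplus> z" "\<ominus> x \<oplus> (y \<oplus> (z \<oplus> x)) = y \<oplus> z"
      using c[of "y \<oplus> z"] z assms by (simp_all add: a_assoc)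
    assume w: "w \<in> carrier A"
    have "\<ominus> x \<oplus> w = w \<oplus> (\<ominus> x)" "x \<oplus> w = w \<oplus> x" using w assms by (auto intro: a_comm)
    then show "x \<oplus> (y \<oplus> (z \<oplus> (\<ominus> x \<oplus> w))) = y \<oplus> (z \<oplus> w)"
      "\<ominus> x \<oplus> (y \<oplus> (z \<oplus> (x \<oplus> w))) = y \<oplus> (z \<oplus> w)"
      using c[of "y \<oplus> (z \<oplus> w)"] z w assms by (simp_all add: a_assoc) }
qed

lemmas group_simps = a_ac r_neg l_neg add.inv_inv r_neg1 r_neg2 cancel_spread

lemma half_add: "x \<in> carrier A \<Longrightarrow> (1/2) \<odot> x \<oplus> (1/2) \<odot> x = x"
  using smult_l_distr[of x "1/2" "1/2"] by (simp add: smult_one)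

lemma half_add_left:
  "x \<in> carrier A \<Longrightarrow> y \<in> carrier A \<Longrightarrow> (1/2) \<odot> x \<oplus> ((1/2) \<odot> x \<oplus> y) = x \<oplus> y"
  using half_add[of x] by (simp add: a_assoc [symmetric])

lemma cnorm_zero [simp]: "cnorm A \<zero> = 0"
  by (simp add: cnorm_eq_0)

lemma cnorm_minus [simp]: "x \<in> carrier A \<Longrightarrow> cnorm A (\<ominus> x) = cnorm A x"
  by (simp add: minus_smult cnorm_smult)

lemma cnorm_diff: "x \<in> carrier A \<Longrightarrow> y \<in> carrier A \<Longrightarrow> cnorm A (x \<ominus> y) \<le> cnorm A x + cnorm A y"
  using cnorm_triangle[of x "\<ominus> y"] by (simp add: minus_eq)

lemma minus_swap: "x \<in> carrier A \<Longrightarrow> y \<in> carrier A \<Longrightarrow> \<ominus> (x \<ominus> y) = y \<ominus> x"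
  by (simp add: distribs group_simps)

lemma cnorm_diff_commute: "x \<in> carrier A \<Longrightarrow> y \<in> carrier A \<Longrightarrow> cnorm A (x \<ominus> y) = cnorm A (y \<ominus> x)"
  by (metis cnorm_minus minus_closed minus_swap)

lemma cnorm_diff_triangle:
  "x \<in> carrier A \<Longrightarrow> y \<in> carrier A \<Longrightarrow> z \<in> carrier A \<Longrightarrow>
    cnorm A (x \<ominus> z) \<le> cnorm A (x \<ominus> y) + cnorm A (y \<ominus> z)"
proof -
  assume *: "x \<in> carrier A" "y \<in> carrier A" "z \<in> carrier A"
  have "x \<ominus> z = (x \<ominus> y) \<oplus> (y \<ominus> z)" using * by (simp add: distribs group_simps)
  then show ?thesis using * cnorm_triangle by simp
qed

lemma diff_eq_zeroD: "x \<in> carrier A \<Longrightarrow> y \<in> carrier A \<Longrightarrow> x \<ominus> y = \<zero> \<Longrightarrow> x = y"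
  by (metis a_minus_def add.inv_closed add.inv_inv minus_equality r_neg)

lemma cnorm_eqD: "x \<in> carrier A \<Longrightarrow> y \<in> carrier A \<Longrightarrow> cnorm A (x \<ominus> y) \<le> 0 \<Longrightarrow> x = y"
  by (metis cnorm_eq_0 cnorm_nonneg diff_eq_zeroD minus_closed order_antisym)

lemma cnorm_adj [simp]: "x \<in> carrier A \<Longrightarrow> cnorm A (adj A x) = cnorm A x"
proof -
  have *: "cnorm A x \<le> cnorm A (adj A x)" if "x \<in> carrier A" for x
  proof (cases "cnorm A x = 0")
    case False
    have "(cnorm A x)\<^sup>2 \<le> cnorm A (adj A x) * cnorm A x"
      using that cstar_identity[of x] cnorm_mult[of "adj A x" x] by simp
    then show ?thesis using False cnorm_nonneg[OF that]
      by (simp add: power2_eq_square)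
  qed (use that in \<open>simp add: cnorm_nonneg\<close>)
  assume "x \<in> carrier A"
  then show ?thesis using *[of x] *[of "adj A x"] by (simp add: adj_adj)
qed

lemma cnorm_self_mult: "x \<in> carrier A \<Longrightarrow> cnorm A (x \<otimes> adj A x) = (cnorm A x)\<^sup>2"
  using cstar_identity[of "adj A x"] by (simp add: adj_adj)

lemma adj_mult_eq_0: "x \<in> carrier A \<Longrightarrow> adj A x \<otimes> x = \<zero> \<Longrightarrow> x = \<zero>"
  by (metis cnorm_eq_0 cnorm_zero cstar_identity power_eq_0_iff)

lemma cnorm_projection_le_1: "cstar_projection A p \<Longrightarrow> cnorm A p \<le> 1"
proof -
  assume p: "cstar_projection A p"
  then have "(cnorm A p)\<^sup>2 = cnorm A p" using cstar_identity[of p] by (simp add: cstar_projection_def)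
  then show ?thesis by (auto simp: power2_eq_square)
qed

lemma cnorm_partial_isometry_le_1:
  assumes s: "cstar_partial_isometry A s" shows "cnorm A s \<le> 1"
proof -
  have s: "s \<in> carrier A" "s \<otimes> (adj A s \<otimes> s) = s"
    using s by (auto simp: cstar_partial_isometry_def mult_assoc)
  then have "cnorm A (adj A s \<otimes> s) \<le> 1"
    by (intro cnorm_projection_le_1) (simp add: cstar_projection_def distribs)
  then show ?thesis using s(1) cstar_identity[OF s(1)] cnorm_nonneg[OF s(1)]
    by (simp add: power_le_one_iff)
qed

text \<open>The element \<open>p(k) b\<close>: letting polynomials act on the algebra replaces calculations in a
  unitization.\<close>

definition pact :: "'a \<Rightarrow> complex poly \<Rightarrow> 'a \<Rightarrow> 'a" where
  "pact k p b = fold_coeffs (\<lambda>c y. c \<odot> b \<oplus> k \<otimes> y) p \<zero>"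

lemma pact_0 [simp]: "pact k 0 b = \<zero>"
  by (simp add: pact_def)

lemma pact_pCons [simp]:
  "k \<in> carrier A \<Longrightarrow> b \<in> carrier A \<Longrightarrow> pact k (pCons c p) b = c \<odot> b \<oplus> k \<otimes> pact k p b"
  by (cases "c = 0 \<and> p = 0") (auto simp: pact_def)

text \<open>A bound for the operator norm of left multiplication by \<open>p(k)\<close>. It takes
  the place of the norm of \<open>p(k)\<close> in a unitization, which would be required when
  \<open>p\<close> has a constant term.\<close>

definition opbound :: "'a \<Rightarrow> complex poly \<Rightarrow> real \<Rightarrow> bool" where
  "opbound k p K \<longleftrightarrow> (\<forall>b\<in>carrier A. cnorm A (pact k p b) \<le> K * cnorm A b)"

text \<open>The adjoint relation for the algebra-valued inner product of \<open>b\<close> and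
  \<open>c\<close> given by b* c; it expresses that \<open>q(k)\<close> is the adjoint of
  \<open>p(k)\<close>.\<close>

definition adjoint_poly :: "'a \<Rightarrow> complex poly \<Rightarrow> complex poly \<Rightarrow> bool" where
  "adjoint_poly k p q \<longleftrightarrow> (\<forall>b\<in>carrier A. \<forall>c\<in>carrier A. adj A (pact k p b) \<otimes> c = adj A b \<otimes> pact k q c)"

section \<open>Calculus of operator bounds\<close>

context
  fixes k assumes k: "k \<in> carrier A"
begin

lemma pact_closed [simp]: "b \<in> carrier A \<Longrightarrow> pact k p b \<in> carrier A"
  by (induction p) (use k in auto)

lemma pact_add: "b \<in> carrier A \<Longrightarrow> pact k (p + q) b = pact k p b \<oplus> pact k q b"
  by (induction p q rule: poly_induct2)
     (use k in \<open>auto simp: smult_l_distr mult_r_distr a_ac\<close>)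

lemma pact_smult: "b \<in> carrier A \<Longrightarrow> pact k (smult c p) b = c \<odot> pact k p b"
  by (induction p) (use k in \<open>auto simp: smult_assoc smult_r_distr smult_mult_r\<close>)

lemma pact_mult: "b \<in> carrier A \<Longrightarrow> pact k (p * q) b = pact k p (pact k q b)"
  by (induction p) (use k in \<open>auto simp: pact_add pact_smult\<close>)

lemma pact_one [simp]: "b \<in> carrier A \<Longrightarrow> pact k 1 b = b"
  using pact_pCons[OF k, of b 1 0] k by (simp add: smult_one one_pCons)

lemma pact_commute: "b \<in> carrier A \<Longrightarrow> pact k p (k \<otimes> b) = k \<otimes> pact k p b"
proof -
  assume b: "b \<in> carrier A"
  have "pact k [:0, 1:] b = k \<otimes> b" if "b \<in> carrier A" for b using that k by (simp add: smult_one)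
  then show ?thesis
    using pact_mult[OF b, of p "[:0,1:]"] pact_mult[OF b, of "[:0,1:]" p] b
    by (simp only: mult.commute pact_closed)
qed

lemma opboundD: "opbound k p K \<Longrightarrow> b \<in> carrier A \<Longrightarrow> cnorm A (pact k p b) \<le> K * cnorm A b"
  by (simp add: opbound_def)

lemma opbound_mono: "opbound k p K \<Longrightarrow> K \<le> L \<Longrightarrow> opbound k p L"
  unfolding opbound_def by (meson cnorm_nonneg mult_right_mono order_trans)

lemma opbound_add: "opbound k p K \<Longrightarrow> opbound k q L \<Longrightarrow> opbound k (p + q) (K + L)"
  unfolding opbound_def
proof
  fix b assume *: "\<forall>b\<in>carrier A. cnorm A (pact k p b) \<le> K * cnorm A b"
    "\<forall>b\<in>carrier A. cnorm A (pact k q b) \<le> L * cnorm A b" "b \<in> carrier A"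
  have "cnorm A (pact k (p + q) b) \<le> cnorm A (pact k p b) + cnorm A (pact k q b)"
    using * by (simp add: pact_add cnorm_triangle)
  also have "\<dots> \<le> (K + L) * cnorm A b" using * by (simp add: distrib_right add_mono)
  finally show "cnorm A (pact k (p + q) b) \<le> (K + L) * cnorm A b" .
qed

lemma opbound_smult: "opbound k p K \<Longrightarrow> opbound k (smult c p) (cmod c * K)"
  by (auto simp: opbound_def pact_smult cnorm_smult mult.assoc intro!: mult_left_mono)

lemma opbound_mult: "opbound k p K \<Longrightarrow> opbound k q L \<Longrightarrow> K \<ge> 0 \<Longrightarrow> opbound k (p * q) (K * L)"
  unfolding opbound_def
proof
  fix b assume *: "\<forall>b\<in>carrier A. cnorm A (pact k p b) \<le> K * cnorm A b"
    "\<forall>b\<in>carrier A. cnorm A (pact k q b) \<le> L * cnorm A b" "b \<in> carrier A" "K \<ge> 0"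
  have "cnorm A (pact k (p * q) b) \<le> K * cnorm A (pact k q b)"
    using * by (simp add: pact_mult)
  also have "\<dots> \<le> K * (L * cnorm A b)" using * by (simp add: mult_left_mono)
  finally show "cnorm A (pact k (p * q) b) \<le> K * L * cnorm A b" by simp
qed

lemma opbound_1: "opbound k 1 1"
  by (simp add: opbound_def)

lemma opbound_0: "opbound k 0 0"
  by (simp add: opbound_def)

lemma opbound_power: "opbound k p K \<Longrightarrow> K \<ge> 0 \<Longrightarrow> opbound k (p ^ n) (K ^ n)"
  by (induction n) (auto intro: opbound_1 opbound_mult)

lemma opbound_sum:
  "finite I \<Longrightarrow> (\<And>i. i \<in> I \<Longrightarrow> opbound k (p i) (K i)) \<Longrightarrow> opbound k (\<Sum>i\<in>I. p i) (\<Sum>i\<in>I. K i)"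
  by (induction I rule: finite_induct) (auto intro: opbound_0 opbound_add)

lemma opbound_X: "opbound k [:0, 1:] (cnorm A k)"
  using k by (auto simp: opbound_def smult_one cnorm_mult)

lemma adjoint_poly_mult:
  "adjoint_poly k p p' \<Longrightarrow> adjoint_poly k q q' \<Longrightarrow> adjoint_poly k (p * q) (p' * q')"
  by (simp add: adjoint_poly_def pact_mult mult.commute[of p'])

lemma adjoint_poly_power: "adjoint_poly k p p' \<Longrightarrow> adjoint_poly k (p ^ n) (p' ^ n)"
  by (induction n) (auto simp: adjoint_poly_def[of k 1] intro: adjoint_poly_mult)

lemma adjoint_poly_pCons:
  assumes "adj A k = k" "adjoint_poly k p p'"
  shows "adjoint_poly k (pCons c p) (pCons (cnj c) p')"
  unfolding adjoint_poly_def
proof (intro ballI)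
  fix b d assume b: "b \<in> carrier A" "d \<in> carrier A"
  have "adj A (pact k p b) \<otimes> (k \<otimes> d) = adj A b \<otimes> pact k p' (k \<otimes> d)"
    using b k assms(2) unfolding adjoint_poly_def by simp
  then show "adj A (pact k (pCons c p) b) \<otimes> d = adj A b \<otimes> pact k (pCons (cnj c) p') d"
    using b k assms(1) by (simp add: distribs pact_commute)
qed

lemma adjoint_poly_0: "adjoint_poly k 0 0"
  by (simp add: adjoint_poly_def)

text \<open>The C*-identity for left multiplication operators: the square of the norm of
  \<open>p(k) b\<close> is the norm of b* p'(k) p(k) b.\<close>

lemma opbound_cstar:
  assumes "adjoint_poly k p p'" "opbound k (p' * p) (K\<^sup>2)" "K \<ge> 0"
  shows "opbound k p K"
  unfolding opbound_def
proof
  fix b assume b: "b \<in> carrier A"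
  have "(cnorm A (pact k p b))\<^sup>2 = cnorm A (adj A b \<otimes> pact k (p' * p) b)"
    using b assms(1) cstar_identity[of "pact k p b"] by (simp add: adjoint_poly_def pact_mult)
  also have "\<dots> \<le> cnorm A b * (K\<^sup>2 * cnorm A b)"
    using b cnorm_mult[of "adj A b" "pact k (p' * p) b"] opboundD[OF assms(2) b]
    by simp (meson cnorm_nonneg mult_left_mono order_trans)
  also have "\<dots> = (K * cnorm A b)\<^sup>2" by (simp add: power2_eq_square)
  finally show "cnorm A (pact k p b) \<le> K * cnorm A b"
    using assms(3) b cnorm_nonneg by (meson mult_nonneg_nonneg power2_le_imp_le)
qed

text \<open>For self-adjoint \<open>p\<close> each application of \<open>opbound_cstar\<close>
  halves the exponent and takes the square root of the bound.\<close>

lemma opbound_root: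
  assumes "adjoint_poly k p p" "L \<ge> 0" "opbound k (p ^ (2 ^ m)) (L ^ (2 ^ m))"
  shows "opbound k p L"
  using assms(3)
proof (induction m)
  case (Suc m)
  have "opbound k (p ^ (2 ^ m)) (L ^ (2 ^ m))"
  proof (rule opbound_cstar)
    show "adjoint_poly k (p ^ 2 ^ m) (p ^ 2 ^ m)" using assms(1) by (rule adjoint_poly_power)
    show "opbound k (p ^ 2 ^ m * p ^ 2 ^ m) ((L ^ 2 ^ m)\<^sup>2)"
      using Suc.prems by (simp add: power_add [symmetric] power_mult [symmetric] mult_2 mult.commute[of _ 2])
  qed (use assms in auto)
  then show ?case by (rule Suc.IH)
qed auto

lemma opbound_closed:
  assumes "\<And>L. L > K \<Longrightarrow> opbound k p L"
  shows "opbound k p K"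
  unfolding opbound_def
proof
  fix b assume b: "b \<in> carrier A"
  show "cnorm A (pact k p b) \<le> K * cnorm A b"
  proof (rule field_le_epsilon)
    fix e :: real assume e: "e > 0"
    \<comment> \<open>The summand 1 keeps the denominator positive when
      \<open>b = 0\<close>.\<close>
    have "opbound k p (K + e / (1 + cnorm A b))"
      using b e cnorm_nonneg by (intro assms) (auto intro!: divide_pos_pos add_pos_nonneg)
    from opboundD[OF this b] have "cnorm A (pact k p b) \<le> K * cnorm A b + e * (cnorm A b / (1 + cnorm A b))"
      by (simp add: algebra_simps)
    also have "\<dots> \<le> K * cnorm A b + e * 1"
      using e cnorm_nonneg[OF b] by (intro add_left_mono mult_left_mono) (auto simp: divide_simps)
    finally show "cnorm A (pact k p b) \<le> K * cnorm A b + e" by simp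
  qed
qed

text \<open>A substitute for the spectral radius formula: after taking \<open>m\<close> square roots
  a bound that is linear in \<open>2 ^ m\<close> tends to 1.\<close>

lemma opbound_contraction:
  assumes "adjoint_poly k p p" and "\<And>m. opbound k (p ^ (2 ^ m)) (c * 2 ^ m)"
  shows "opbound k p 1"
proof (rule opbound_closed)
  fix L :: real assume L: "L > 1"
  obtain m where "c * 2 ^ m \<le> L ^ (2 ^ m)" using exceeds_linear[OF L] by blast
  then show "opbound k p L" using L assms by (intro opbound_root[of p L m]) (auto intro: opbound_mono)
qed

end

end

section \<open>Cauchy's estimate over roots of unity\<close>

lemma coeff_linear_power: "coeff ([:1, a:] ^ n) i = of_nat (n choose i) * a ^ i" for a :: complex
proof (cases "i \<le> n")
  case True
  then show ?thesis by (simp add: coeff_linear_poly_power)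
next
  case False
  have "degree ([:1, a:] ^ n) \<le> n"
    using degree_power_le[of "[:1, a:]" n] by (auto intro: order_trans split: if_splits)
  then show ?thesis using False by (simp add: coeff_eq_0 binomial_eq_0)
qed

text \<open>A discrete Cauchy formula. Since \<open>w ^ Suc N = 1\<close>, the weight
  \<open>w ^ (j * N)\<close> is the inverse of \<open>w ^ j\<close> and selects the linear
  coefficient \<open>N * t\<close>; \<open>Suc N\<close> nodes suffice for a polynomial of degree at
  most \<open>N\<close>.\<close>

lemma linear_coeff_average:
  fixes t :: complex
  assumes N: "N > 0"
  defines "w \<equiv> cis (2 * pi / real (Suc N))"
  shows "(\<Sum>j<Suc N. smult (w ^ (j * N)) ([:1, t * w ^ j:] ^ N)) =
    smult (of_nat (Suc N) * of_nat N * t) [:0, 1:]"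
proof (rule poly_eqI)
  fix i
  have "coeff (\<Sum>j<Suc N. smult (w ^ (j * N)) ([:1, t * w ^ j:] ^ N)) i =
      (\<Sum>j<Suc N. of_nat (N choose i) * t ^ i * (w ^ (N + i)) ^ j)"
    by (simp add: coeff_sum coeff_linear_power power_mult_distrib power_mult [symmetric] power_add
        mult_ac add_mult_distrib2)
  also have "\<dots> = of_nat (N choose i) * t ^ i * (\<Sum>j<Suc N. (w ^ (N + i)) ^ j)"
    by (simp only: sum_distrib_left)
  also have "\<dots> = of_nat (N choose i) * t ^ i * (if Suc N dvd N + i then of_nat (Suc N) else 0)"
    unfolding w_def by (subst sum_root_of_unity_powers) auto
  also have "\<dots> = coeff (smult (of_nat (Suc N) * of_nat N * t) [:0, 1:]) i"
  proof (cases "i = 1")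
    case False
    \<comment> \<open>For \<open>i \<le> N\<close> the number \<open>N + i\<close> lies between
      \<open>N\<close> and \<open>2 N\<close>, where \<open>N + 1\<close> is the only multiple of
      \<open>Suc N\<close>; this is the excluded case \<open>i = 1\<close>.\<close>
    have "\<not> Suc N dvd N + i" if "i \<le> N"
    proof
      assume "Suc N dvd N + i"
      then obtain c where c: "N + i = Suc N * c" by (elim dvdE)
      consider "c = 0" | "c = 1" | "c \<ge> 2" by linarith
      then show False
      proof cases
        case 3
        then have "Suc N * 2 \<le> Suc N * c" by (rule mult_le_mono2)
        then show False using c that by simp
      qed (use c False N in auto)
    qed
    then show ?thesis using False by (auto simp: binomial_eq_0 coeff_pCons split: nat.splits)
  qed (auto simp: algebra_simps)
  finally show "coeff (\<Sum>j<Suc N. smult (w ^ (j * N)) ([:1, t * w ^ j:] ^ N)) i =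
    coeff (smult (of_nat (Suc N) * of_nat N * t) [:0, 1:]) i" .
qed

context cstar_algebra
begin

text \<open>Cauchy's estimate for the linear coefficient of \<open>(1 + z k)^N\<close> on the circle
  \<open>\<bar>z\<bar> = d / sqrt N\<close> bounds \<open>sqrt N \<parallel>k\<parallel>\<close> independently of \<open>N\<close>.\<close>

lemma linear_opbound_imp_zero:
  assumes k: "k \<in> carrier A" and d: "d > 0" and C: "C \<ge> 0"
    and bd: "\<And>z. cmod z \<le> d \<Longrightarrow> opbound k [:1, z:] (1 + C * (cmod z)\<^sup>2)"
  shows "k = \<zero>"
proof -
  \<comment> \<open>On the circle of radius \<open>t\<close> with
    \<open>N * t\<^sup>2 = d\<^sup>2\<close>, the bound \<open>(1 + C * t\<^sup>2) ^ N\<close> is at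
    most \<open>exp (C * d\<^sup>2)\<close>, whatever \<open>N\<close> is.\<close>
  define D where "D = exp (C * d\<^sup>2)"
  have key: "d * sqrt (real N) * cnorm A (k \<otimes> b) \<le> D * cnorm A b" if N: "N > 0" and b: "b \<in> carrier A" for N b
  proof -
    define t where "t = d / sqrt (real N)"
    define w where "w = cis (2 * pi / real (Suc N))"
    have t: "0 < t" "t \<le> d" "real N * t\<^sup>2 = d\<^sup>2" "real N * t = d * sqrt (real N)"
      using N d by (auto simp: t_def field_simps power_divide real_div_sqrt)
    have "opbound k ([:1, of_real t * w ^ j:] ^ N) D" for j
    proof -
      have n: "cmod (of_real t * w ^ j) = t" using t by (simp add: norm_mult norm_power w_def)
      then have "opbound k ([:1, of_real t * w ^ j:] ^ N) ((1 + C * t\<^sup>2) ^ N)"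
        using bd[of "of_real t * w ^ j"] k t C by (intro opbound_power) auto
      moreover have "(1 + C * t\<^sup>2) ^ N \<le> D"
      proof -
        have "(1 + C * t\<^sup>2) ^ N \<le> exp (C * t\<^sup>2) ^ N"
          using C by (intro power_mono) auto
        also have "\<dots> = D" using t by (simp add: D_def exp_of_nat_mult [symmetric] mult_ac)
        finally show ?thesis .
      qed
      ultimately show ?thesis using k opbound_mono by blast
    qed
    then have "opbound k (smult (w ^ (j * N)) ([:1, of_real t * w ^ j:] ^ N)) D" for j
      using opbound_smult[OF k, of "[:1, of_real t * w ^ j:] ^ N" D "w ^ (j * N)"]
      by (simp add: norm_power w_def)
    then have "opbound k (\<Sum>j<Suc N. smult (w ^ (j * N)) ([:1, of_real t * w ^ j:] ^ N)) (\<Sum>j<Suc N. D)"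
      by (intro opbound_sum[OF k]) auto
    then have "opbound k (smult (of_nat (Suc N) * of_nat N * of_real t) [:0, 1:]) (real (Suc N) * D)"
      unfolding w_def linear_coeff_average[OF N] by (simp add: algebra_simps)
    from opboundD[OF k this b]
    have "cnorm A (pact k (smult (of_nat (Suc N) * of_nat N * of_real t) [:0, 1:]) b) \<le> real (Suc N) * (D * cnorm A b)"
      by (simp only: mult.assoc)
    moreover have "cnorm A (pact k (smult (of_nat (Suc N) * of_nat N * of_real t) [:0, 1:]) b) =
        real (Suc N) * (real N * t) * cnorm A (k \<otimes> b)"
      using b k t by (simp only: pact_smult[OF k b])
        (simp add: cnorm_smult norm_mult smult_one del: of_nat_Suc)
    ultimately have "real (Suc N) * (real N * t) * cnorm A (k \<otimes> b) \<le> real (Suc N) * (D * cnorm A b)"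
      by simp
    then have "real (Suc N) * (real N * t * cnorm A (k \<otimes> b)) \<le> real (Suc N) * (D * cnorm A b)"
      by (simp only: mult.assoc)
    then show ?thesis unfolding t(4) by (rule mult_left_le_imp_le) simp
  qed
  have "cnorm A (k \<otimes> adj A k) = 0"
  proof (rule ccontr)
    assume "cnorm A (k \<otimes> adj A k) \<noteq> 0"
    then have p: "cnorm A (k \<otimes> adj A k) > 0" using k cnorm_nonneg[of "k \<otimes> adj A k"] by simp
    \<comment> \<open>With \<open>b = adj A k\<close> the left side of \<open>key\<close> grows like
      \<open>sqrt N\<close> while the right side is constant; this \<open>N\<close> is large enough
      for a contradiction.\<close>
    obtain N :: nat where N: "((D * cnorm A k + 1) / (d * cnorm A (k \<otimes> adj A k)))\<^sup>2 < real N"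
      using reals_Archimedean2 by blast
    have "((D * cnorm A k + 1) / (d * cnorm A (k \<otimes> adj A k))) < sqrt (real N)"
      using N real_less_rsqrt by blast
    then have "D * cnorm A k + 1 < d * sqrt (real N) * cnorm A (k \<otimes> adj A k)"
      using p d by (simp add: field_simps)
    moreover have "N > 0" using N by (metis of_nat_0 gr0I not_less zero_le_power2)
    ultimately show False using key[of N "adj A k"] k by auto
  qed
  then show ?thesis using k by (simp add: cnorm_self_mult cnorm_eq_0)
qed

section \<open>The order of projections\<close>

text \<open>The C*-identity would give the square root of \<open>1 + r * cnorm A a ^ n\<close>. It
  is given away by \<open>K \<le> K\<^sup>2\<close>, because only the order of the error in
  \<open>r\<close> matters.\<close>

lemma opbound_square_eq:
  assumes a: "a \<in> carrier A" and p: "adjoint_poly a p p'" "p' * p = 1 + smult (of_real r) ([:0, 1:] ^ n)"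
    and r: "r \<ge> 0"
  shows "opbound a p (1 + r * cnorm A a ^ n)"
proof (rule opbound_cstar[OF a p(1)])
  define K where "K = 1 + r * cnorm A a ^ n"
  have K: "K \<ge> 1" using r a by (simp add: K_def cnorm_nonneg)
  have "opbound a ([:0, 1:] ^ n) (cnorm A a ^ n)"
    using a cnorm_nonneg opbound_X opbound_power by blast
  from opbound_smult[OF a this, of "of_real r"]
  have "opbound a (1 + smult (of_real r) ([:0, 1:] ^ n)) K"
    unfolding K_def using a r by (intro opbound_add opbound_1) simp_all
  moreover have "K \<le> K\<^sup>2" using K by (simp add: power2_eq_square)
  ultimately show "opbound a (p' * p) (K\<^sup>2)" unfolding p(2) using a opbound_mono by blast
  show "0 \<le> K" using K by simp
qed

text \<open>\<open>1 - t a\<^sup>2\<close> is the mean of the elements \<open>1 \<plusminus> i sqrt (2t) a - t a\<^sup>2\<close>, and their absolute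
  squares are both equal to \<open>1 + t\<^sup>2 a^4\<close>.\<close>

lemma opbound_square:
  assumes a: "a \<in> carrier A" "adj A a = a" and t: "t \<ge> 0"
  shows "opbound a [:1, 0, - of_real t:] (1 + t\<^sup>2 * (cnorm A a) ^ 4)"
proof -
  \<comment> \<open>For purely imaginary \<open>c\<close> of modulus \<open>s\<close> the product of
    the two conjugate polynomials has no linear term, and its quadratic coefficient
    \<open>s\<^sup>2 - 2 * t\<close> vanishes.\<close>
  define s where "s = sqrt (2 * t)"
  have s: "complex_of_real s * complex_of_real s = 2 * of_real t"
  proof -
    have "s * s = 2 * t" using t by (simp add: s_def)
    then show ?thesis by (metis of_real_mult of_real_numeral)
  qed
  define K where "K = 1 + t\<^sup>2 * (cnorm A a) ^ 4"
  have b: "opbound a [:1, c, - of_real t:] K" if c: "c = \<i> * of_real s \<or> c = - \<i> * of_real s" for c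
    unfolding K_def
  proof (rule opbound_square_eq[OF a(1)])
    show "adjoint_poly a [:1, c, - of_real t:] [:1, cnj c, - of_real t:]"
      using adjoint_poly_pCons[OF a adjoint_poly_pCons[OF a adjoint_poly_pCons[OF a adjoint_poly_0]],
          of 1 c "- of_real t"] a by simp
    have "(\<i> * of_real s) * (\<i> * of_real s) = - (complex_of_real s * of_real s)"
      by (simp add: complex_eq_iff)
    then have "cnj c = - c" "c * c = - (2 * of_real t)" using c s by auto
    then show "[:1, cnj c, - of_real t:] * [:1, c, - of_real t:] = 1 + smult (of_real (t\<^sup>2)) ([:0, 1:] ^ 4)"
      by (simp add: one_pCons power4_eq_xxxx power2_eq_square)
  qed simp
  have "[:1, 0, - of_real t:] = smult (1/2) ([:1, \<i> * of_real s, - of_real t:] + [:1, - \<i> * of_real s, - of_real t:])"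
    by simp
  moreover have "opbound a (smult (1/2) ([:1, \<i> * of_real s, - of_real t:] + [:1, - \<i> * of_real s, - of_real t:])) (cmod (1/2) * (K + K))"
    using a b by (intro opbound_smult opbound_add) auto
  ultimately show ?thesis by (simp add: K_def add_divide_distrib)
qed

text \<open>In the imaginary direction the first-order terms cancel for every self-adjoint
  \<open>a\<close>, positive or not, since the absolute square of \<open>1 + \<i> s a\<close> is
  \<open>1 + s\<^sup>2 a\<^sup>2\<close>.\<close>

lemma opbound_imaginary:
  assumes a: "a \<in> carrier A" "adj A a = a"
  shows "opbound a [:1, \<i> * of_real s:] (1 + s\<^sup>2 * (cnorm A a)\<^sup>2)"
proof (rule opbound_square_eq[OF a(1)])
  show "adjoint_poly a [:1, \<i> * of_real s:] [:1, - \<i> * of_real s:]"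
    using adjoint_poly_pCons[OF a adjoint_poly_pCons[OF a adjoint_poly_0], of 1 "\<i> * of_real s"] a by simp
  show "[:1, - \<i> * of_real s:] * [:1, \<i> * of_real s:] = 1 + smult (of_real (s\<^sup>2)) ([:0, 1:]\<^sup>2)"
    by (simp add: one_pCons power2_eq_square complex_eq_iff)
qed simp

lemma adjoint_poly_real:
  "a \<in> carrier A \<Longrightarrow> adj A a = a \<Longrightarrow> adjoint_poly a [:1, of_real t:] [:1, of_real t:]"
  using adjoint_poly_pCons[OF _ _ adjoint_poly_pCons[OF _ _ adjoint_poly_0], of a 1 "of_real t"] by simp

text \<open>Induction from the identity of \<open>(w v) w\<close> and \<open>w (v w)\<close>. It
  plays the role of the coincidence of the non-zero spectra of \<open>w v\<close> and
  \<open>v w\<close>.\<close>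

lemma pact_swap:
  assumes w: "w \<in> carrier A" "v \<in> carrier A" "b \<in> carrier A"
  shows "pact (w \<otimes> v) p (w \<otimes> b) = w \<otimes> pact (v \<otimes> w) p b"
  by (induction p) (use w in \<open>auto simp: distribs\<close>)

text \<open>\<open>(1 + t w w* )^N - 1 = w r w*\<close>, where \<open>r\<close> is \<open>t\<close> times a sum of \<open>N\<close> contractions; this
  grows only linearly in \<open>N\<close>.\<close>

lemma opbound_swap:
  assumes w: "w \<in> carrier A" and bd: "opbound (adj A w \<otimes> w) [:1, complex_of_real t:] 1"
  shows "opbound (w \<otimes> adj A w) [:1, complex_of_real t:] 1"
proof (rule opbound_contraction)
  define k m where "k = w \<otimes> adj A w" and "m = adj A w \<otimes> w"
  have car: "k \<in> carrier A" "m \<in> carrier A" using w by (auto simp: k_def m_def)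
  show "w \<otimes> adj A w \<in> carrier A" using w by simp
  show "adjoint_poly (w \<otimes> adj A w) [:1, complex_of_real t:] [:1, complex_of_real t:]"
    using w by (intro adjoint_poly_real) (simp_all add: distribs)
  \<comment> \<open>As \<open>N \<ge> 1\<close>, the constant term 1 of the final bound is absorbed:
    \<open>1 + (cnorm A w)\<^sup>2 * \<bar>t\<bar> * N \<le> c * N\<close>.\<close>
  define c where "c = 1 + \<bar>t\<bar> * (cnorm A w)\<^sup>2"
  fix j
  define N :: nat where "N = 2 ^ j"
  define r where "r = smult (of_real t) (\<Sum>i<N. [:1, complex_of_real t:] ^ i)"
  have "[:1, complex_of_real t:] ^ N - 1 = ([:1, complex_of_real t:] - 1) * (\<Sum>i<N. [:1, complex_of_real t:] ^ i)"
    by (rule power_diff_1_eq)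
  also have "[:1, complex_of_real t:] - 1 = smult (complex_of_real t) [:0, 1:]" by (simp add: one_pCons)
  finally have e: "[:1, complex_of_real t:] ^ N = 1 + [:0, 1:] * r"
    unfolding r_def by (simp add: algebra_simps)
  have r: "opbound m r (\<bar>t\<bar> * real N)"
  proof -
    have "opbound m (smult (of_real t) (\<Sum>i<N. [:1, complex_of_real t:] ^ i)) (cmod (of_real t) * (\<Sum>i<N. 1 ^ i))"
      using car bd by (intro opbound_smult opbound_sum opbound_power) (auto simp: m_def)
    then show ?thesis by (simp add: r_def)
  qed
  have "opbound k ([:1, complex_of_real t:] ^ N) (1 + (cnorm A w)\<^sup>2 * (\<bar>t\<bar> * real N))"
    unfolding opbound_def
  proof
    fix b assume b: "b \<in> carrier A"
    have "pact k ([:1, complex_of_real t:] ^ N) b = b \<oplus> k \<otimes> pact k r b"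
      unfolding e using b car by (simp add: pact_add pact_mult smult_one del: mult_pCons_left)
    \<comment> \<open>Swapping moves \<open>r\<close> from \<open>k\<close> to \<open>m\<close>,
      where the powers it sums are contractions by hypothesis.\<close>
    also have "k \<otimes> pact k r b = w \<otimes> pact m r (adj A w \<otimes> b)"
      using pact_swap[of w "adj A w" "adj A w \<otimes> b" r] pact_commute[OF car(1) b, of r] w b
      unfolding k_def m_def by (simp add: mult_assoc)
    finally have "cnorm A (pact k ([:1, complex_of_real t:] ^ N) b) \<le> cnorm A b + cnorm A (w \<otimes> pact m r (adj A w \<otimes> b))"
      using b w car by (simp add: cnorm_triangle)
    also have "cnorm A (w \<otimes> pact m r (adj A w \<otimes> b)) \<le> cnorm A w * cnorm A (pact m r (adj A w \<otimes> b))"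
      using b w car by (intro cnorm_mult) simp_all
    also have "\<dots> \<le> cnorm A w * (\<bar>t\<bar> * real N * (cnorm A w * cnorm A b))"
    proof (intro mult_left_mono)
      have "cnorm A (pact m r (adj A w \<otimes> b)) \<le> \<bar>t\<bar> * real N * cnorm A (adj A w \<otimes> b)"
        using r car w b by (intro opboundD) auto
      also have "\<dots> \<le> \<bar>t\<bar> * real N * (cnorm A w * cnorm A b)"
        using cnorm_mult[of "adj A w" b] w b by (intro mult_left_mono) auto
      finally show "cnorm A (pact m r (adj A w \<otimes> b)) \<le> \<bar>t\<bar> * real N * (cnorm A w * cnorm A b)" .
    qed (use w cnorm_nonneg in auto)
    finally show "cnorm A (pact k ([:1, complex_of_real t:] ^ N) b) \<le> (1 + (cnorm A w)\<^sup>2 * (\<bar>t\<bar> * real N)) * cnorm A b"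
      by (simp add: algebra_simps power2_eq_square)
  qed
  moreover have "1 + (cnorm A w)\<^sup>2 * (\<bar>t\<bar> * real N) \<le> c * real N"
    by (simp add: c_def N_def algebra_simps)
  ultimately show "opbound (w \<otimes> adj A w) ([:1, complex_of_real t:] ^ (2 ^ j)) (c * 2 ^ j)"
    using car opbound_mono unfolding k_def N_def by fastforce
qed

text \<open>\<open>1 + (p/6) k\<close> is the mean of \<open>1 + p a\<^sup>2\<close>,
  \<open>1 + p c\<^sup>2\<close> and \<open>1 - (p/2) m\<close>: a third of \<open>p\<close> is
  \<open>p/6\<close> times the coefficient 2 of the squares.\<close>

lemma opbound_convex3:
  fixes K L M :: real
  assumes k: "k \<in> carrier A" "a \<in> carrier A" "c \<in> carrier A" "m \<in> carrier A"
    and K: "opbound a [:1, 0, p:] K" and L: "opbound c [:1, 0, p:] L" and M: "opbound m [:1, - p / 2:] M"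
    and e: "k = 2 \<odot> (a \<otimes> a) \<oplus> 2 \<odot> (c \<otimes> c) \<oplus> (\<ominus> m)"
  shows "opbound k [:1, p / 6:] ((K + L + M) / 3)"
  unfolding opbound_def
proof
  fix b assume b: "b \<in> carrier A"
  have third: "(1/3) \<odot> b \<oplus> ((1/3) \<odot> b \<oplus> ((1/3) \<odot> b \<oplus> r)) = b \<oplus> r" if "r \<in> carrier A" for r
    using b that smult_l_distr[of b "1/3" "1/3"] smult_l_distr[of b "2/3" "1/3"]
    by (simp add: smult_one a_assoc [symmetric])
  have "pact k [:1, p / 6:] b = (1/3) \<odot> (pact a [:1, 0, p:] b \<oplus> pact c [:1, 0, p:] b \<oplus> pact m [:1, - p / 2:] b)"
    using k b by (simp add: e distribs group_simps smult_minus_l third)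
  also have "cnorm A \<dots> \<le> 1/3 * (K * cnorm A b + L * cnorm A b + M * cnorm A b)"
  proof -
    have "cnorm A (pact a [:1, 0, p:] b \<oplus> pact c [:1, 0, p:] b \<oplus> pact m [:1, - p / 2:] b) \<le>
      cnorm A (pact a [:1, 0, p:] b) + cnorm A (pact c [:1, 0, p:] b) + cnorm A (pact m [:1, - p / 2:] b)"
      using k b by (smt (verit) cnorm_triangle a_closed pact_closed)
    then show ?thesis
      using opboundD[OF k(2) K b] opboundD[OF k(3) L b] opboundD[OF k(4) M b] k b
      by (simp add: cnorm_smult)
  qed
  finally show "cnorm A (pact k [:1, p / 6:] b) \<le> (K + L + M) / 3 * cnorm A b"
    by (simp add: algebra_simps)
qed

text \<open>The element \<open>k = w w*\<close> is negative like \<open>w* w\<close>, but it is also \<open>2 (Re w)\<^sup>2 + 2 (Im w)\<^sup>2 - w* w\<close>,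
  a sum of positive elements.  Hence \<open>\<parallel>1 + z k\<parallel> \<le> 1 + O(\<bar>z\<bar>\<^sup>2)\<close> in every complex direction.\<close>

lemma negative_square_eq_zero:
  assumes w: "w \<in> carrier A"
    and bd: "\<And>t. 0 \<le> t \<Longrightarrow> t \<le> 1 \<Longrightarrow> opbound (adj A w \<otimes> w) [:1, of_real t:] 1"
  shows "w = \<zero>"
proof -
  define k m where "k = w \<otimes> adj A w" and "m = adj A w \<otimes> w"
  have car: "k \<in> carrier A" "m \<in> carrier A" using w by (auto simp: k_def m_def)
  have sa: "adj A k = k" using w by (simp add: k_def distribs)
  define a where "a = (1/2) \<odot> (w \<oplus> adj A w)"
  \<comment> \<open>\<open>a\<close> is the real part of \<open>w\<close>, and \<open>c\<close> is
    minus its imaginary part; only the square of \<open>c\<close> enters.\<close>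
  define c where "c = (\<i>/2) \<odot> (w \<ominus> adj A w)"
  have ac: "a \<in> carrier A" "c \<in> carrier A" "adj A a = a" "adj A c = c"
    using w by (simp_all add: a_def c_def distribs smult_minus_l group_simps)
  have "2 \<odot> (a \<otimes> a) \<oplus> 2 \<odot> (c \<otimes> c) = k \<oplus> m"
    using w by (simp add: a_def c_def k_def m_def distribs smult_minus_l group_simps half_add half_add_left)
  then have e: "k = 2 \<odot> (a \<otimes> a) \<oplus> 2 \<odot> (c \<otimes> c) \<oplus> (\<ominus> m)"
    using car by (simp add: group_simps)
  \<comment> \<open>The 36 comes from the substitution \<open>s = - 6 * t\<close> below, of whose
    error the mean of three uses a third. The last summand serves the imaginary direction.\<close>
  define C where "C = 36 * (cnorm A a ^ 4 + cnorm A c ^ 4) + (cnorm A k)\<^sup>2"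
  have C0: "C \<ge> 0" by (simp add: C_def)
  have re: "opbound k [:1, of_real t:] (1 + C * t\<^sup>2)" if t: "\<bar>t\<bar> \<le> 1/6" for t
  proof (cases "t \<ge> 0")
    case True
    have "opbound k [:1, of_real t:] 1"
      using opbound_swap[OF w bd, of t] True t by (simp add: k_def)
    then show ?thesis using car C0 by (auto elim!: opbound_mono)
  next
    case False
    \<comment> \<open>For negative \<open>t\<close> the representation by squares is used with
      \<open>p = - s\<close>, so that \<open>p / 6 = t\<close>. The third term is then
      \<open>1 + (s/2) m\<close> with a nonnegative coefficient, which the hypothesis on w* w
      covers.\<close>
    define s where "s = - 6 * t"
    have s: "0 \<le> s" "s \<le> 1" using False t by (auto simp: s_def)
    have "opbound k [:1, (- of_real s) / 6:] ((1 + s\<^sup>2 * cnorm A a ^ 4 + (1 + s\<^sup>2 * cnorm A c ^ 4) + 1) / 3)"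
    proof (rule opbound_convex3[OF car(1) ac(1,2) car(2) _ _ _ e])
      show "opbound m [:1, - (- of_real s) / 2:] 1"
        using bd[of "s / 2"] s by (simp add: m_def)
    qed (use ac s in \<open>auto intro: opbound_square\<close>)
    moreover have "(- of_real s) / 6 = complex_of_real t" by (simp add: s_def)
    moreover have "(1 + s\<^sup>2 * cnorm A a ^ 4 + (1 + s\<^sup>2 * cnorm A c ^ 4) + 1) / 3 =
        1 + 12 * (cnorm A a ^ 4 + cnorm A c ^ 4) * t\<^sup>2"
      by (simp add: s_def algebra_simps power2_eq_square)
    moreover have "12 * (cnorm A a ^ 4 + cnorm A c ^ 4) * t\<^sup>2 \<le> C * t\<^sup>2"
      by (intro mult_right_mono) (auto simp: C_def)
    ultimately show ?thesis using car opbound_mono by fastforce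
  qed
  have im: "opbound k [:1, \<i> * of_real t:] (1 + C * t\<^sup>2)" for t
  proof -
    have "(cnorm A k)\<^sup>2 * t\<^sup>2 \<le> C * t\<^sup>2" by (intro mult_right_mono) (auto simp: C_def)
    then show ?thesis
      using opbound_mono[OF car(1) opbound_imaginary[OF car(1) sa, of t], of "1 + C * t\<^sup>2"]
      by (simp add: mult.commute)
  qed
  have "k = \<zero>"
  \<comment> \<open>\<open>1 + z k\<close> is the mean of \<open>1 + 2 (Re z) k\<close> and
    \<open>1 + 2 \<i> (Im z) k\<close>. The doubled real part must stay within 1/6, hence the radius
    1/12; the mean error \<open>2 * C * (cmod z)\<^sup>2\<close> is within the bound.\<close>
  proof (rule linear_opbound_imp_zero[OF car(1), of "1/12" "4 * C"])
    fix z :: complex assume z: "cmod z \<le> 1/12"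
    have "\<bar>2 * Re z\<bar> \<le> 1/6" using abs_Re_le_cmod[of z] z by linarith
    from re[OF this] im[of "2 * Im z"]
    have "opbound k (smult (1/2) ([:1, of_real (2 * Re z):] + [:1, \<i> * of_real (2 * Im z):]))
        (cmod (1/2) * ((1 + C * (2 * Re z)\<^sup>2) + (1 + C * (2 * Im z)\<^sup>2)))"
      using car by (intro opbound_smult opbound_add) auto
    moreover have "smult (1/2) ([:1, of_real (2 * Re z):] + [:1, \<i> * of_real (2 * Im z):]) = [:1, z:]"
      by (simp add: complex_eq_iff)
    moreover have "cmod (1/2) * ((1 + C * (2 * Re z)\<^sup>2) + (1 + C * (2 * Im z)\<^sup>2)) \<le> 1 + 4 * C * (cmod z)\<^sup>2"
    proof -
      have "cmod (1/2) * ((1 + C * (2 * Re z)\<^sup>2) + (1 + C * (2 * Im z)\<^sup>2)) = 1 + 2 * (C * (cmod z)\<^sup>2)"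
        unfolding cmod_power2 by (simp add: algebra_simps power2_eq_square)
      moreover have "C * (cmod z)\<^sup>2 \<ge> 0" using C0 by simp
      ultimately show ?thesis by linarith
    qed
    ultimately show "opbound k [:1, z:] (1 + 4 * C * (cmod z)\<^sup>2)"
      using opbound_mono[OF car(1)] by auto
  qed (use C0 in auto)
  then have "(cnorm A w)\<^sup>2 = 0" using cnorm_self_mult[OF w] by (simp add: k_def)
  then show ?thesis using w by (simp add: cnorm_eq_0)
qed

text \<open>Powers of \<open>1 - x + x y x\<close> are \<open>1 - x + (x y x)^n\<close>, of norm at most 3.\<close>

lemma opbound_complement:
  assumes x: "x \<in> carrier A" "adj A x = x" "x \<otimes> x = x"
    and y: "y \<in> carrier A" "adj A y = y" "y \<otimes> y = y"
  shows "opbound (x \<ominus> x \<otimes> y \<otimes> x) [:1, - 1:] 1"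
proof (rule opbound_contraction)
  define h g where "h = x \<ominus> x \<otimes> y \<otimes> x" and "g = x \<otimes> y \<otimes> x"
  have car: "h \<in> carrier A" "g \<in> carrier A" using x y by (auto simp: h_def g_def)
  show "x \<ominus> x \<otimes> y \<otimes> x \<in> carrier A" using x y by simp
  have "adj A (x \<ominus> x \<otimes> y \<otimes> x) = x \<ominus> x \<otimes> y \<otimes> x" using x y by (simp add: distribs)
  then show "adjoint_poly (x \<ominus> x \<otimes> y \<otimes> x) [:1, - 1:] [:1, - 1:]"
    using x y adjoint_poly_real[of "x \<ominus> x \<otimes> y \<otimes> x" "-1"] by simp
  have le1: "cnorm A x \<le> 1" "cnorm A y \<le> 1"
    using x y by (auto intro!: cnorm_projection_le_1 simp: cstar_projection_def)
  have xb: "cnorm A (x \<otimes> b) \<le> cnorm A b" if "b \<in> carrier A" for b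
    using cnorm_mult[of x b] le1(1) x that cnorm_nonneg[of b] by (smt (verit) mult_left_le_one_le cnorm_nonneg)
  have yb: "cnorm A (y \<otimes> b) \<le> cnorm A b" if "b \<in> carrier A" for b
    using cnorm_mult[of y b] le1(2) y that cnorm_nonneg[of b] by (smt (verit) mult_left_le_one_le cnorm_nonneg)
  have g1: "opbound g [:0, 1:] 1"
    unfolding opbound_def
  proof
    fix b assume b: "b \<in> carrier A"
    have "pact g [:0, 1:] b = x \<otimes> (y \<otimes> (x \<otimes> b))"
      using b x y by (simp add: g_def smult_one mult_assoc)
    then show "cnorm A (pact g [:0, 1:] b) \<le> 1 * cnorm A b"
      using xb[of "y \<otimes> (x \<otimes> b)"] yb[of "x \<otimes> b"] xb[of b] b x y by simp
  qed
  have xx: "x \<otimes> (x \<otimes> b) = x \<otimes> b" if "b \<in> carrier A" for b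
    using x that by (simp add: mult_assoc [symmetric])
  have gx: "g \<otimes> (x \<otimes> b) = g \<otimes> b" "x \<otimes> (g \<otimes> b) = g \<otimes> b" if "b \<in> carrier A" for b
    using x y that by (simp_all add: g_def mult_assoc xx)
  \<comment> \<open>The exponent starts at 1: for exponent 0 the right side would be
    \<open>2 b - x b\<close> instead of \<open>b\<close>.\<close>
  have ind: "pact h ([:1, - 1:] ^ Suc n) b = b \<ominus> x \<otimes> b \<oplus> pact g ([:0, 1:] ^ Suc n) b"
    if b: "b \<in> carrier A" for n b
  proof (induction n)
    case 0
    show ?case using b x y by (simp add: h_def g_def distribs smult_minus_l group_simps)
  next
    case (Suc n)
    define G where "G = pact g ([:0, 1:] ^ n) b"
    have G: "G \<in> carrier A" "pact g ([:0, 1:] ^ Suc n) b = g \<otimes> G"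
      "pact g ([:0, 1:] ^ Suc (Suc n)) b = g \<otimes> (g \<otimes> G)"
      using b car by (simp_all add: G_def smult_one del: power_Suc) (simp_all add: pact_mult smult_one del: mult_pCons_left)
    have "pact h ([:1, - 1:] ^ Suc (Suc n)) b = pact h [:1, - 1:] (b \<ominus> x \<otimes> b \<oplus> g \<otimes> G)"
      unfolding power_Suc[of _ "Suc n"] using Suc b car by (simp add: pact_mult G del: mult_pCons_left power_Suc)
    also have "\<dots> = b \<ominus> x \<otimes> b \<oplus> g \<otimes> (g \<otimes> G)"
      unfolding h_def g_def [symmetric]
      using b x y car G by (simp add: distribs smult_minus_l group_simps gx xx)
    finally show ?case using G by simp
  qed
  fix m
  show "opbound (x \<ominus> x \<otimes> y \<otimes> x) ([:1, - 1:] ^ 2 ^ m) (3 * 2 ^ m)"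
    unfolding opbound_def h_def [symmetric]
  proof
    fix b assume b: "b \<in> carrier A"
    obtain n where n: "2 ^ m = Suc n" by (metis not0_implies_Suc power_eq_0_iff zero_neq_numeral)
    have "cnorm A (pact h ([:1, - 1:] ^ 2 ^ m) b) \<le> cnorm A (b \<ominus> x \<otimes> b) + cnorm A (pact g ([:0, 1:] ^ 2 ^ m) b)"
      using b x car unfolding n ind[OF b] by (intro cnorm_triangle) auto
    also have "cnorm A (pact g ([:0, 1:] ^ 2 ^ m) b) \<le> 1 ^ 2 ^ m * cnorm A b"
      using opboundD[OF car(2) opbound_power[OF car(2) g1] b] by simp
    also have "cnorm A (b \<ominus> x \<otimes> b) \<le> cnorm A b + cnorm A b"
      using cnorm_diff[of b "x \<otimes> b"] xb[OF b] b x by simp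
    also have "cnorm A b + cnorm A b + 1 ^ 2 ^ m * cnorm A b = 3 * 1 * cnorm A b" by simp
    also have "\<dots> \<le> 3 * 2 ^ m * cnorm A b"
      using b cnorm_nonneg by (intro mult_right_mono mult_left_mono) auto
    finally show "cnorm A (pact h ([:1, - 1:] ^ 2 ^ m) b) \<le> 3 * 2 ^ m * cnorm A b" by simp
  qed
qed

text \<open>Write \<open>y - x\<close> as z* z and put \<open>w = z x\<close>. Then w* w is
  \<open>- h\<close> with \<open>h = x - x y x\<close>, and \<open>1 - t h\<close> is a convex
  combination of 1 and the contraction \<open>1 - h\<close>; hence \<open>w = 0\<close> and
  \<open>h = 0\<close>. Finally \<open>h\<close> is c* c for \<open>c = (1 - y) x\<close>, so
  \<open>c = 0\<close>.\<close>

lemma projection_le_imp_mult: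
  assumes x: "cstar_projection A x" and y: "cstar_projection A y" and le: "cstar_le A x y"
  shows "y \<otimes> x = x"
proof -
  have x: "x \<in> carrier A" "adj A x = x" "x \<otimes> x = x" and y: "y \<in> carrier A" "adj A y = y" "y \<otimes> y = y"
    using x y by (auto simp: cstar_projection_def)
  obtain z where z: "z \<in> carrier A" "y \<ominus> x = adj A z \<otimes> z"
    using le by (auto simp: cstar_le_def cstar_positive_def)
  define h where "h = x \<ominus> x \<otimes> y \<otimes> x"
  have h: "h \<in> carrier A" using x y by (simp add: h_def)
  define w where "w = z \<otimes> x"
  have w: "w \<in> carrier A" using x z by (simp add: w_def)
  have "adj A w \<otimes> w = x \<otimes> (adj A z \<otimes> z) \<otimes> x" using x z by (simp add: w_def distribs)
  also have "\<dots> = \<ominus> h" using x y unfolding z(2)[symmetric]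
    by (simp add: h_def distribs group_simps)
  finally have ww: "adj A w \<otimes> w = \<ominus> h" .
  have "w = \<zero>"
  proof (rule negative_square_eq_zero[OF w])
    fix t :: real assume t: "0 \<le> t" "t \<le> 1"
    have "opbound h (smult (of_real (1 - t)) 1 + smult (of_real t) [:1, - 1:])
        (cmod (of_real (1 - t)) * 1 + cmod (of_real t) * 1)"
      using h opbound_complement[OF x y] unfolding h_def [symmetric]
      by (intro opbound_add opbound_smult opbound_1)
    moreover have "smult (of_real (1 - t)) 1 + smult (of_real t) [:1, - 1:] = [:1, - complex_of_real t:]"
      by (simp add: one_pCons)
    moreover have "cmod (of_real (1 - t)) * 1 + cmod (of_real t) * 1 = 1"
      using t by (simp del: of_real_diff)
    ultimately have *: "opbound h [:1, - of_real t:] 1" by simp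
    show "opbound (adj A w \<otimes> w) [:1, of_real t:] 1"
      unfolding ww using * h by (simp add: opbound_def distribs smult_minus_l)
  qed
  then have "\<ominus> h = \<zero>" using ww by simp
  then have "h = \<zero>" using cnorm_minus[OF h] h by (simp add: cnorm_eq_0)
  define c where "c = x \<ominus> y \<otimes> x"
  have yy: "y \<otimes> (y \<otimes> b) = y \<otimes> b" if "b \<in> carrier A" for b
    using y that by (simp add: mult_assoc [symmetric])
  have "adj A c = x \<ominus> x \<otimes> y" using x y by (simp add: c_def distribs)
  then have "adj A c \<otimes> c = (x \<ominus> x \<otimes> y) \<otimes> x \<ominus> (x \<ominus> x \<otimes> y) \<otimes> (y \<otimes> x)"
    using x(1) y(1) by (simp add: c_def minus_eq mult_r_distr mult_minus_r)
  also have "(x \<ominus> x \<otimes> y) \<otimes> (y \<otimes> x) = \<zero>"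
    using x(1) y(1) by (simp add: minus_eq mult_l_distr mult_minus_l mult_assoc yy r_neg)
  also have "(x \<ominus> x \<otimes> y) \<otimes> x = h"
    using x y(1) by (simp add: h_def minus_eq mult_l_distr mult_minus_l)
  finally have "adj A c \<otimes> c = h" using h by (simp add: minus_eq)
  moreover have "c \<in> carrier A" using x y by (simp add: c_def)
  ultimately have "c = \<zero>" using \<open>h = \<zero>\<close> adj_mult_eq_0 by blast
  then show ?thesis using x y unfolding c_def using diff_eq_zeroD[of x "y \<otimes> x"] by simp
qed

section \<open>Homomorphisms of C*-algebras\<close>

text \<open>The hypothesis on \<open>t\<close> says, without a unit, that \<open>1 + t\<close> is an
  isometry.\<close>

lemma cnorm_add_isometry:
  assumes t: "t \<in> carrier A" and e: "t \<oplus> adj A t \<oplus> adj A t \<otimes> t = \<zero>" and b: "b \<in> carrier A"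
  shows "cnorm A (b \<oplus> t \<otimes> b) = cnorm A b"
proof -
  have "adj A (b \<oplus> t \<otimes> b) \<otimes> (b \<oplus> t \<otimes> b) =
      adj A b \<otimes> b \<oplus> adj A b \<otimes> ((t \<oplus> adj A t \<oplus> adj A t \<otimes> t) \<otimes> b)"
    using t b by (simp add: distribs group_simps)
  also have "\<dots> = adj A b \<otimes> b" using e b by simp
  finally have "(cnorm A (b \<oplus> t \<otimes> b))\<^sup>2 = (cnorm A b)\<^sup>2"
    using t b cstar_identity[of b] cstar_identity[of "b \<oplus> t \<otimes> b"] by simp
  then show ?thesis using t b by (simp add: cnorm_nonneg)
qed

lemma complete_geometric:
  assumes X: "\<And>n. X n \<in> carrier A" and d: "\<And>n. cnorm A (X (Suc n) \<ominus> X n) \<le> (1/2) ^ n"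
  shows "\<exists>l\<in>carrier A. (\<lambda>n. cnorm A (X n \<ominus> l)) \<longlonglongrightarrow> 0"
proof (rule complete[OF X])
  \<comment> \<open>The exact partial sum of the geometric series is kept, because the weaker bound
    \<open>2 * (1/2) ^ n\<close> would not survive the induction on \<open>k\<close>.\<close>
  have le: "cnorm A (X (n + k) \<ominus> X n) \<le> 2 * (1/2) ^ n - 2 * (1/2) ^ (n + k)" for n k
  proof (induction k)
    case (Suc k)
    have "cnorm A (X (n + Suc k) \<ominus> X n) \<le> cnorm A (X (Suc (n + k)) \<ominus> X (n + k)) + cnorm A (X (n + k) \<ominus> X n)"
      using cnorm_diff_triangle[OF X X X] by simp
    also have "\<dots> \<le> (1/2) ^ (n + k) + (2 * (1/2) ^ n - 2 * (1/2) ^ (n + k))"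
      using Suc d by (intro add_mono) auto
    finally show ?case by simp
  qed (use X in \<open>simp add: minus_eq r_neg\<close>)
  have le': "cnorm A (X m \<ominus> X n) \<le> 2 * (1/2) ^ N" if "n \<ge> N" "m \<ge> n" for m n N
  proof -
    have "cnorm A (X m \<ominus> X n) \<le> 2 * (1/2) ^ n - 2 * (1/2) ^ m" using le[of n "m - n"] that by simp
    also have "\<dots> \<le> 2 * (1/2) ^ n" by simp
    also have "\<dots> \<le> 2 * (1/2) ^ N" using that by (simp add: power_decreasing)
    finally show ?thesis .
  qed
  fix e :: real assume "e > 0"
  then obtain N where N: "(1/2) ^ N < e / 2" using real_arch_pow_inv[of "e/2" "1/2"] by auto
  have "cnorm A (X m \<ominus> X n) < e" if "m \<ge> N" "n \<ge> N" for m n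
  proof (cases "m \<ge> n")
    case True
    then show ?thesis using le'[of N n m] that N by simp
  next
    case False
    then show ?thesis using le'[of N m n] that N cnorm_diff_commute[OF X X, of m n] by simp
  qed
  then show "\<exists>N. \<forall>m\<ge>N. \<forall>n\<ge>N. cnorm A (X m \<ominus> X n) < e" by blast
qed

text \<open>The equation says that \<open>1 - y\<close> is a square root of \<open>1 - h\<^sup>2\<close>, so that \<open>1 - y + i h\<close> is unitary.\<close>

lemma ex_quadratic_root:
  assumes h: "h \<in> carrier A" "adj A h = h" "cnorm A h \<le> 1/2"
  shows "\<exists>y\<in>carrier A. adj A y = y \<and> y \<otimes> h = h \<otimes> y \<and> y \<oplus> y = h \<otimes> h \<oplus> y \<otimes> y"
proof -
  \<comment> \<open>Fixed-point iteration for \<open>y = (h\<^sup>2 + y\<^sup>2) / 2\<close>. On the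
    ball of radius 1/4 this map is a contraction and stays inside, because \<open>h\<close> has norm
    at most 1/2. Self-adjointness and commutation with \<open>h\<close> are inherited by all
    iterates.\<close>
  define X where "X = rec_nat \<zero> (\<lambda>_ y. (1/2) \<odot> (h \<otimes> h \<oplus> y \<otimes> y))"
  have X0: "X 0 = \<zero>" and XS: "\<And>n. X (Suc n) = (1/2) \<odot> (h \<otimes> h \<oplus> X n \<otimes> X n)"
    by (simp_all add: X_def)
  have Xc [simp]: "X n \<in> carrier A" for n by (induction n) (use h in \<open>auto simp: X0 XS\<close>)
  have Xa: "adj A (X n) = X n" for n by (induction n) (use h in \<open>auto simp: X0 XS distribs\<close>)
  have Xh: "X n \<otimes> h = h \<otimes> X n" for n
  proof (induction n)
    case (Suc n)
    have "X n \<otimes> (X n \<otimes> h) = h \<otimes> (X n \<otimes> X n)"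
      using h Suc by simp (simp add: mult_assoc [symmetric] Suc)
    then show ?case using h by (simp add: XS distribs)
  qed (use h in \<open>simp add: X0\<close>)
  have hh: "cnorm A (h \<otimes> h) \<le> 1/4"
    using cnorm_mult[of h h] mult_mono[OF h(3) h(3)] h cnorm_nonneg[of h] by simp
  have XN: "cnorm A (X n) \<le> 1/4" for n
  proof (induction n)
    case (Suc n)
    have "cnorm A (X n \<otimes> X n) \<le> 1/4 * (1/4)"
      using cnorm_mult[of "X n" "X n"] mult_mono[OF Suc Suc] cnorm_nonneg[of "X n"] by simp
    moreover have "cnorm A (h \<otimes> h \<oplus> X n \<otimes> X n) \<le> cnorm A (h \<otimes> h) + cnorm A (X n \<otimes> X n)"
      using h by (intro cnorm_triangle) auto
    ultimately show ?case using hh h by (simp add: XS cnorm_smult)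
  qed (simp add: X0)
  have D: "cnorm A (x \<otimes> x \<ominus> y \<otimes> y) \<le> (cnorm A x + cnorm A y) * cnorm A (x \<ominus> y)"
    if "x \<in> carrier A" "y \<in> carrier A" for x y
  proof -
    have "x \<otimes> x \<ominus> y \<otimes> y = x \<otimes> (x \<ominus> y) \<oplus> (x \<ominus> y) \<otimes> y"
      using that by (simp add: distribs group_simps)
    then have "cnorm A (x \<otimes> x \<ominus> y \<otimes> y) \<le> cnorm A (x \<otimes> (x \<ominus> y)) + cnorm A ((x \<ominus> y) \<otimes> y)"
      using that by (simp add: cnorm_triangle)
    also have "\<dots> \<le> cnorm A x * cnorm A (x \<ominus> y) + cnorm A (x \<ominus> y) * cnorm A y"
      using that by (intro add_mono cnorm_mult) auto
    finally show ?thesis by (simp add: algebra_simps)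
  qed
  have XD: "cnorm A (X (Suc n) \<ominus> X n) \<le> (1/2) ^ n" for n
  proof (induction n)
    case 0
    then show ?case using XN[of 1] by (simp add: X0 minus_eq)
  next
    case (Suc n)
    have "X (Suc (Suc n)) \<ominus> X (Suc n) = (1/2) \<odot> (X (Suc n) \<otimes> X (Suc n) \<ominus> X n \<otimes> X n)"
      unfolding XS[of "Suc n"] using h by (subst (3) XS) (simp add: distribs group_simps)
    then have "cnorm A (X (Suc (Suc n)) \<ominus> X (Suc n)) = 1/2 * cnorm A (X (Suc n) \<otimes> X (Suc n) \<ominus> X n \<otimes> X n)"
      by (simp add: cnorm_smult)
    also have "\<dots> \<le> 1/2 * ((cnorm A (X (Suc n)) + cnorm A (X n)) * cnorm A (X (Suc n) \<ominus> X n))"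
      by (intro mult_left_mono D) auto
    also have "\<dots> \<le> 1/2 * (1 * (1/2) ^ n)"
      using XN[of n] XN[of "Suc n"] Suc cnorm_nonneg[of "X (Suc n) \<ominus> X n"]
      by (intro mult_left_mono mult_mono) auto
    finally show ?case by simp
  qed
  obtain y where y: "y \<in> carrier A" and lim: "(\<lambda>n. cnorm A (X n \<ominus> y)) \<longlonglongrightarrow> 0"
    using complete_geometric[OF Xc XD] by blast
  have lim': "(\<lambda>n. C * cnorm A (X n \<ominus> y) + C' * cnorm A (X (Suc n) \<ominus> y)) \<longlonglongrightarrow> 0" for C C'
    using tendsto_add[OF tendsto_mult_right_zero[OF lim, of C]
        tendsto_mult_right_zero[OF LIMSEQ_Suc[OF lim], of C']] by simp
  \<comment> \<open>Equations for the limit come from equations for the iterates through this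
    estimate. Two consecutive iterates are allowed because the recursion links \<open>X n\<close>
    with \<open>X (Suc n)\<close>.\<close>
  have zero: "z = z'" if "z \<in> carrier A" "z' \<in> carrier A"
    "\<And>n. cnorm A (z \<ominus> z') \<le> C * cnorm A (X n \<ominus> y) + C' * cnorm A (X (Suc n) \<ominus> y)" for z z' C C'
    using that cnorm_eqD LIMSEQ_le_const[OF lim'[of C C']] by blast
  have "adj A y = y"
  proof (rule zero[where C = 2 and C' = 0])
    fix n
    have "cnorm A (adj A y \<ominus> y) \<le> cnorm A (adj A y \<ominus> adj A (X n)) + cnorm A (X n \<ominus> y)"
      using cnorm_diff_triangle[of "adj A y" "X n" y] y by (simp add: Xa)
    also have "adj A y \<ominus> adj A (X n) = adj A (y \<ominus> X n)" using y by (simp add: distribs)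
    finally show "cnorm A (adj A y \<ominus> y) \<le> 2 * cnorm A (X n \<ominus> y) + 0 * cnorm A (X (Suc n) \<ominus> y)"
      using y by (simp add: cnorm_diff_commute)
  qed (use y in auto)
  moreover have "y \<otimes> h = h \<otimes> y"
  proof (rule zero[where C = "2 * cnorm A h" and C' = 0])
    fix n
    have "y \<otimes> h \<ominus> h \<otimes> y = h \<otimes> (X n \<ominus> y) \<ominus> (X n \<ominus> y) \<otimes> h"
      using y h by (simp add: distribs group_simps Xh)
    also have "cnorm A \<dots> \<le> cnorm A (h \<otimes> (X n \<ominus> y)) + cnorm A ((X n \<ominus> y) \<otimes> h)"
      using y h by (intro cnorm_diff) auto
    also have "\<dots> \<le> cnorm A h * cnorm A (X n \<ominus> y) + cnorm A (X n \<ominus> y) * cnorm A h"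
      using y h by (intro add_mono cnorm_mult) auto
    finally show "cnorm A (y \<otimes> h \<ominus> h \<otimes> y) \<le> 2 * cnorm A h * cnorm A (X n \<ominus> y) + 0 * cnorm A (X (Suc n) \<ominus> y)"
      by simp
  qed (use y h in auto)
  moreover have "y \<oplus> y = h \<otimes> h \<oplus> y \<otimes> y"
  proof (rule zero[where C = "1/4 + cnorm A y" and C' = 2])
    fix n
    have "X (Suc n) \<oplus> X (Suc n) = h \<otimes> h \<oplus> X n \<otimes> X n"
      using h by (simp add: XS half_add)
    then have "h \<otimes> h = X (Suc n) \<oplus> X (Suc n) \<ominus> X n \<otimes> X n"
      using h by (simp add: distribs group_simps)
    then have "y \<oplus> y \<ominus> (h \<otimes> h \<oplus> y \<otimes> y) =
       (X n \<otimes> X n \<ominus> y \<otimes> y) \<ominus> ((X (Suc n) \<ominus> y) \<oplus> (X (Suc n) \<ominus> y))"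
      using h y by (simp add: distribs group_simps)
    also have "cnorm A \<dots> \<le> cnorm A (X n \<otimes> X n \<ominus> y \<otimes> y) + cnorm A ((X (Suc n) \<ominus> y) \<oplus> (X (Suc n) \<ominus> y))"
      using y by (intro cnorm_diff) auto
    also have "cnorm A (X n \<otimes> X n \<ominus> y \<otimes> y) \<le> (cnorm A (X n) + cnorm A y) * cnorm A (X n \<ominus> y)"
      using y by (intro D) auto
    also have "\<dots> \<le> (1/4 + cnorm A y) * cnorm A (X n \<ominus> y)"
      using XN[of n] y cnorm_nonneg[of "X n \<ominus> y"] by (intro mult_right_mono) auto
    also have "cnorm A ((X (Suc n) \<ominus> y) \<oplus> (X (Suc n) \<ominus> y)) \<le> 2 * cnorm A (X (Suc n) \<ominus> y)"
      using cnorm_triangle[of "X (Suc n) \<ominus> y" "X (Suc n) \<ominus> y"] y by simp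
    finally show "cnorm A (y \<oplus> y \<ominus> (h \<otimes> h \<oplus> y \<otimes> y)) \<le>
       (1/4 + cnorm A y) * cnorm A (X n \<ominus> y) + 2 * cnorm A (X (Suc n) \<ominus> y)" by simp
  qed (use y h in auto)
  ultimately show ?thesis using y by blast
qed

text \<open>\<open>1 + t\<close> with \<open>t = \<i> h - y\<close> is unitary with imaginary part
  \<open>h\<close>. The unit-free form is preserved by homomorphisms that need not be
  unital.\<close>

lemma ex_unitary:
  assumes h: "h \<in> carrier A" "adj A h = h" "cnorm A h \<le> 1/2"
  shows "\<exists>t\<in>carrier A. t \<oplus> adj A t \<oplus> adj A t \<otimes> t = \<zero> \<and> adj A t \<oplus> t \<oplus> t \<otimes> adj A t = \<zero> \<and>
    t \<ominus> adj A t = (2 * \<i>) \<odot> h"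
proof -
  obtain y where y: "y \<in> carrier A" "adj A y = y" "y \<otimes> h = h \<otimes> y" "y \<oplus> y = h \<otimes> h \<oplus> y \<otimes> y"
    using ex_quadratic_root[OF h] by blast
  define t where "t = \<i> \<odot> h \<ominus> y"
  have t: "t \<in> carrier A" using y h by (simp add: t_def)
  have ta: "adj A t = \<ominus> (\<i> \<odot> h) \<ominus> y" using y h by (simp add: t_def distribs smult_minus_l)
  have s: "t \<oplus> adj A t = \<ominus> (y \<oplus> y)" using y(1,2) h by (simp add: ta, simp add: t_def distribs group_simps)
  have m: "adj A t \<otimes> t = y \<oplus> y" "t \<otimes> adj A t = y \<oplus> y"
    using y(1,2,3) h by (simp_all add: y(4) ta, simp_all add: t_def distribs group_simps smult_minus_l)
  have "(2 * \<i>) \<odot> h = \<i> \<odot> h \<oplus> \<i> \<odot> h" using smult_l_distr[of h \<i> \<i>] h by simp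
  then have "t \<ominus> adj A t = (2 * \<i>) \<odot> h"
    using y(1,2) h by (simp add: ta, simp add: t_def distribs group_simps)
  moreover have "t \<oplus> adj A t \<oplus> adj A t \<otimes> t = \<zero>" "adj A t \<oplus> t \<oplus> t \<otimes> adj A t = \<zero>"
    using y(1) t s by (simp_all add: m a_comm[of "adj A t" t] l_neg)
  ultimately show ?thesis using t by blast
qed

text \<open>The power of \<open>x\<close> with exponent \<open>2 ^ m\<close>, formed without a unit;
  for self-adjoint \<open>x\<close> the C*-identity applies at each squaring.\<close>

definition sqiter :: "'a \<Rightarrow> nat \<Rightarrow> 'a" where
  "sqiter x m = ((\<lambda>y. y \<otimes> y) ^^ m) x"

lemma sqiter_0 [simp]: "sqiter x 0 = x"
  and sqiter_Suc [simp]: "sqiter x (Suc m) = sqiter x m \<otimes> sqiter x m"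
  by (simp_all add: sqiter_def)

lemma sqiter_closed [simp]: "x \<in> carrier A \<Longrightarrow> sqiter x m \<in> carrier A"
  by (induction m) auto

lemma cnorm_sqiter:
  assumes "x \<in> carrier A" "adj A x = x"
  shows "cnorm A (sqiter x m) = cnorm A x ^ (2 ^ m)"
proof -
  have "adj A (sqiter x m) = sqiter x m" for m by (induction m) (use assms in \<open>auto simp: adj_mult\<close>)
  then show ?thesis
  proof (induction m)
    case (Suc m)
    then show ?case using cstar_identity[of "sqiter x m"] assms
      by (simp add: power_mult [symmetric] mult.commute[of _ 2])
  qed simp
qed

end

section \<open>Homomorphisms are contractive\<close>

locale cstar_hom = A: cstar_algebra A + B: cstar_algebra B
  for A :: "('a, 'm) cstar_scheme" (structure) and B :: "('b, 'n) cstar_scheme" +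
  fixes \<phi> :: "'a \<Rightarrow> 'b"
  assumes hom: "\<phi> \<in> star_hom A B"
begin

lemma closed [simp]: "x \<in> carrier A \<Longrightarrow> \<phi> x \<in> carrier B"
  and add: "x \<in> carrier A \<Longrightarrow> y \<in> carrier A \<Longrightarrow> \<phi> (x \<oplus> y) = \<phi> x \<oplus>\<^bsub>B\<^esub> \<phi> y"
  and mult: "x \<in> carrier A \<Longrightarrow> y \<in> carrier A \<Longrightarrow> \<phi> (x \<otimes> y) = \<phi> x \<otimes>\<^bsub>B\<^esub> \<phi> y"
  and adj: "x \<in> carrier A \<Longrightarrow> \<phi> (adj A x) = adj B (\<phi> x)"
  and smult: "x \<in> carrier A \<Longrightarrow> \<phi> (c \<odot> x) = c \<odot>\<^bsub>B\<^esub> \<phi> x"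
  using hom by (auto simp: star_hom_def Pi_def)

lemma zero [simp]: "\<phi> \<zero> = \<zero>\<^bsub>B\<^esub>"
  using smult[of "\<zero>" 0] by simp

lemma minus: "x \<in> carrier A \<Longrightarrow> \<phi> (\<ominus> x) = \<ominus>\<^bsub>B\<^esub> \<phi> x"
  by (simp add: A.minus_smult B.minus_smult smult)

lemma diff: "x \<in> carrier A \<Longrightarrow> y \<in> carrier A \<Longrightarrow> \<phi> (x \<ominus> y) = \<phi> x \<ominus>\<^bsub>B\<^esub> \<phi> y"
  by (simp add: A.minus_eq B.minus_eq add minus)

lemma finsum:
  "finite I \<Longrightarrow> f \<in> I \<rightarrow> carrier A \<Longrightarrow> \<phi> (finsum A f I) = finsum B (\<lambda>i. \<phi> (f i)) I"
  by (induction I rule: finite_induct)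
     (auto simp: A.finsum_insert B.finsum_insert A.finsum_empty B.finsum_empty add Pi_def A.finsum_closed)

lemma sqiter: "x \<in> carrier A \<Longrightarrow> \<phi> (A.sqiter x m) = B.sqiter (\<phi> x) m"
  by (induction m) (auto simp: mult)

text \<open>The image of the unitary \<open>1 + t\<close> makes \<open>1 + s\<close> and its adjoint
  isometries on \<open>B\<close>. As \<open>2 \<i> k\<close> is the difference of these two, twice
  the squared norm of \<open>k\<close> is at most twice its norm.\<close>

lemma contractive_half:
  assumes h: "h \<in> carrier A" "adj A h = h" "cnorm A h \<le> 1/2"
  shows "cnorm B (\<phi> h) \<le> 1"
proof -
  obtain t where t: "t \<in> carrier A" "t \<oplus> adj A t \<oplus> adj A t \<otimes> t = \<zero>"
    "adj A t \<oplus> t \<oplus> t \<otimes> adj A t = \<zero>" "t \<ominus> adj A t = (2 * \<i>) \<odot> h"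
    using A.ex_unitary[OF h] by blast
  define s k where "s = \<phi> t" and "k = \<phi> h"
  have s: "s \<in> carrier B" "k \<in> carrier B" using t h by (simp_all add: s_def k_def)
  have k: "adj B k = k" using adj[of h] h by (simp add: k_def)
  have s1: "s \<oplus>\<^bsub>B\<^esub> adj B s \<oplus>\<^bsub>B\<^esub> adj B s \<otimes>\<^bsub>B\<^esub> s = \<zero>\<^bsub>B\<^esub>"
    using arg_cong[OF t(2), of \<phi>] t(1) by (simp add: s_def add mult adj)
  have s2: "adj B s \<oplus>\<^bsub>B\<^esub> s \<oplus>\<^bsub>B\<^esub> s \<otimes>\<^bsub>B\<^esub> adj B s = \<zero>\<^bsub>B\<^esub>"
    using arg_cong[OF t(3), of \<phi>] t(1) by (simp add: s_def add mult adj)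
  have s3: "s \<ominus>\<^bsub>B\<^esub> adj B s = (2 * \<i>) \<odot>\<^bsub>B\<^esub> k"
    using arg_cong[OF t(4), of \<phi>] t(1) h by (simp add: s_def k_def diff adj smult)
  have "(2 * \<i>) \<odot>\<^bsub>B\<^esub> (k \<otimes>\<^bsub>B\<^esub> k) = (s \<ominus>\<^bsub>B\<^esub> adj B s) \<otimes>\<^bsub>B\<^esub> k"
    using s by (simp add: s3 B.smult_mult_l)
  also have "\<dots> = (k \<oplus>\<^bsub>B\<^esub> s \<otimes>\<^bsub>B\<^esub> k) \<ominus>\<^bsub>B\<^esub> (k \<oplus>\<^bsub>B\<^esub> adj B s \<otimes>\<^bsub>B\<^esub> k)"
    using s by (simp add: B.distribs B.group_simps)
  also have "cnorm B \<dots> \<le> cnorm B (k \<oplus>\<^bsub>B\<^esub> s \<otimes>\<^bsub>B\<^esub> k) + cnorm B (k \<oplus>\<^bsub>B\<^esub> adj B s \<otimes>\<^bsub>B\<^esub> k)"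
    using s by (intro B.cnorm_diff) auto
  also have "\<dots> = 2 * cnorm B k"
    using B.cnorm_add_isometry[OF s(1) s1 s(2)] B.cnorm_add_isometry[of "adj B s" k] s s2
    by (simp add: B.adj_adj)
  finally have "(cnorm B k)\<^sup>2 \<le> cnorm B k"
    using s B.cstar_identity[OF s(2)] k by (simp add: B.cnorm_smult norm_mult)
  then have "\<not> 1 < cnorm B k"
    using mult_strict_left_mono[of 1 "cnorm B k" "cnorm B k"] by (auto simp: power2_eq_square)
  then show ?thesis by (simp add: k_def)
qed

lemma contractive_sa_aux:
  assumes h: "h \<in> carrier A" "adj A h = h"
  shows "cnorm B (\<phi> h) \<le> 2 * cnorm A h"
proof (cases "cnorm A h = 0")
  case True
  then show ?thesis using h A.cnorm_eq_0[of h] by simp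
next
  case False
  then have p: "cnorm A h > 0" using A.cnorm_nonneg[OF h(1)] by simp
  define c where "c = complex_of_real (1 / (2 * cnorm A h))"
  have c: "cmod c = 1 / (2 * cnorm A h)" "cnj c = c" using p by (simp_all add: c_def norm_divide)
  have "cnorm B (\<phi> (c \<odot> h)) \<le> 1"
    using h p c by (intro contractive_half) (auto simp: A.adj_smult A.cnorm_smult)
  then show ?thesis using h p by (simp add: smult B.cnorm_smult c field_simps)
qed

text \<open>Scaling to norm 1/2 costs a factor 2. It stays the same under repeated squaring while
  the norms are squared, so the power trick removes it.\<close>

lemma contractive_sa:
  assumes h: "h \<in> carrier A" "adj A h = h"
  shows "cnorm B (\<phi> h) \<le> cnorm A h"
proof (rule power_trick_real)
  fix m
  have "adj A (A.sqiter h m) = A.sqiter h m" by (induction m) (use h in \<open>auto simp: A.adj_mult\<close>)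
  then have "cnorm B (\<phi> (A.sqiter h m)) \<le> 2 * cnorm A (A.sqiter h m)"
    using h by (intro contractive_sa_aux) auto
  then have "cnorm B (\<phi> h) ^ 2 ^ m \<le> 2 * cnorm A h ^ 2 ^ m"
    using h B.cnorm_sqiter[of "\<phi> h" m] by (simp add: A.cnorm_sqiter sqiter adj [symmetric])
  also have "\<dots> \<le> 2 * 2 ^ m * cnorm A h ^ 2 ^ m"
    using h by (intro mult_right_mono) (auto simp: A.cnorm_nonneg)
  finally show "cnorm B (\<phi> h) ^ 2 ^ m \<le> 2 * 2 ^ m * cnorm A h ^ 2 ^ m" .
qed (use h in \<open>simp add: A.cnorm_nonneg\<close>)

theorem contractive:
  assumes x: "x \<in> carrier A"
  shows "cnorm B (\<phi> x) \<le> cnorm A x"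
proof -
  have "(cnorm B (\<phi> x))\<^sup>2 \<le> (cnorm A x)\<^sup>2"
    using contractive_sa[of "adj A x \<otimes> x"] x B.cstar_identity[of "\<phi> x"]
    by (simp add: A.cstar_identity A.distribs mult adj)
  then show ?thesis using A.cnorm_nonneg[OF x] power2_le_imp_le by blast
qed

text \<open>By the C*-identity, squaring \<open>m\<close> times raises norms to the power \<open>2^m\<close>, which absorbs any
  factor linear in \<open>2^m\<close>.\<close>

theorem isometric_if_polynomially_bounded_below:
  assumes x: "x \<in> carrier A"
    and le: "\<And>m. cnorm A (A.sqiter (adj A x \<otimes> x) m) \<le> c * 2 ^ m * cnorm B (\<phi> (A.sqiter (adj A x \<otimes> x) m))"
  shows "cnorm B (\<phi> x) = cnorm A x"
proof -
  define h where "h = adj A x \<otimes> x"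
  have h: "h \<in> carrier A" "adj A h = h" using x by (simp_all add: h_def A.distribs)
  have "cnorm A h \<le> cnorm B (\<phi> h)"
  proof (rule power_trick_real)
    fix m
    show "cnorm A h ^ 2 ^ m \<le> c * 2 ^ m * cnorm B (\<phi> h) ^ 2 ^ m"
      using le[of m] h B.cnorm_sqiter[of "\<phi> h" m]
      by (simp add: A.cnorm_sqiter sqiter adj [symmetric] flip: h_def)
  qed (use h in \<open>simp add: B.cnorm_nonneg\<close>)
  then have "(cnorm A x)\<^sup>2 \<le> (cnorm B (\<phi> x))\<^sup>2"
    using x B.cstar_identity[of "\<phi> x"] by (simp add: h_def A.cstar_identity mult adj)
  then have "cnorm A x \<le> cnorm B (\<phi> x)" using x B.cnorm_nonneg power2_le_imp_le closed by blast
  then show ?thesis using contractive[OF x] by simp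
qed

end

section \<open>The completion of the free *-algebra\<close>

lemma lookup_free_adj: "Poly_Mapping.lookup (free_adj a) w = cnj (Poly_Mapping.lookup a (fword_adj w))"
  and fword_adj_adj [simp]: "fword_adj (fword_adj w) = w"
  and fword_adj_add: "fword_adj (u + w) = fword_adj w + fword_adj u"
proof -
  show inv: "fword_adj (fword_adj w) = w" for w :: "'a fword"
    by (cases w) (auto simp: fword_adj_def rev_map [symmetric] intro!: map_idI)
  show "fword_adj (u + w) = fword_adj w + fword_adj u"
    by (simp add: fword_adj_def plus_fword_def)
  have inj: "inj (fword_adj :: 'a fword \<Rightarrow> _)"
    by (rule injI) (metis inv)
  show "Poly_Mapping.lookup (free_adj a) w = cnj (Poly_Mapping.lookup a (fword_adj w))"
    unfolding free_adj_def by (simp add: map.rep_eq map_key.rep_eq[OF inj] when_def)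
qed

lemma free_induct [case_names single add]:
  fixes a :: "'x free_star"
  assumes "\<And>w c. P (Poly_Mapping.single w c)" "\<And>a b. P a \<Longrightarrow> P b \<Longrightarrow> P (a + b)"
  shows "P a"
proof (induction a rule: update_induct)
  case const
  then show ?case using assms(1)[of 0 0] by simp
next
  case (update f w c)
  have "Poly_Mapping.update w c f = f + Poly_Mapping.single w c"
    using update by (intro poly_mapping_eqI) (auto simp: lookup_update lookup_add lookup_single in_keys_iff when_def)
  then show ?case using update assms by simp
qed

lemma free_adj_add: "free_adj (a + b) = free_adj a + free_adj b"
  by (rule poly_mapping_eqI) (simp add: lookup_free_adj lookup_add)

lemma free_adj_single: "free_adj (Poly_Mapping.single w c) = Poly_Mapping.single (fword_adj w) (cnj c)"
  by (rule poly_mapping_eqI) (auto simp: lookup_free_adj lookup_single when_def)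

lemma free_adj_adj: "free_adj (free_adj a) = a"
  by (rule poly_mapping_eqI) (simp add: lookup_free_adj)

lemma free_adj_diff: "free_adj (a - b) = free_adj a - free_adj b"
  by (rule poly_mapping_eqI) (simp add: lookup_free_adj lookup_minus)

lemma free_adj_mult: "free_adj (a * b) = free_adj b * free_adj a"
proof (induction a rule: free_induct)
  case (single w c)
  show ?case
    by (induction b rule: free_induct)
       (simp_all add: mult_single free_adj_single fword_adj_add distrib_left distrib_right free_adj_add mult.commute)
next
  case (add a a')
  then show ?case by (simp add: distrib_left distrib_right free_adj_add)
qed

text \<open>Scalars act as multiples of the empty word, so the module laws become ring laws of the
  full monoid algebra, although the empty word is outside \<open>free_carrier\<close>.\<close>

lemma free_smult_conv: "free_smult c a = Poly_Mapping.single 0 c * a"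
proof -
  have "free_smult c a = Poly_Mapping.map ((*) c) a" by (simp add: free_smult_def)
  then show ?thesis by (simp only: mult_map_scale_conv_mult)
qed

lemma free_smult_single: "free_smult c (Poly_Mapping.single w d) = Poly_Mapping.single w (c * d)"
  by (simp add: free_smult_conv mult_single)

lemma free_smult_mult_l: "free_smult c a * b = free_smult c (a * b)"
  by (simp add: free_smult_conv mult.assoc)

lemma single_zero_commute: "Poly_Mapping.single 0 (c::complex) * a = a * Poly_Mapping.single 0 c"
  for a :: "'x free_star"
  by (induction a rule: free_induct) (simp_all add: mult_single distrib_left distrib_right mult.commute)

lemma free_smult_mult_r: "a * free_smult c b = free_smult c (a * b)"
  unfolding free_smult_conv by (simp only: mult.assoc [symmetric] single_zero_commute [of c a])

lemma free_smult_add: "free_smult c (a + b) = free_smult c a + free_smult c b"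
  by (simp add: free_smult_conv distrib_left)

lemma free_smult_diff: "free_smult c (a - b) = free_smult c a - free_smult c b"
  by (simp add: free_smult_conv right_diff_distrib)

lemma free_smult_add_l: "free_smult (c + d) a = free_smult c a + free_smult d a"
  by (simp add: free_smult_conv distrib_right single_add)

lemma free_smult_assoc: "free_smult (c * d) a = free_smult c (free_smult d a)"
  by (simp add: free_smult_conv mult.assoc [symmetric] mult_single)

lemma free_smult_one: "free_smult 1 a = a"
  by (simp add: free_smult_conv single_one)

lemma free_smult_minus_one: "free_smult (-1) a = - a"
  by (simp add: free_smult_conv single_uminus single_one)

lemma free_adj_smult: "free_adj (free_smult c a) = free_smult (cnj c) (free_adj a)"
proof -
  have "fword_adj 0 = (0 :: 'a fword)" by (simp add: fword_adj_def zero_fword_def)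
  then show ?thesis
    by (simp add: free_smult_conv free_adj_mult free_adj_single single_zero_commute)
qed

lemma free_carrier_zero [simp]: "0 \<in> free_carrier G"
  by (simp add: free_carrier_def)

lemma free_carrier_add [simp]: "a \<in> free_carrier G \<Longrightarrow> b \<in> free_carrier G \<Longrightarrow> a + b \<in> free_carrier G"
  using Poly_Mapping.keys_add[of a b] by (auto simp: free_carrier_def)

lemma free_carrier_mult [simp]: "a \<in> free_carrier G \<Longrightarrow> b \<in> free_carrier G \<Longrightarrow> a * b \<in> free_carrier G"
  using keys_mult[of a b] by (fastforce simp: free_carrier_def plus_fword_def)

lemma free_carrier_smult [simp]: "a \<in> free_carrier G \<Longrightarrow> free_smult c a \<in> free_carrier G"
proof -
  have "Poly_Mapping.keys (free_smult c a) \<subseteq> Poly_Mapping.keys a"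
    by (auto simp: in_keys_iff free_smult_def map.rep_eq when_def)
  then show "a \<in> free_carrier G \<Longrightarrow> ?thesis" by (auto simp: free_carrier_def)
qed

lemma free_carrier_uminus [simp]: "a \<in> free_carrier G \<Longrightarrow> - a \<in> free_carrier G"
  using free_carrier_smult[of a G "-1"] by (simp add: free_smult_minus_one)

lemma free_carrier_diff [simp]: "a \<in> free_carrier G \<Longrightarrow> b \<in> free_carrier G \<Longrightarrow> a - b \<in> free_carrier G"
  using free_carrier_add[of a G "- b"] by simp

lemma free_carrier_adj [simp]: "a \<in> free_carrier G \<Longrightarrow> free_adj a \<in> free_carrier G"
proof -
  assume a: "a \<in> free_carrier G"
  have "letters w \<noteq> [] \<and> set (letters w) \<subseteq> G \<times> UNIV" if "w \<in> Poly_Mapping.keys (free_adj a)" for w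
  proof -
    have "fword_adj w \<in> Poly_Mapping.keys a" using that by (simp add: in_keys_iff lookup_free_adj)
    with a have "letters (fword_adj w) \<noteq> [] \<and> set (letters (fword_adj w)) \<subseteq> G \<times> UNIV"
      by (simp add: free_carrier_def)
    then show ?thesis by (force simp: fword_adj_def)
  qed
  then show ?thesis by (simp add: free_carrier_def)
qed

lemma free_carrier_gen [simp]: "x \<in> G \<Longrightarrow> free_gen x \<in> free_carrier G"
  by (auto simp: free_gen_def free_carrier_def)

section \<open>Cauchy sequences modulo null sequences\<close>

locale free_seminorm =
  fixes G :: "'x set" and q :: "'x free_star \<Rightarrow> real"
  assumes cstar_seminorm: "cstar_seminorm G q"
begin

abbreviation "V \<equiv> free_carrier G"
abbreviation "C \<equiv> free_completion G q"
abbreviation "Z \<equiv> free_cauchy G q"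
abbreviation "cls \<equiv> free_class G q"

lemma q_nonneg: "a \<in> V \<Longrightarrow> 0 \<le> q a"
  and q_smult: "a \<in> V \<Longrightarrow> q (free_smult c a) = cmod c * q a"
  and q_cstar: "a \<in> V \<Longrightarrow> q (free_adj a * a) = (q a)\<^sup>2"
  and q_add: "a \<in> V \<Longrightarrow> b \<in> V \<Longrightarrow> q (a + b) \<le> q a + q b"
  and q_mult: "a \<in> V \<Longrightarrow> b \<in> V \<Longrightarrow> q (a * b) \<le> q a * q b"
  using cstar_seminorm unfolding cstar_seminorm_def by auto

lemma q_0 [simp]: "q 0 = 0"
  using q_smult[of 0 0] by (simp add: free_smult_conv)

lemma q_minus: "a \<in> V \<Longrightarrow> q (- a) = q a"
  using q_smult[of a "-1"] by (simp add: free_smult_minus_one)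

lemma q_diff_commute: "a \<in> V \<Longrightarrow> b \<in> V \<Longrightarrow> q (a - b) = q (b - a)"
  using q_minus[of "b - a"] by simp

lemma q_triangle: "a \<in> V \<Longrightarrow> b \<in> V \<Longrightarrow> c \<in> V \<Longrightarrow> q (a - c) \<le> q (a - b) + q (b - c)"
  using q_add[of "a - b" "b - c"] by simp

lemma q_adj_le: "a \<in> V \<Longrightarrow> q a \<le> q (free_adj a)"
proof (cases "q a = 0")
  case False
  assume a: "a \<in> V"
  then have "q a * q a \<le> q (free_adj a) * q a"
    using q_cstar[of a] q_mult[of "free_adj a" a] by (simp add: power2_eq_square)
  then show ?thesis using False q_nonneg[OF a] by simp
qed (simp add: q_nonneg)

lemma q_adj: "a \<in> V \<Longrightarrow> q (free_adj a) = q a"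
  using q_adj_le[of a] q_adj_le[of "free_adj a"] by (simp add: free_adj_adj)

lemma q_abs_diff: "a \<in> V \<Longrightarrow> b \<in> V \<Longrightarrow> \<bar>q a - q b\<bar> \<le> q (a - b)"
  using q_triangle[of a b 0] q_triangle[of b a 0] q_diff_commute[of a b] by simp

lemma Z_V: "X \<in> Z \<Longrightarrow> X n \<in> V"
  by (simp add: free_cauchy_def)

lemma ZI: "(\<And>n. X n \<in> V) \<Longrightarrow> (\<And>e. e > 0 \<Longrightarrow> \<exists>N. \<forall>m\<ge>N. \<forall>n\<ge>N. q (X m - X n) < e) \<Longrightarrow> X \<in> Z"
  by (simp add: free_cauchy_def)

lemma ZD: "X \<in> Z \<Longrightarrow> e > 0 \<Longrightarrow> \<exists>N. \<forall>m\<ge>N. \<forall>n\<ge>N. q (X m - X n) < e"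
  by (simp add: free_cauchy_def)

lemma Z_const [simp]: "a \<in> V \<Longrightarrow> (\<lambda>n. a) \<in> Z"
  by (rule ZI) auto

lemma Z_convergent: "X \<in> Z \<Longrightarrow> convergent (\<lambda>n. q (X n))"
  unfolding Cauchy_convergent_iff [symmetric]
proof (rule metric_CauchyI)
  fix e :: real assume X: "X \<in> Z" and "e > 0"
  then obtain N where "\<forall>m\<ge>N. \<forall>n\<ge>N. q (X m - X n) < e" using ZD by blast
  then show "\<exists>M. \<forall>m\<ge>M. \<forall>n\<ge>M. dist (q (X m)) (q (X n)) < e"
    using q_abs_diff[OF Z_V[OF X] Z_V[OF X]] by (metis dist_real_def le_less_trans)
qed

lemma Z_bounded: "X \<in> Z \<Longrightarrow> \<exists>K>0. \<forall>n. q (X n) \<le> K"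
proof -
  assume X: "X \<in> Z"
  then have "Bseq (\<lambda>n. q (X n))" using Z_convergent convergent_imp_Bseq by blast
  then show ?thesis unfolding Bseq_def by (auto intro: order_trans[OF abs_ge_self])
qed

text \<open>All operations are Lipschitz on bounded sets, in at most two arguments; this is their
  common Cauchy argument.\<close>

lemma Z_dominated:
  assumes "\<And>n. Y n \<in> V" "X \<in> Z" "X' \<in> Z" "K > 0"
    and le: "\<And>m n. q (Y m - Y n) \<le> K * (q (X m - X n) + q (X' m - X' n))"
  shows "Y \<in> Z"
proof (rule ZI)
  fix e :: real assume e: "e > 0"
  then have e': "e / (2 * K) > 0" using assms by simp
  obtain N N' where "\<forall>m\<ge>N. \<forall>n\<ge>N. q (X m - X n) < e / (2 * K)"
      "\<forall>m\<ge>N'. \<forall>n\<ge>N'. q (X' m - X' n) < e / (2 * K)"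
    using ZD[OF assms(2) e'] ZD[OF assms(3) e'] by blast
  then have "q (Y m - Y n) < e" if "m \<ge> max N N'" "n \<ge> max N N'" for m n
  proof -
    have "q (X m - X n) + q (X' m - X' n) < e / (2 * K) + e / (2 * K)"
      using \<open>\<forall>m\<ge>N. _ m\<close> \<open>\<forall>m\<ge>N'. _ m\<close> that by (intro add_strict_mono) auto
    also have "\<dots> = e / K" by simp
    finally have "K * (q (X m - X n) + q (X' m - X' n)) < e" using assms(4) by (simp add: pos_less_divide_eq mult.commute)
    then show ?thesis using le[of m n] by linarith
  qed
  then show "\<exists>N. \<forall>m\<ge>N. \<forall>n\<ge>N. q (Y m - Y n) < e" by blast
qed (rule assms)

lemma q_add_diff:
  "a \<in> V \<Longrightarrow> b \<in> V \<Longrightarrow> a' \<in> V \<Longrightarrow> b' \<in> V \<Longrightarrow> q ((a + b) - (a' + b')) \<le> q (a - a') + q (b - b')"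
  using q_add[of "a - a'" "b - b'"] by (simp add: algebra_simps)

text \<open>From \<open>a b - a' b' = (a - a') b + a' (b - b')\<close>: only the two factors that
  stand next to a difference have to be bounded.\<close>

lemma q_mult_diff:
  assumes "a \<in> V" "b \<in> V" "a' \<in> V" "b' \<in> V" "q b \<le> K" "q a' \<le> K"
  shows "q (a * b - a' * b') \<le> K * (q (a - a') + q (b - b'))"
proof -
  have "q (a * b - a' * b') = q ((a - a') * b + a' * (b - b'))" by (simp add: algebra_simps)
  also have "\<dots> \<le> q ((a - a') * b) + q (a' * (b - b'))" using assms by (intro q_add) auto
  also have "\<dots> \<le> q (a - a') * q b + q a' * q (b - b')" using assms by (intro add_mono q_mult) auto
  also have "\<dots> \<le> q (a - a') * K + K * q (b - b')"
    using assms by (intro add_mono mult_left_mono mult_right_mono q_nonneg) auto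
  finally show ?thesis by (simp add: algebra_simps)
qed

lemma Z_add: "X \<in> Z \<Longrightarrow> Y \<in> Z \<Longrightarrow> (\<lambda>n. X n + Y n) \<in> Z"
  by (rule Z_dominated[of _ X Y 1]) (auto simp: Z_V intro: q_add_diff)

lemma Z_smult: "X \<in> Z \<Longrightarrow> (\<lambda>n. free_smult c (X n)) \<in> Z"
proof (rule Z_dominated[of _ X X "cmod c + 1"])
  fix m n assume X: "X \<in> Z"
  have "q (free_smult c (X m) - free_smult c (X n)) = cmod c * q (X m - X n)"
    using X by (simp add: Z_V q_smult flip: free_smult_diff)
  also have "\<dots> \<le> (cmod c + 1) * (q (X m - X n) + q (X m - X n))"
    using X by (intro mult_mono) (auto simp: Z_V q_nonneg)
  finally show "q (free_smult c (X m) - free_smult c (X n)) \<le> (cmod c + 1) * (q (X m - X n) + q (X m - X n))" .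
qed (auto simp: Z_V add_nonneg_pos)

lemma Z_adj: "X \<in> Z \<Longrightarrow> (\<lambda>n. free_adj (X n)) \<in> Z"
  by (rule Z_dominated[of _ X X 1]) (auto simp: Z_V q_adj q_nonneg simp flip: free_adj_diff)

lemma Z_mult: "X \<in> Z \<Longrightarrow> Y \<in> Z \<Longrightarrow> (\<lambda>n. X n * Y n) \<in> Z"
proof -
  assume X: "X \<in> Z" and Y: "Y \<in> Z"
  obtain K where "K > 0" "\<forall>n. q (X n) \<le> K" using Z_bounded[OF X] by blast
  moreover obtain L where "L > 0" "\<forall>n. q (Y n) \<le> L" using Z_bounded[OF Y] by blast
  ultimately have K: "K > 0" "L > 0" "\<forall>n. q (X n) \<le> K" "\<forall>n. q (Y n) \<le> L" by auto
  have KL: "q (X n) \<le> max K L" "q (Y n) \<le> max K L" for n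
    using K(3,4)[rule_format, of n] by simp_all
  show ?thesis
  proof (rule Z_dominated[OF _ X Y])
    show "max K L > 0" using K by simp
    show "q (X m * Y m - X n * Y n) \<le> max K L * (q (X m - X n) + q (Y m - Y n))" for m n
      using X Y KL by (intro q_mult_diff) (simp_all add: Z_V)
  qed (use X Y in \<open>simp add: Z_V\<close>)
qed

lemma Z_uminus: "X \<in> Z \<Longrightarrow> (\<lambda>n. - X n) \<in> Z"
  using Z_smult[of X "-1"] by (simp add: free_smult_minus_one)

lemma null_iff: "(X, Y) \<in> free_null G q \<longleftrightarrow> X \<in> Z \<and> Y \<in> Z \<and> (\<lambda>n. q (X n - Y n)) \<longlonglongrightarrow> 0"
  by (simp add: free_null_def)

lemma dominated_null:
  assumes "\<And>n. Y n \<in> V" "\<And>n. q (Y n) \<le> K * (q (X n) + q (X' n))" "(\<lambda>n. q (X n)) \<longlonglongrightarrow> 0" "(\<lambda>n. q (X' n)) \<longlonglongrightarrow> 0"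
  shows "(\<lambda>n. q (Y n)) \<longlonglongrightarrow> 0"
proof (rule tendsto_sandwich[of "\<lambda>n. 0" _ _ "\<lambda>n. K * (q (X n) + q (X' n))"])
  show "(\<lambda>n. K * (q (X n) + q (X' n))) \<longlonglongrightarrow> 0"
    using tendsto_mult_right_zero[OF tendsto_add_zero[OF assms(3,4)], of K] .
qed (use assms in \<open>auto simp: q_nonneg\<close>)

lemma equiv: "equiv Z (free_null G q)"
proof (rule equivI)
  show "free_null G q \<subseteq> Z \<times> Z" by (auto simp: null_iff)
  show "refl_on Z (free_null G q)" by (auto simp: refl_on_def null_iff)
  show "sym (free_null G q)"
  proof (rule symI)
    fix X Y assume *: "(X, Y) \<in> free_null G q"
    then have "q (X n - Y n) = q (Y n - X n)" for n by (intro q_diff_commute) (simp_all add: null_iff Z_V)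
    then show "(Y, X) \<in> free_null G q" using * by (simp add: null_iff)
  qed
  show "trans (free_null G q)"
  proof (rule transI)
    fix X Y W assume *: "(X, Y) \<in> free_null G q" "(Y, W) \<in> free_null G q"
    have "(\<lambda>n. q (X n - W n)) \<longlonglongrightarrow> 0"
    proof (rule dominated_null[of _ 1 "\<lambda>n. X n - Y n" "\<lambda>n. Y n - W n"])
      show "q (X n - W n) \<le> 1 * (q (X n - Y n) + q (Y n - W n))" for n
        using * q_triangle[of "X n" "Y n" "W n"] by (simp add: null_iff Z_V)
    qed (use * in \<open>simp_all add: null_iff Z_V\<close>)
    then show "(X, W) \<in> free_null G q" using * by (simp add: null_iff)
  qed
qed

lemma cls_eq_iff: "X \<in> Z \<Longrightarrow> Y \<in> Z \<Longrightarrow> cls X = cls Y \<longleftrightarrow> (\<lambda>n. q (X n - Y n)) \<longlonglongrightarrow> 0"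
  unfolding free_class_def using eq_equiv_class_iff[OF equiv, of X Y] by (simp add: null_iff)

lemma cls_carrier [simp]: "X \<in> Z \<Longrightarrow> cls X \<in> carrier C"
  by (simp add: free_completion_def free_class_def quotientI)

lemma carrier_cases:
  assumes "x \<in> carrier C" obtains X where "X \<in> Z" "x = cls X"
  using assms by (auto simp: free_completion_def free_class_def elim!: quotientE)

text \<open>The completion computes with chosen representatives. A choice differs from any other
  member of its class by a null sequence, so the rules for classes hold for arbitrary
  representatives.\<close>

lemma rep: "X \<in> Z \<Longrightarrow> free_rep (cls X) \<in> Z"
  and rep_null: "X \<in> Z \<Longrightarrow> (\<lambda>n. q (free_rep (cls X) n - X n)) \<longlonglongrightarrow> 0"
proof -
  assume X: "X \<in> Z"
  then have "X \<in> cls X" by (simp add: free_class_def null_iff)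
  then have "free_rep (cls X) \<in> cls X" unfolding free_rep_def by (rule someI[of "\<lambda>Y. Y \<in> cls X"])
  then have *: "(X, free_rep (cls X)) \<in> free_null G q" by (simp add: free_class_def)
  then show R: "free_rep (cls X) \<in> Z" by (simp add: null_iff)
  show "(\<lambda>n. q (free_rep (cls X) n - X n)) \<longlonglongrightarrow> 0"
    using * X R by (simp add: null_iff q_diff_commute Z_V)
qed

lemma add_cls: "X \<in> Z \<Longrightarrow> Y \<in> Z \<Longrightarrow> cls X \<oplus>\<^bsub>C\<^esub> cls Y = cls (\<lambda>n. X n + Y n)"
proof -
  assume *: "X \<in> Z" "Y \<in> Z"
  note r = rep[OF *(1)] rep[OF *(2)]
  have "cls (\<lambda>n. free_rep (cls X) n + free_rep (cls Y) n) = cls (\<lambda>n. X n + Y n)"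
  proof (subst cls_eq_iff)
    show "(\<lambda>n. q (free_rep (cls X) n + free_rep (cls Y) n - (X n + Y n))) \<longlonglongrightarrow> 0"
    proof (rule dominated_null[of _ 1 "\<lambda>n. free_rep (cls X) n - X n" "\<lambda>n. free_rep (cls Y) n - Y n"])
      show "q (free_rep (cls X) n + free_rep (cls Y) n - (X n + Y n)) \<le>
          1 * (q (free_rep (cls X) n - X n) + q (free_rep (cls Y) n - Y n))" for n
        using * r q_add_diff[of "free_rep (cls X) n" "free_rep (cls Y) n" "X n" "Y n"] by (simp add: Z_V)
    qed (use * r rep_null in \<open>simp_all add: Z_V\<close>)
  qed (use * r in \<open>auto intro: Z_add\<close>)
  then show ?thesis by (simp add: free_completion_def)
qed

lemma mult_cls: "X \<in> Z \<Longrightarrow> Y \<in> Z \<Longrightarrow> cls X \<otimes>\<^bsub>C\<^esub> cls Y = cls (\<lambda>n. X n * Y n)"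
proof -
  assume *: "X \<in> Z" "Y \<in> Z"
  note r = rep[OF *(1)] rep[OF *(2)]
  obtain K where "\<forall>n. q (X n) \<le> K" using Z_bounded[OF *(1)] by blast
  moreover obtain L where "\<forall>n. q (free_rep (cls Y) n) \<le> L" using Z_bounded[OF r(2)] by blast
  ultimately have K: "\<forall>n. q (X n) \<le> K" "\<forall>n. q (free_rep (cls Y) n) \<le> L" by auto
  have K': "q (X n) \<le> max K L" "q (free_rep (cls Y) n) \<le> max K L" for n
    using K[rule_format, of n] by simp_all
  have "cls (\<lambda>n. free_rep (cls X) n * free_rep (cls Y) n) = cls (\<lambda>n. X n * Y n)"
  proof (subst cls_eq_iff)
    show "(\<lambda>n. q (free_rep (cls X) n * free_rep (cls Y) n - X n * Y n)) \<longlonglongrightarrow> 0"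
    proof (rule dominated_null[of _ "max K L" "\<lambda>n. free_rep (cls X) n - X n" "\<lambda>n. free_rep (cls Y) n - Y n"])
      show "q (free_rep (cls X) n * free_rep (cls Y) n - X n * Y n) \<le>
          max K L * (q (free_rep (cls X) n - X n) + q (free_rep (cls Y) n - Y n))" for n
        using * r K' by (intro q_mult_diff) (simp_all add: Z_V)
    qed (use * r rep_null in \<open>simp_all add: Z_V\<close>)
  qed (use * r in \<open>auto intro: Z_mult\<close>)
  then show ?thesis by (simp add: free_completion_def)
qed

lemma smult_cls: "X \<in> Z \<Longrightarrow> c \<odot>\<^bsub>C\<^esub> cls X = cls (\<lambda>n. free_smult c (X n))"
proof -
  assume *: "X \<in> Z"
  have "cls (\<lambda>n. free_smult c (free_rep (cls X) n)) = cls (\<lambda>n. free_smult c (X n))"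
  proof (subst cls_eq_iff)
    show "(\<lambda>n. q (free_smult c (free_rep (cls X) n) - free_smult c (X n))) \<longlonglongrightarrow> 0"
      using tendsto_mult_right_zero[OF rep_null[OF *], of "cmod c"] * rep[OF *]
      by (simp add: q_smult Z_V flip: free_smult_diff)
  qed (use * rep in \<open>auto intro: Z_smult\<close>)
  then show ?thesis by (simp add: free_completion_def)
qed

lemma adj_cls: "X \<in> Z \<Longrightarrow> adj C (cls X) = cls (\<lambda>n. free_adj (X n))"
proof -
  assume *: "X \<in> Z"
  have "cls (\<lambda>n. free_adj (free_rep (cls X) n)) = cls (\<lambda>n. free_adj (X n))"
  proof (subst cls_eq_iff)
    show "(\<lambda>n. q (free_adj (free_rep (cls X) n) - free_adj (X n))) \<longlonglongrightarrow> 0"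
      using rep_null[OF *] * rep[OF *] by (simp add: q_adj Z_V flip: free_adj_diff)
  qed (use * rep in \<open>auto intro: Z_adj\<close>)
  then show ?thesis by (simp add: free_completion_def)
qed

lemma cnorm_cls: "X \<in> Z \<Longrightarrow> (\<lambda>n. q (X n)) \<longlonglongrightarrow> cnorm C (cls X)"
proof -
  assume *: "X \<in> Z"
  have "(\<lambda>n. q (free_rep (cls X) n)) \<longlonglongrightarrow> cnorm C (cls X)"
    using Z_convergent[OF rep[OF *]] by (simp add: free_completion_def convergent_LIMSEQ_iff)
  moreover have "(\<lambda>n. q (X n) - q (free_rep (cls X) n)) \<longlonglongrightarrow> 0"
  proof (rule tendsto_0_le[OF rep_null[OF *], of _ 1])
    have "norm (q (X n) - q (free_rep (cls X) n)) \<le> norm (q (free_rep (cls X) n - X n)) * 1" for n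
      using q_abs_diff[of "X n" "free_rep (cls X) n"] q_diff_commute[of "X n" "free_rep (cls X) n"]
        Z_V[OF *, of n] Z_V[OF rep[OF *], of n] by simp
    then show "\<forall>\<^sub>F n in sequentially. norm (q (X n) - q (free_rep (cls X) n)) \<le> norm (q (free_rep (cls X) n - X n)) * 1"
      by simp
  qed
  ultimately show ?thesis using tendsto_add[of _ "cnorm C (cls X)"] by fastforce
qed

lemma zero_cls: "\<zero>\<^bsub>C\<^esub> = cls (\<lambda>n. 0)"
  by (simp add: free_completion_def)

lemmas cls_simps = add_cls mult_cls smult_cls adj_cls zero_cls
lemmas Z_intros = Z_add Z_mult Z_smult Z_adj Z_uminus

lemma abelian_group: "abelian_group C"
proof (rule abelian_groupI)
  fix x assume "x \<in> carrier C"
  then obtain X where X: "X \<in> Z" "x = cls X" by (elim carrier_cases)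
  have "cls (\<lambda>n. - X n) \<oplus>\<^bsub>C\<^esub> x = \<zero>\<^bsub>C\<^esub>" using X by (simp add: cls_simps Z_intros)
  then show "\<exists>y\<in>carrier C. y \<oplus>\<^bsub>C\<^esub> x = \<zero>\<^bsub>C\<^esub>" using cls_carrier[OF Z_uminus[OF X(1)]] by blast
qed ((elim carrier_cases)?, simp add: cls_simps Z_intros ac_simps)+

lemma minus_cls: "X \<in> Z \<Longrightarrow> Y \<in> Z \<Longrightarrow> cls X \<ominus>\<^bsub>C\<^esub> cls Y = cls (\<lambda>n. X n - Y n)"
proof -
  assume *: "X \<in> Z" "Y \<in> Z"
  interpret abelian_group C by (rule abelian_group)
  have "\<ominus>\<^bsub>C\<^esub> cls Y = cls (\<lambda>n. - Y n)"
    using * by (intro minus_equality) (auto simp: cls_simps Z_intros)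
  then show ?thesis using * by (simp add: minus_eq cls_simps Z_intros)
qed

text \<open>Density of the constant sequences: a late term of a Cauchy sequence approximates its
  class.\<close>

lemma tail_bound: "X \<in> Z \<Longrightarrow> e > 0 \<Longrightarrow> \<exists>N. cnorm C (cls X \<ominus>\<^bsub>C\<^esub> cls (\<lambda>n. X N)) \<le> e"
proof -
  assume X: "X \<in> Z" and e: "e > 0"
  obtain N where N: "\<forall>m\<ge>N. \<forall>n\<ge>N. q (X m - X n) < e" using ZD[OF X e] by blast
  have "(\<lambda>n. q (X n - X N)) \<longlonglongrightarrow> cnorm C (cls X \<ominus>\<^bsub>C\<^esub> cls (\<lambda>n. X N))"
    using X Z_add[OF X Z_const[of "- X N"]] by (simp add: minus_cls Z_V cnorm_cls)
  then have "cnorm C (cls X \<ominus>\<^bsub>C\<^esub> cls (\<lambda>n. X N)) \<le> e"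
    by (rule LIMSEQ_le_const2) (intro exI[of _ N] allI impI less_imp_le, use N in simp)
  then show ?thesis ..
qed

lemma cnorm_const: "a \<in> V \<Longrightarrow> cnorm C (cls (\<lambda>n. a)) = q a"
  using cnorm_cls[of "\<lambda>n. a"] by (simp add: LIMSEQ_const_iff)

text \<open>Identities hold termwise on representatives, norm inequalities pass to the limit, and
  completeness is a diagonal argument.\<close>

theorem cstar_algebra: "cstar_algebra C"
proof -
  interpret abelian_group C by (rule abelian_group)
  have tri: "cnorm C (x \<oplus>\<^bsub>C\<^esub> y) \<le> cnorm C x + cnorm C y" if "x \<in> carrier C" "y \<in> carrier C" for x y
  proof -
    from that(1) obtain X where "X \<in> Z" "x = cls X" by (rule carrier_cases)
    moreover from that(2) obtain Y where "Y \<in> Z" "y = cls Y" by (rule carrier_cases)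
    ultimately have X: "X \<in> Z" "x = cls X" "Y \<in> Z" "y = cls Y" by simp_all
    have "cnorm C (cls (\<lambda>n. X n + Y n)) \<le> cnorm C x + cnorm C y"
      unfolding X(2,4)
      by (rule LIMSEQ_le[OF cnorm_cls[OF Z_add[OF X(1,3)]] tendsto_add[OF cnorm_cls[OF X(1)] cnorm_cls[OF X(3)]]])
         (use X in \<open>simp add: q_add Z_V\<close>)
    then show ?thesis using X by (simp add: cls_simps)
  qed
  have smult: "cnorm C (c \<odot>\<^bsub>C\<^esub> x) = cmod c * cnorm C x" if "x \<in> carrier C" for c x
  proof -
    from that obtain X where X: "X \<in> Z" "x = cls X" by (rule carrier_cases)
    have "(\<lambda>n. q (free_smult c (X n))) \<longlonglongrightarrow> cmod c * cnorm C x"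
      using tendsto_mult_left[OF cnorm_cls[OF X(1)], of "cmod c"] X by (simp add: q_smult Z_V)
    then show ?thesis using cnorm_cls[OF Z_smult[OF X(1), of c]] X by (auto simp: cls_simps intro: LIMSEQ_unique)
  qed
  have mult: "cnorm C (x \<otimes>\<^bsub>C\<^esub> y) \<le> cnorm C x * cnorm C y" if "x \<in> carrier C" "y \<in> carrier C" for x y
  proof -
    from that(1) obtain X where "X \<in> Z" "x = cls X" by (rule carrier_cases)
    moreover from that(2) obtain Y where "Y \<in> Z" "y = cls Y" by (rule carrier_cases)
    ultimately have X: "X \<in> Z" "x = cls X" "Y \<in> Z" "y = cls Y" by simp_all
    have "cnorm C (cls (\<lambda>n. X n * Y n)) \<le> cnorm C x * cnorm C y"
      unfolding X(2,4)
      by (rule LIMSEQ_le[OF cnorm_cls[OF Z_mult[OF X(1,3)]] tendsto_mult[OF cnorm_cls[OF X(1)] cnorm_cls[OF X(3)]]])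
         (use X in \<open>simp add: q_mult Z_V\<close>)
    then show ?thesis using X by (simp add: cls_simps)
  qed
  have cstar: "cnorm C (adj C x \<otimes>\<^bsub>C\<^esub> x) = (cnorm C x)\<^sup>2" if "x \<in> carrier C" for x
  proof -
    from that obtain X where X: "X \<in> Z" "x = cls X" by (rule carrier_cases)
    have "(\<lambda>n. q (free_adj (X n) * X n)) \<longlonglongrightarrow> (cnorm C x)\<^sup>2"
      using tendsto_power[OF cnorm_cls[OF X(1)], of 2] X by (simp add: q_cstar Z_V)
    then show ?thesis using cnorm_cls[OF Z_mult[OF Z_adj[OF X(1)] X(1)]] X
      by (auto simp: cls_simps Z_intros intro: LIMSEQ_unique)
  qed
  have nonneg: "0 \<le> cnorm C x" if "x \<in> carrier C" for x
  proof -
    from that obtain X where X: "X \<in> Z" "x = cls X" by (rule carrier_cases)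
    show ?thesis unfolding X(2) by (rule LIMSEQ_le_const[OF cnorm_cls[OF X(1)]]) (auto simp: X Z_V q_nonneg)
  qed
  have minus_norm: "cnorm C (x \<ominus>\<^bsub>C\<^esub> y) = cnorm C (y \<ominus>\<^bsub>C\<^esub> x)" if "x \<in> carrier C" "y \<in> carrier C" for x y
  proof -
    from that(1) obtain X where "X \<in> Z" "x = cls X" by (rule carrier_cases)
    moreover from that(2) obtain Y where "Y \<in> Z" "y = cls Y" by (rule carrier_cases)
    ultimately have X: "X \<in> Z" "x = cls X" "Y \<in> Z" "y = cls Y" by simp_all
    have "x \<ominus>\<^bsub>C\<^esub> y = (-1) \<odot>\<^bsub>C\<^esub> (y \<ominus>\<^bsub>C\<^esub> x)"
      using X Z_add[OF X(3) Z_uminus[OF X(1)]] by (simp add: minus_cls smult_cls free_smult_minus_one)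
    then show ?thesis using smult[of "y \<ominus>\<^bsub>C\<^esub> x" "-1"] that by simp
  qed
  have tri3: "cnorm C (x \<ominus>\<^bsub>C\<^esub> z) \<le> cnorm C (x \<ominus>\<^bsub>C\<^esub> y) + cnorm C (y \<ominus>\<^bsub>C\<^esub> z)"
    if "x \<in> carrier C" "y \<in> carrier C" "z \<in> carrier C" for x y z
  proof -
    have "x \<ominus>\<^bsub>C\<^esub> z = (x \<ominus>\<^bsub>C\<^esub> y) \<oplus>\<^bsub>C\<^esub> (y \<ominus>\<^bsub>C\<^esub> z)"
      using that by (simp add: minus_eq a_ac r_neg r_neg1 r_neg2 l_neg)
    then show ?thesis using tri[of "x \<ominus>\<^bsub>C\<^esub> y" "y \<ominus>\<^bsub>C\<^esub> z"] that by simp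
  qed
  have complete: "\<exists>l\<in>carrier C. (\<lambda>n. cnorm C (X n \<ominus>\<^bsub>C\<^esub> l)) \<longlonglongrightarrow> 0"
    if X: "\<And>n. X n \<in> carrier C"
      and cau: "\<And>\<epsilon>. \<epsilon> > 0 \<Longrightarrow> \<exists>N. \<forall>m\<ge>N. \<forall>n\<ge>N. cnorm C (X m \<ominus>\<^bsub>C\<^esub> X n) < \<epsilon>" for X
  proof -
    \<comment> \<open>Each \<open>X k\<close> is replaced by one element of the free algebra at
      distance at most \<open>1 / (k + 1)\<close>; the sequence of these is itself Cauchy, and its
      class is the limit.\<close>
    have "\<exists>a\<in>V. cnorm C (X k \<ominus>\<^bsub>C\<^esub> cls (\<lambda>n. a)) \<le> inverse (real (Suc k))" for k
    proof -
      obtain Y where Y: "Y \<in> Z" "X k = cls Y" using X[of k] by (rule carrier_cases)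
      show ?thesis using tail_bound[OF Y(1), of "inverse (real (Suc k))"] Y Z_V[OF Y(1)] by auto
    qed
    then obtain a where a: "\<And>k. a k \<in> V" "\<And>k. cnorm C (X k \<ominus>\<^bsub>C\<^esub> cls (\<lambda>n. a k)) \<le> inverse (real (Suc k))"
      by metis
    let ?c = "\<lambda>k. cls (\<lambda>n. a k)"
    have c: "?c k \<in> carrier C" for k using a by simp
    have small: "\<exists>N. \<forall>k\<ge>N. inverse (real (Suc k)) < e" if "e > 0" for e :: real
    proof -
      from reals_Archimedean[OF that] obtain N where N: "inverse (real (Suc N)) < e" by blast
      have "inverse (real (Suc k)) < e" if "k \<ge> N" for k
        by (rule le_less_trans[OF le_imp_inverse_le N]) (use that in auto)
      then show ?thesis by blast
    qed
    have aZ: "a \<in> Z"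
    proof (rule ZI)
      fix e :: real assume e: "e > 0"
      obtain N1 where N1: "\<forall>m\<ge>N1. \<forall>n\<ge>N1. cnorm C (X m \<ominus>\<^bsub>C\<^esub> X n) < e / 3" using cau[of "e/3"] e by auto
      obtain N2 where N2: "\<forall>k\<ge>N2. inverse (real (Suc k)) < e / 3" using small[of "e/3"] e by auto
      have "q (a m - a n) < e" if "m \<ge> max N1 N2" "n \<ge> max N1 N2" for m n
      proof -
        have "q (a m - a n) = cnorm C (?c m \<ominus>\<^bsub>C\<^esub> ?c n)" using a by (simp add: minus_cls cnorm_const)
        also have "\<dots> \<le> cnorm C (?c m \<ominus>\<^bsub>C\<^esub> X m) + cnorm C (X m \<ominus>\<^bsub>C\<^esub> ?c n)" using X c by (intro tri3) auto
        also have "cnorm C (X m \<ominus>\<^bsub>C\<^esub> ?c n) \<le> cnorm C (X m \<ominus>\<^bsub>C\<^esub> X n) + cnorm C (X n \<ominus>\<^bsub>C\<^esub> ?c n)" using X c by (intro tri3) auto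
        also have "cnorm C (?c m \<ominus>\<^bsub>C\<^esub> X m) = cnorm C (X m \<ominus>\<^bsub>C\<^esub> ?c m)" using X c by (intro minus_norm) auto
        finally have "q (a m - a n) \<le> cnorm C (X m \<ominus>\<^bsub>C\<^esub> ?c m) + (cnorm C (X m \<ominus>\<^bsub>C\<^esub> X n) + cnorm C (X n \<ominus>\<^bsub>C\<^esub> ?c n))"
          by simp
        moreover have "cnorm C (X m \<ominus>\<^bsub>C\<^esub> X n) < e / 3" "inverse (real (Suc m)) < e / 3" "inverse (real (Suc n)) < e / 3"
          using N1 N2 that by simp_all
        ultimately show ?thesis using a(2)[of m] a(2)[of n] by linarith
      qed
      then show "\<exists>N. \<forall>m\<ge>N. \<forall>n\<ge>N. q (a m - a n) < e" by blast
    qed (rule a)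
    have "(\<lambda>k. cnorm C (X k \<ominus>\<^bsub>C\<^esub> cls a)) \<longlonglongrightarrow> 0"
    proof (rule LIMSEQ_I)
      fix e :: real assume e: "e > 0"
      obtain N1 where N1: "\<forall>m\<ge>N1. \<forall>n\<ge>N1. q (a m - a n) < e / 3" using ZD[OF aZ, of "e/3"] e by auto
      obtain N2 where N2: "\<forall>k\<ge>N2. inverse (real (Suc k)) < e / 3" using small[of "e/3"] e by auto
      have "norm (cnorm C (X k \<ominus>\<^bsub>C\<^esub> cls a) - 0) < e" if k: "k \<ge> max N1 N2" for k
      proof -
        have "(\<lambda>n. q (a n - a k)) \<longlonglongrightarrow> cnorm C (cls a \<ominus>\<^bsub>C\<^esub> ?c k)"
          using aZ a Z_add[OF aZ Z_const[of "- a k"]] by (simp add: minus_cls cnorm_cls)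
        then have "cnorm C (cls a \<ominus>\<^bsub>C\<^esub> ?c k) \<le> e / 3"
          by (rule LIMSEQ_le_const2) (intro exI[of _ N1] allI impI less_imp_le, use N1 k in simp)
        moreover have "cnorm C (X k \<ominus>\<^bsub>C\<^esub> cls a) \<le> cnorm C (X k \<ominus>\<^bsub>C\<^esub> ?c k) + cnorm C (?c k \<ominus>\<^bsub>C\<^esub> cls a)"
          using X c aZ by (intro tri3) auto
        moreover have "cnorm C (?c k \<ominus>\<^bsub>C\<^esub> cls a) = cnorm C (cls a \<ominus>\<^bsub>C\<^esub> ?c k)" using aZ c by (intro minus_norm) auto
        moreover have "inverse (real (Suc k)) < e / 3" using N2 k by simp
        moreover have "0 \<le> cnorm C (X k \<ominus>\<^bsub>C\<^esub> cls a)" using X aZ by (intro nonneg minus_closed) auto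
        ultimately have "cnorm C (X k \<ominus>\<^bsub>C\<^esub> cls a) < e" "0 \<le> cnorm C (X k \<ominus>\<^bsub>C\<^esub> cls a)"
          using a(2)[of k] by linarith+
        then show ?thesis by simp
      qed
      then show "\<exists>N. \<forall>k\<ge>N. norm (cnorm C (X k \<ominus>\<^bsub>C\<^esub> cls a) - 0) < e" by blast
    qed
    then show ?thesis using aZ by (auto intro!: bexI[of _ "cls a"])
  qed
  have eq0: "cnorm C x = 0 \<longleftrightarrow> x = \<zero>\<^bsub>C\<^esub>" if "x \<in> carrier C" for x
  proof -
    from that obtain X where X: "X \<in> Z" "x = cls X" by (rule carrier_cases)
    have "x = \<zero>\<^bsub>C\<^esub> \<longleftrightarrow> (\<lambda>n. q (X n)) \<longlonglongrightarrow> 0" using X cls_eq_iff[of X "\<lambda>n. 0"] by (simp add: zero_cls)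
    also have "\<dots> \<longleftrightarrow> cnorm C x = 0" using cnorm_cls[OF X(1)] X(2) by (auto intro: LIMSEQ_unique)
    finally show ?thesis ..
  qed
  show ?thesis
  proof (intro cstar_algebra.intro cstar_algebra_axioms.intro)
    show "abelian_group C" by (rule abelian_group)
  qed (rule complete tri smult mult cstar nonneg eq0 | assumption |
     (elim carrier_cases, simp add: cls_simps Z_intros free_smult_add free_smult_add_l free_smult_assoc free_smult_one
       mult.assoc distrib_left distrib_right free_smult_mult_l free_smult_mult_r free_adj_adj free_adj_add free_adj_smult free_adj_mult))+
qed

end

section \<open>Relations between the edges\<close>

context cstar_algebra
begin

lemma mult_finsum:
  "finite I \<Longrightarrow> f \<in> I \<rightarrow> carrier A \<Longrightarrow> x \<in> carrier A \<Longrightarrow> x \<otimes> finsum A f I = (\<Oplus>i\<in>I. x \<otimes> f i)"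
  by (induction I rule: finite_induct)
     (simp_all add: finsum_empty finsum_insert finsum_closed mult_r_distr Pi_def)

lemma finsum_mult:
  "finite I \<Longrightarrow> f \<in> I \<rightarrow> carrier A \<Longrightarrow> x \<in> carrier A \<Longrightarrow> finsum A f I \<otimes> x = (\<Oplus>i\<in>I. f i \<otimes> x)"
  by (induction I rule: finite_induct)
     (simp_all add: finsum_empty finsum_insert finsum_closed mult_l_distr Pi_def)

lemma smult_finsum:
  "finite I \<Longrightarrow> f \<in> I \<rightarrow> carrier A \<Longrightarrow> c \<odot> finsum A f I = (\<Oplus>i\<in>I. c \<odot> f i)"
  by (induction I rule: finite_induct)
     (simp_all add: finsum_empty finsum_insert finsum_closed smult_r_distr Pi_def)

lemma finsum_smult:
  "finite I \<Longrightarrow> x \<in> carrier A \<Longrightarrow> (\<Oplus>i\<in>I. c i \<odot> x) = (\<Sum>i\<in>I. c i) \<odot> x"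
  by (induction I rule: finite_induct)
     (simp_all add: finsum_empty finsum_insert finsum_closed smult_l_distr Pi_def)

lemma adj_finsum:
  "finite I \<Longrightarrow> f \<in> I \<rightarrow> carrier A \<Longrightarrow> adj A (finsum A f I) = (\<Oplus>i\<in>I. adj A (f i))"
  by (induction I rule: finite_induct)
     (simp_all add: finsum_empty finsum_insert finsum_closed adj_add Pi_def)

lemma cnorm_finsum:
  assumes "finite I" "f \<in> I \<rightarrow> carrier A"
  shows "cnorm A (finsum A f I) \<le> (\<Sum>i\<in>I. cnorm A (f i))"
  using assms
proof (induction I rule: finite_induct)
  case (insert i I)
  then have "cnorm A (finsum A f (insert i I)) \<le> cnorm A (f i) + cnorm A (finsum A f I)"
    by (simp add: finsum_insert Pi_def finsum_closed cnorm_triangle)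
  then show ?case using insert by (simp add: Pi_def)
qed (simp add: finsum_empty)

lemma finsum_delta:
  assumes "finite I" "j \<in> I" "x \<in> carrier A" "\<And>i. i \<in> I \<Longrightarrow> f i = (if i = j then x else \<zero>)"
  shows "finsum A f I = x"
proof -
  have "finsum A f I = (\<Oplus>i\<in>I. if j = i then x else \<zero>)"
    using assms by (intro finsum_cong') auto
  also have "\<dots> = x" using assms by (subst finsum_singleton) auto
  finally show ?thesis .
qed

lemma finsum_eq_zero:
  "(\<And>i. i \<in> I \<Longrightarrow> f i = \<zero>) \<Longrightarrow> finsum A f I = \<zero>"
  using finsum_cong'[of I I "\<lambda>_. \<zero>" f] by (simp add: finsum_zero)

context
  fixes I :: "'i set" and P :: "'i \<Rightarrow> 'a"
  assumes fin: "finite I" and proj: "\<And>i. i \<in> I \<Longrightarrow> cstar_projection A (P i)"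
    and orth: "\<And>i j. i \<in> I \<Longrightarrow> j \<in> I \<Longrightarrow> i \<noteq> j \<Longrightarrow> P i \<otimes> P j = \<zero>"
begin

lemma orth_closed: "J \<subseteq> I \<Longrightarrow> P \<in> J \<rightarrow> carrier A"
  using proj by (auto simp: cstar_projection_def)

lemma orth_sum_closed: "J \<subseteq> I \<Longrightarrow> finsum A P J \<in> carrier A"
  by (rule finsum_closed[OF orth_closed])

lemma orth_sum_mult:
  assumes J: "J \<subseteq> I" and k: "k \<in> I"
  shows "finsum A P J \<otimes> P k = (if k \<in> J then P k else \<zero>)"
proof -
  have f: "finite J" using J fin by (rule finite_subset)
  have "finsum A P J \<otimes> P k = (\<Oplus>i\<in>J. P i \<otimes> P k)"
    using orth_closed[OF J] orth_closed[of I] k f by (intro finsum_mult) auto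
  also have "\<dots> = (if k \<in> J then P k else \<zero>)"
  proof (cases "k \<in> J")
    case True
    have "(\<Oplus>i\<in>J. P i \<otimes> P k) = P k"
      using f True J k proj[of k] orth by (intro finsum_delta[of _ k]) (auto simp: cstar_projection_def)
    then show ?thesis using True by simp
  next
    case False
    have "(\<Oplus>i\<in>J. P i \<otimes> P k) = \<zero>"
      using False J k orth by (intro finsum_eq_zero) auto
    then show ?thesis using False by simp
  qed
  finally show ?thesis .
qed

lemma orth_sum_mult_sum:
  assumes J: "J \<subseteq> I" and K: "K \<subseteq> I"
  shows "K \<subseteq> J \<Longrightarrow> finsum A P J \<otimes> finsum A P K = finsum A P K"
    and "K \<inter> J = {} \<Longrightarrow> finsum A P J \<otimes> finsum A P K = \<zero>"
proof -
  have f: "finite K" using K fin by (rule finite_subset)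
  have e: "finsum A P J \<otimes> finsum A P K = (\<Oplus>k\<in>K. finsum A P J \<otimes> P k)"
    using orth_sum_closed[OF J] orth_closed[OF K] f by (intro mult_finsum) auto
  show "finsum A P J \<otimes> finsum A P K = finsum A P K" if "K \<subseteq> J"
    unfolding e using that orth_sum_mult[OF J] orth_closed[OF K] K by (intro finsum_cong') (auto simp: subset_iff Pi_iff)
  show "finsum A P J \<otimes> finsum A P K = \<zero>" if "K \<inter> J = {}"
    unfolding e using that orth_sum_mult[OF J] orth_closed[OF K] K by (intro finsum_eq_zero) (auto simp: subset_iff)
qed

lemma orth_sum_projection: "J \<subseteq> I \<Longrightarrow> cstar_projection A (finsum A P J)"
proof -
  assume J: "J \<subseteq> I"
  have f: "finite J" using J fin by (rule finite_subset)
  have "adj A (finsum A P J) = (\<Oplus>i\<in>J. adj A (P i))" using f orth_closed[OF J] by (rule adj_finsum)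
  also have "\<dots> = finsum A P J"
    using J proj by (intro finsum_cong') (auto simp: cstar_projection_def)
  finally show ?thesis using orth_sum_mult_sum(1)[OF J J] orth_sum_closed[OF J] by (simp add: cstar_projection_def)
qed

end

end

text \<open>The Cuntz-Krieger relations \<open>s\<^sub>e* s\<^sub>e = \<Sum>\<^sub>f T(e,f) s\<^sub>f s\<^sub>f*\<close>, split into two assumptions that are
  polynomial identities in the edges and hence pass to suprema of seminorms, unlike the order relations
  of a Cuntz-Krieger family.\<close>

locale edge_family = cstar_algebra A for A :: "('a, 'm) cstar_scheme" (structure) +
  fixes E :: "'e set" and T :: "'e \<Rightarrow> 'e \<Rightarrow> bool" and s :: "'e \<Rightarrow> 'a"
  assumes finite_E: "finite E"
    and s_closed: "e \<in> E \<Longrightarrow> s e \<in> carrier A"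
    and s_orth: "e \<in> E \<Longrightarrow> f \<in> E \<Longrightarrow> e \<noteq> f \<Longrightarrow> adj A (s e) \<otimes> s f = \<zero>"
    and s_isometry: "e \<in> E \<Longrightarrow> s e \<otimes> (adj A (s e) \<otimes> s e) = s e"
    and s_transition: "e \<in> E \<Longrightarrow> f \<in> E \<Longrightarrow> adj A (s e) \<otimes> (s e \<otimes> s f) = (if T e f then s f else \<zero>)"
    and s_unit: "e \<in> E \<Longrightarrow> s e \<otimes> (\<Oplus>f\<in>E. s f \<otimes> adj A (s f)) = s e"

text \<open>Sources being non-empty, with only quasi perfect paths this is equivalent to inclusion
  of the source of \<open>f\<close> in the range of \<open>e\<close>.\<close>

definition htransition :: "('v, 'e) hypergraph \<Rightarrow> 'e \<Rightarrow> 'e \<Rightarrow> bool" where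
  "htransition H e f \<longleftrightarrow> hsource H f \<inter> hrange H e \<noteq> {}"

text \<open>HR2a makes the source sum of \<open>e\<close> a left unit for \<open>S e\<close>. HR2b
  and the absence of sinks make \<open>u\<close>, the sum of the range projections of all edges, a
  unit for every \<open>P v\<close>, hence for the sums in HR1.\<close>

lemma ck_family_edge_family:
  fixes A (structure)
  assumes A: "cstar_algebra A" and fin: "finite_hypergraph H" and qp: "only_quasi_perfect_paths H"
    and ns: "\<not> (\<exists>v\<in>hverts H. hsink H v)" and ck: "ck_family H A P S"
  shows "edge_family A (hedges H) (htransition H) S"
proof -
  interpret cstar_algebra A by (rule A)
  let ?V = "hverts H" and ?E = "hedges H"
  have fV: "finite ?V" and fE: "finite ?E"
    and rng: "\<And>e. e \<in> ?E \<Longrightarrow> hrange H e \<subseteq> ?V" and src: "\<And>e. e \<in> ?E \<Longrightarrow> hsource H e \<subseteq> ?V"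
    using fin by (auto simp: finite_hypergraph_def)
  have pr: "\<And>v. v \<in> ?V \<Longrightarrow> cstar_projection A (P v)"
    and po: "\<And>v w. v \<in> ?V \<Longrightarrow> w \<in> ?V \<Longrightarrow> v \<noteq> w \<Longrightarrow> P v \<otimes> P w = \<zero>"
    and pi: "\<And>e. e \<in> ?E \<Longrightarrow> cstar_partial_isometry A (S e)"
    and hr1: "\<And>e f. e \<in> ?E \<Longrightarrow> f \<in> ?E \<Longrightarrow> adj A (S e) \<otimes> S f = (if e = f then \<Oplus>v\<in>hrange H e. P v else \<zero>)"
    and hr2a: "\<And>e. e \<in> ?E \<Longrightarrow> cstar_le A (S e \<otimes> adj A (S e)) (\<Oplus>v\<in>hsource H e. P v)"
    and hr2b: "\<And>v. v \<in> ?V \<Longrightarrow> cstar_le A (P v) (\<Oplus>e\<in>{e \<in> ?E. v \<in> hsource H e}. S e \<otimes> adj A (S e))"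
    using ck ns unfolding ck_family_def by auto
  have oss: "J \<subseteq> ?V \<Longrightarrow> K \<subseteq> ?V \<Longrightarrow> K \<subseteq> J \<Longrightarrow> finsum A P J \<otimes> finsum A P K = finsum A P K"
      "J \<subseteq> ?V \<Longrightarrow> K \<subseteq> ?V \<Longrightarrow> K \<inter> J = {} \<Longrightarrow> finsum A P J \<otimes> finsum A P K = \<zero>"
    and osp: "J \<subseteq> ?V \<Longrightarrow> cstar_projection A (finsum A P J)"
    and osc: "J \<subseteq> ?V \<Longrightarrow> finsum A P J \<in> carrier A" for J K
    using orth_sum_mult_sum[of ?V P J K] orth_sum_projection[of ?V P J] orth_sum_closed[of ?V P J] fV pr po
    by blast+
  have Sc [simp]: "S e \<in> carrier A" if "e \<in> ?E" for e using pi[OF that] by (simp add: cstar_partial_isometry_def)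
  have SS: "S e \<otimes> (adj A (S e) \<otimes> S e) = S e" if "e \<in> ?E" for e
    using pi[OF that] that by (simp add: cstar_partial_isometry_def mult_assoc)
  define p where "p e = S e \<otimes> adj A (S e)" for e
  have p_eq: "p = (\<lambda>e. S e \<otimes> adj A (S e))" by (simp add: p_def fun_eq_iff)
  have pc: "p e \<in> carrier A" if "e \<in> ?E" for e using that by (simp add: p_def)
  have pp: "cstar_projection A (p e)" if "e \<in> ?E" for e
    using that SS[OF that] by (simp add: cstar_projection_def p_def distribs) (simp add: mult_assoc [symmetric])
  have porth: "p e \<otimes> p f = \<zero>" if "e \<in> ?E" "f \<in> ?E" "e \<noteq> f" for e f
  proof -
    have "p e \<otimes> p f = S e \<otimes> ((adj A (S e) \<otimes> S f) \<otimes> adj A (S f))" using that by (simp add: p_def mult_assoc)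
    then show ?thesis using that hr1[of e f] by simp
  qed
  have us: "J \<subseteq> ?E \<Longrightarrow> K \<subseteq> ?E \<Longrightarrow> K \<subseteq> J \<Longrightarrow> finsum A p J \<otimes> finsum A p K = finsum A p K"
    and usp: "J \<subseteq> ?E \<Longrightarrow> cstar_projection A (finsum A p J)" for J K
    using orth_sum_mult_sum(1)[of ?E p J K] orth_sum_projection[of ?E p J] fE pp porth by blast+
  define u where "u = finsum A p ?E"
  have u: "u \<in> carrier A" "adj A u = u" using usp[OF subset_refl] by (auto simp: u_def cstar_projection_def)
  have source: "(\<Oplus>v\<in>hsource H e. P v) \<otimes> S e = S e" if e: "e \<in> ?E" for e
  proof -
    have "(\<Oplus>v\<in>hsource H e. P v) \<otimes> p e = p e"
      using projection_le_imp_mult[OF pp[OF e] osp] hr2a[OF e] src[OF e] by (simp add: p_def)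
    then have "(\<Oplus>v\<in>hsource H e. P v) \<otimes> (p e \<otimes> S e) = p e \<otimes> S e"
      using e osc[OF src[OF e]] by (simp add: pc flip: mult_assoc)
    then show ?thesis using SS[OF e] e by (simp add: p_def mult_assoc)
  qed
  have unit: "P v \<otimes> u = P v" if v: "v \<in> ?V" for v
  proof -
    let ?F = "{e \<in> ?E. v \<in> hsource H e}"
    have Pv: "P v \<in> carrier A" "adj A (P v) = P v" using pr[OF v] by (auto simp: cstar_projection_def)
    have F: "?F \<subseteq> ?E" by auto
    have uv: "finsum A p ?F \<in> carrier A" using usp[OF F] by (simp add: cstar_projection_def)
    have "finsum A p ?F \<otimes> P v = P v"
      using projection_le_imp_mult[OF pr[OF v] usp[OF F]] hr2b[OF v] unfolding p_eq by simp
    moreover have "u \<otimes> finsum A p ?F = finsum A p ?F" unfolding u_def by (rule us[OF subset_refl F F])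
    ultimately have "u \<otimes> P v = P v" using mult_assoc[OF u(1) uv Pv(1)] by simp
    then have "adj A (u \<otimes> P v) = adj A (P v)" by simp
    then show ?thesis using u Pv by (simp add: adj_mult)
  qed
  show ?thesis
  proof (intro edge_family.intro edge_family_axioms.intro A)
    fix e f assume e: "e \<in> ?E" and f: "f \<in> ?E"
    show "e \<noteq> f \<Longrightarrow> adj A (S e) \<otimes> S f = \<zero>" using hr1[OF e f] by simp
    have "adj A (S e) \<otimes> (S e \<otimes> S f) = (\<Oplus>v\<in>hrange H e. P v) \<otimes> S f"
      using hr1[OF e e] e f by (simp flip: mult_assoc)
    \<comment> \<open>With the source sum inserted, quasi perfectness leaves two cases: the source
      of \<open>f\<close> lies in the range of \<open>e\<close> or is disjoint from it.\<close>
    also have "\<dots> = (\<Oplus>v\<in>hrange H e. P v) \<otimes> (\<Oplus>v\<in>hsource H f. P v) \<otimes> S f"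
      using source[OF f] osc[OF rng[OF e]] osc[OF src[OF f]] f by (simp add: mult_assoc)
    also have "\<dots> = (if htransition H e f then S f else \<zero>)"
    proof (cases "htransition H e f")
      case True
      then have "hsource H f \<subseteq> hrange H e" using qp e f by (auto simp: only_quasi_perfect_paths_def htransition_def)
      then show ?thesis using True oss(1)[OF rng[OF e] src[OF f]] source[OF f] by simp
    next
      case False
      then have "hsource H f \<inter> hrange H e = {}" by (simp add: htransition_def)
      then show ?thesis using False oss(2)[OF rng[OF e] src[OF f]] f by simp
    qed
    finally show "adj A (S e) \<otimes> (S e \<otimes> S f) = (if htransition H e f then S f else \<zero>)" .
  next
    fix e assume e: "e \<in> ?E"
    have fr: "finite (hrange H e)" using rng[OF e] fV by (rule finite_subset)
    have Pc: "P \<in> hrange H e \<rightarrow> carrier A" using pr rng[OF e] by (auto simp: cstar_projection_def)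
    have "(\<Oplus>v\<in>hrange H e. P v) \<otimes> u = (\<Oplus>v\<in>hrange H e. P v \<otimes> u)"
      using fr Pc u by (intro finsum_mult) auto
    also have "\<dots> = (\<Oplus>v\<in>hrange H e. P v)"
      using unit rng[OF e] Pc by (intro finsum_cong') auto
    finally have "adj A (S e) \<otimes> S e \<otimes> u = adj A (S e) \<otimes> S e" using hr1[OF e e] by simp
    then have "S e \<otimes> (adj A (S e) \<otimes> S e) \<otimes> u = S e \<otimes> (adj A (S e) \<otimes> S e)"
      using e u by (simp add: mult_assoc)
    then have "S e \<otimes> u = S e" using SS[OF e] by simp
    then show "S e \<otimes> (\<Oplus>f\<in>?E. S f \<otimes> adj A (S f)) = S e" by (simp add: u_def p_eq)
  qed (use fE SS in auto)
qed

text \<open>The family in the zero algebra; it shows that the supremum defining the universal norm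
  is over a non-empty set.\<close>

lemma ck_family_trivial:
  fixes A (structure)
  assumes A: "cstar_algebra A" and triv: "\<And>x y. x \<in> carrier A \<Longrightarrow> y \<in> carrier A \<Longrightarrow> x = y"
    and fin: "finite_hypergraph H"
    and P: "\<And>v. v \<in> hverts H \<Longrightarrow> P v \<in> carrier A" and S: "\<And>e. e \<in> hedges H \<Longrightarrow> S e \<in> carrier A"
  shows "ck_family H A P S"
proof -
  interpret cstar_algebra A by (rule A)
  have sub: "hrange H e \<subseteq> hverts H" "hsource H e \<subseteq> hverts H" if "e \<in> hedges H" for e
    using that fin by (auto simp: finite_hypergraph_def)
  have le: "cstar_le A x y" if "x \<in> carrier A" "y \<in> carrier A" for x y
    unfolding cstar_le_def cstar_positive_def
    using that triv[of "y \<ominus> x" "adj A \<zero> \<otimes> \<zero>"] by (intro conjI bexI[of _ \<zero>]) simp_all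
  have sum: "(\<Oplus>v\<in>hrange H e. P v) \<in> carrier A" "(\<Oplus>v\<in>hsource H e. P v) \<in> carrier A"
    if "e \<in> hedges H" for e
    using sub[OF that] P by (auto intro!: finsum_closed)
  have sum': "(\<Oplus>e\<in>{e \<in> hedges H. v \<in> hsource H e}. S e \<otimes> adj A (S e)) \<in> carrier A" for v
    using S by (auto intro!: finsum_closed)
  show ?thesis
    unfolding ck_family_def cstar_projection_def cstar_partial_isometry_def
    using P S by (auto intro!: triv le sum sum')
qed

section \<open>Edge relations as zeros of the seminorm\<close>

context free_seminorm
begin

definition const :: "'x free_star \<Rightarrow> (nat \<Rightarrow> 'x free_star) set" where
  "const a = cls (\<lambda>n. a)"

lemma completion_gen_const: "completion_gen G q x = const (free_gen x)"
  by (simp add: completion_gen_def const_def)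

lemma const_closed [simp]: "a \<in> V \<Longrightarrow> const a \<in> carrier C"
  by (simp add: const_def)

lemma const_add: "a \<in> V \<Longrightarrow> b \<in> V \<Longrightarrow> const (a + b) = const a \<oplus>\<^bsub>C\<^esub> const b"
  and const_mult: "a \<in> V \<Longrightarrow> b \<in> V \<Longrightarrow> const (a * b) = const a \<otimes>\<^bsub>C\<^esub> const b"
  and const_adj: "a \<in> V \<Longrightarrow> const (free_adj a) = adj C (const a)"
  and const_zero: "const 0 = \<zero>\<^bsub>C\<^esub>"
  by (simp_all add: const_def cls_simps)

lemma free_carrier_sum [simp]: "(\<And>i. i \<in> I \<Longrightarrow> a i \<in> V) \<Longrightarrow> sum a I \<in> V"
  by (induction I rule: infinite_finite_induct) auto

lemma const_sum:
  "finite I \<Longrightarrow> (\<And>i. i \<in> I \<Longrightarrow> a i \<in> V) \<Longrightarrow> const (sum a I) = (\<Oplus>\<^bsub>C\<^esub>i\<in>I. const (a i))"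
proof (induction I rule: finite_induct)
  case empty
  interpret abelian_group C by (rule abelian_group)
  show ?case by (simp add: const_zero finsum_empty)
next
  case (insert i I)
  interpret abelian_group C by (rule abelian_group)
  show ?case using insert by (simp add: const_add finsum_insert Pi_def)
qed

lemma const_eq_iff: "a \<in> V \<Longrightarrow> b \<in> V \<Longrightarrow> const a = const b \<longleftrightarrow> q (a - b) = 0"
  by (simp add: const_def cls_eq_iff LIMSEQ_const_iff)

text \<open>Two constant classes agree exactly if \<open>q\<close> vanishes on the difference. Each
  relation is thus a zero of \<open>q\<close> at an element that is independent of
  \<open>q\<close>.\<close>

lemma edge_family_iff:
  fixes g :: "'e \<Rightarrow> 'x"
  assumes E: "finite E" "g ` E \<subseteq> G"
  defines "x \<equiv> \<lambda>e. free_gen (g e)"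
  shows "edge_family C E T (\<lambda>e. completion_gen G q (g e)) \<longleftrightarrow>
     (\<forall>e\<in>E. \<forall>f\<in>E. e \<noteq> f \<longrightarrow> q (free_adj (x e) * x f - 0) = 0) \<and>
     (\<forall>e\<in>E. q (x e * (free_adj (x e) * x e) - x e) = 0) \<and>
     (\<forall>e\<in>E. \<forall>f\<in>E. q (free_adj (x e) * (x e * x f) - (if T e f then x f else 0)) = 0) \<and>
     (\<forall>e\<in>E. q (x e * (\<Sum>f\<in>E. x f * free_adj (x f)) - x e) = 0)"
proof -
  have x: "x e \<in> V" if "e \<in> E" for e using E that by (auto simp: x_def)
  have sum: "(\<Oplus>\<^bsub>C\<^esub>f\<in>E. const (x f) \<otimes>\<^bsub>C\<^esub> adj C (const (x f))) = const (\<Sum>f\<in>E. x f * free_adj (x f))"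
  proof -
    interpret abelian_group C by (rule abelian_group)
    have "(\<Oplus>\<^bsub>C\<^esub>f\<in>E. const (x f) \<otimes>\<^bsub>C\<^esub> adj C (const (x f))) = (\<Oplus>\<^bsub>C\<^esub>f\<in>E. const (x f * free_adj (x f)))"
    proof (rule finsum_cong')
      show "(\<lambda>f. const (x f * free_adj (x f))) \<in> E \<rightarrow> carrier C" using x by (intro funcsetI const_closed) simp
    qed (use x in \<open>simp_all add: const_mult const_adj\<close>)
    then show ?thesis using E(1) x by (simp add: const_sum)
  qed
  have 1: "const (x e) \<in> carrier C" if "e \<in> E" for e using x[OF that] by simp
  have 2: "adj C (const (x e)) \<otimes>\<^bsub>C\<^esub> const (x f) = \<zero>\<^bsub>C\<^esub> \<longleftrightarrow> q (free_adj (x e) * x f - 0) = 0"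
    if "e \<in> E" "f \<in> E" for e f
    using that x const_eq_iff[of "free_adj (x e) * x f" 0] by (simp add: const_mult const_adj const_zero)
  have 3: "const (x e) \<otimes>\<^bsub>C\<^esub> (adj C (const (x e)) \<otimes>\<^bsub>C\<^esub> const (x e)) = const (x e) \<longleftrightarrow>
      q (x e * (free_adj (x e) * x e) - x e) = 0" if "e \<in> E" for e
    using that x const_eq_iff[of "x e * (free_adj (x e) * x e)" "x e"] by (simp add: const_mult const_adj)
  have 4: "adj C (const (x e)) \<otimes>\<^bsub>C\<^esub> (const (x e) \<otimes>\<^bsub>C\<^esub> const (x f)) = (if T e f then const (x f) else \<zero>\<^bsub>C\<^esub>) \<longleftrightarrow>
      q (free_adj (x e) * (x e * x f) - (if T e f then x f else 0)) = 0" if "e \<in> E" "f \<in> E" for e f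
    using that x const_eq_iff[of "free_adj (x e) * (x e * x f)" "if T e f then x f else 0"]
    by (cases "T e f") (simp_all add: const_mult const_adj const_zero)
  have 5: "const (x e) \<otimes>\<^bsub>C\<^esub> (\<Oplus>\<^bsub>C\<^esub>f\<in>E. const (x f) \<otimes>\<^bsub>C\<^esub> adj C (const (x f))) = const (x e) \<longleftrightarrow>
      q (x e * (\<Sum>f\<in>E. x f * free_adj (x f)) - x e) = 0" if "e \<in> E" for e
    unfolding sum using that x const_eq_iff[of "x e * (\<Sum>f\<in>E. x f * free_adj (x f))" "x e"] by (simp add: const_mult)
  have gen: "completion_gen G q (g e) = const (x e)" for e
    by (simp add: completion_gen_const x_def)
  show ?thesis
    unfolding edge_family_def edge_family_axioms_def gen
    using cstar_algebra E(1) by (simp only: Ball_def 1 2 3 4 5 cong: imp_cong) blast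
qed

end

section \<open>Suprema of C*-seminorms\<close>

lemma SUP_eq_0:
  fixes f :: "'i \<Rightarrow> real"
  assumes "Q \<noteq> {}" "\<And>q. q \<in> Q \<Longrightarrow> f q = 0"
  shows "(SUP q\<in>Q. f q) = 0"
proof -
  have "f ` Q = {0}" using assms by force
  then show ?thesis by simp
qed

text \<open>A common zero of all \<open>q\<close> in \<open>Q\<close> is a zero of their supremum,
  and the relations are such zeros.\<close>

lemma edge_family_transfer:
  fixes g :: "'e \<Rightarrow> 'x" and Q :: "('x free_star \<Rightarrow> real) set"
  assumes E: "finite E" "g ` E \<subseteq> G"
    and Q: "\<And>q. q \<in> Q \<Longrightarrow> cstar_seminorm G q" "Q \<noteq> {}"
    and fam: "\<And>q. q \<in> Q \<Longrightarrow> edge_family (free_completion G q) E T (\<lambda>e. completion_gen G q (g e))"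
    and N: "cstar_seminorm G (\<lambda>a. SUP q\<in>Q. q a)"
  shows "edge_family (free_completion G (\<lambda>a. SUP q\<in>Q. q a)) E T (\<lambda>e. completion_gen G (\<lambda>a. SUP q\<in>Q. q a) (g e))"
proof -
  have 0: "(SUP q\<in>Q. q a) = 0" if "\<And>q. q \<in> Q \<Longrightarrow> q a = 0" for a
    using that Q(2) by (intro SUP_eq_0)
  have q: "free_seminorm G q" if "q \<in> Q" for q using Q(1)[OF that] by (rule free_seminorm.intro)
  note iff = free_seminorm.edge_family_iff[OF _ E]
  show ?thesis
    unfolding iff[OF free_seminorm.intro[OF N]]
    using fam iff[OF q] by (intro conjI ballI impI 0) blast+
qed

lemma cstar_seminorm_SUP:
  fixes Q :: "('x free_star \<Rightarrow> real) set"
  assumes Q: "\<And>q. q \<in> Q \<Longrightarrow> cstar_seminorm G q" and ne: "Q \<noteq> {}"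
    and bdd: "\<And>a. a \<in> free_carrier G \<Longrightarrow> bdd_above ((\<lambda>q. q a) ` Q)"
  shows "cstar_seminorm G (\<lambda>a. SUP q\<in>Q. q a)"
proof -
  let ?N = "\<lambda>a. SUP q\<in>Q. q a"
  have q: "free_seminorm G q" if "q \<in> Q" for q using Q[OF that] by (rule free_seminorm.intro)
  have up: "q a \<le> ?N a" if "q \<in> Q" "a \<in> free_carrier G" for q a
    using that bdd by (intro cSUP_upper) auto
  have least: "?N a \<le> K" if "\<And>q. q \<in> Q \<Longrightarrow> q a \<le> K" for a K
    using that ne by (intro cSUP_least) auto
  have nn: "0 \<le> ?N a" if "a \<in> free_carrier G" for a
  proof -
    obtain q0 where "q0 \<in> Q" using ne by blast
    then show ?thesis using up[OF _ that] free_seminorm.q_nonneg[OF q that] order_trans by blast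
  qed
  have smult: "?N (free_smult c a) = cmod c * ?N a" if a: "a \<in> free_carrier G" for c a
  proof (cases "c = 0")
    case True
    have "q (free_smult c a) = 0" if "q \<in> Q" for q using free_seminorm.q_smult[OF q[OF that] a] True by simp
    then have "?N (free_smult c a) = 0" using ne by (intro SUP_eq_0)
    then show ?thesis using True by simp
  next
    case False
    have le: "?N (free_smult c a) \<le> cmod c * ?N a" if a: "a \<in> free_carrier G" for c a
      by (rule least) (simp add: free_seminorm.q_smult[OF q a] mult_left_mono up[OF _ a])
    \<comment> \<open>The missing inequality is the upper bound applied to
      \<open>inverse c\<close>.\<close>
    have "?N a = ?N (free_smult (inverse c) (free_smult c a))"
      using False by (simp add: free_smult_assoc [symmetric] free_smult_one)
    also have "\<dots> \<le> cmod (inverse c) * ?N (free_smult c a)" using a by (intro le) simp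
    finally have "cmod c * ?N a \<le> ?N (free_smult c a)" using False by (simp add: norm_inverse norm_divide field_simps)
    then show ?thesis using le[OF a, of c] by simp
  qed
  have add: "?N (a + b) \<le> ?N a + ?N b" if "a \<in> free_carrier G" "b \<in> free_carrier G" for a b
  proof (rule least)
    fix p assume "p \<in> Q"
    then show "p (a + b) \<le> ?N a + ?N b"
      using free_seminorm.q_add[OF q that, of p] up[of p a] up[of p b] that by linarith
  qed
  have mult: "?N (a * b) \<le> ?N a * ?N b" if ab: "a \<in> free_carrier G" "b \<in> free_carrier G" for a b
  proof (rule least)
    fix p assume p: "p \<in> Q"
    have "p a * p b \<le> ?N a * ?N b"
      using up[OF p] ab nn free_seminorm.q_nonneg[OF q[OF p]] by (intro mult_mono) auto
    then show "p (a * b) \<le> ?N a * ?N b" using free_seminorm.q_mult[OF q[OF p] ab] by linarith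
  qed
  have star: "?N (free_adj a * a) = (?N a)\<^sup>2" if a: "a \<in> free_carrier G" for a
  proof (rule antisym)
    show "?N (free_adj a * a) \<le> (?N a)\<^sup>2"
      using up[OF _ a] free_seminorm.q_nonneg[OF q a]
      by (intro least) (simp add: free_seminorm.q_cstar[OF q a] power_mono)
    have "?N a \<le> sqrt (?N (free_adj a * a))"
    proof (rule least)
      fix p assume p: "p \<in> Q"
      have "(p a)\<^sup>2 \<le> ?N (free_adj a * a)"
        using up[OF p, of "free_adj a * a"] a free_seminorm.q_cstar[OF q[OF p] a] by simp
      then show "p a \<le> sqrt (?N (free_adj a * a))" by (rule real_le_rsqrt)
    qed
    then have "(?N a)\<^sup>2 \<le> (sqrt (?N (free_adj a * a)))\<^sup>2" using nn[OF a] by (intro power_mono)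
    then show "(?N a)\<^sup>2 \<le> ?N (free_adj a * a)" using nn[of "free_adj a * a"] a by simp
  qed
  show ?thesis unfolding cstar_seminorm_def using nn smult star add mult by blast
qed

lemma free_star_eq_sum: "a = (\<Sum>w\<in>Poly_Mapping.keys a. Poly_Mapping.single w (Poly_Mapping.lookup a w))"
proof (rule poly_mapping_eqI)
  fix w
  show "Poly_Mapping.lookup a w =
    Poly_Mapping.lookup (\<Sum>w\<in>Poly_Mapping.keys a. Poly_Mapping.single w (Poly_Mapping.lookup a w)) w"
    by (simp add: lookup_sum lookup_single when_def sum.delta in_keys_iff)
qed

context free_seminorm
begin

lemma q_word_le_1:
  assumes gen: "\<And>x. x \<in> G \<Longrightarrow> q (free_gen x) \<le> 1"
  shows "set l \<subseteq> G \<times> UNIV \<Longrightarrow> l \<noteq> [] \<Longrightarrow>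
    Poly_Mapping.single (FWord l) 1 \<in> V \<and> q (Poly_Mapping.single (FWord l) 1) \<le> 1"
proof (induction l)
  case (Cons y l)
  obtain x b where y: "y = (x, b)" by (cases y)
  have x: "x \<in> G" using Cons.prems y by simp
  have s: "Poly_Mapping.single (FWord [y]) 1 = (if b then free_adj (free_gen x) else free_gen x)"
    by (simp add: y free_gen_def free_adj_single fword_adj_def)
  have 1: "Poly_Mapping.single (FWord [y]) 1 \<in> V \<and> q (Poly_Mapping.single (FWord [y]) 1) \<le> 1"
    unfolding s using x gen[OF x] by (auto simp: q_adj)
  show ?case
  proof (cases "l = []")
    case False
    have IH: "Poly_Mapping.single (FWord l) 1 \<in> V" "q (Poly_Mapping.single (FWord l) 1) \<le> 1"
      using Cons False by auto
    have "Poly_Mapping.single (FWord (y # l)) (1::complex) = Poly_Mapping.single (FWord [y]) 1 * Poly_Mapping.single (FWord l) 1"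
      by (simp add: mult_single plus_fword_def)
    moreover have "q (Poly_Mapping.single (FWord [y]) 1 * Poly_Mapping.single (FWord l) 1) \<le> 1 * 1"
      using 1 IH by (intro order_trans[OF q_mult] mult_mono q_nonneg) auto
    ultimately show ?thesis using 1 IH by simp
  qed (use 1 in simp)
qed simp

lemma q_sum: "(\<And>i. i \<in> I \<Longrightarrow> a i \<in> V) \<Longrightarrow> q (sum a I) \<le> (\<Sum>i\<in>I. q (a i))"
proof (induction I rule: infinite_finite_induct)
  case (insert i I)
  then have "q (sum a (insert i I)) \<le> q (a i) + q (sum a I)" by (simp add: q_add)
  then show ?case using insert by simp
qed auto

text \<open>The l1-norm of the coefficients does not mention \<open>q\<close>. It therefore bounds
  all admissible seminorms at once and makes the supremum finite.\<close>

lemma q_le_coefficients: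
  assumes gen: "\<And>x. x \<in> G \<Longrightarrow> q (free_gen x) \<le> 1" and a: "a \<in> V"
  shows "q a \<le> (\<Sum>w\<in>Poly_Mapping.keys a. cmod (Poly_Mapping.lookup a w))"
proof -
  have w: "Poly_Mapping.single w 1 \<in> V \<and> q (Poly_Mapping.single w 1) \<le> 1" if "w \<in> Poly_Mapping.keys a" for w
  proof (cases w)
    case (FWord l)
    then show ?thesis using a that q_word_le_1[OF gen, of l] by (force simp: free_carrier_def)
  qed
  have e: "Poly_Mapping.single w c = free_smult c (Poly_Mapping.single w 1)" for w and c :: complex
    by (simp add: free_smult_single)
  have "q a = q (\<Sum>w\<in>Poly_Mapping.keys a. Poly_Mapping.single w (Poly_Mapping.lookup a w))"
    by (simp flip: free_star_eq_sum)
  also have "\<dots> \<le> (\<Sum>w\<in>Poly_Mapping.keys a. q (Poly_Mapping.single w (Poly_Mapping.lookup a w)))"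
    using w by (intro q_sum) (subst e, simp)
  also have "\<dots> \<le> (\<Sum>w\<in>Poly_Mapping.keys a. cmod (Poly_Mapping.lookup a w))"
    using w by (intro sum_mono) (subst e, simp add: q_smult mult_left_le)
  finally show ?thesis .
qed

end

lemma huniv_norm_facts:
  fixes H :: "('v, 'e) hypergraph"
  assumes fin: "finite_hypergraph H"
  shows "hadmissible H \<noteq> {}" and "cstar_seminorm (hgens H) (huniv_norm H)"
proof -
  let ?G = "hgens H"
  have G: "Inl v \<in> ?G \<longleftrightarrow> v \<in> hverts H" "Inr e \<in> ?G \<longleftrightarrow> e \<in> hedges H" for v e
    by (auto simp: hgens_def)
  \<comment> \<open>The zero seminorm: its completion has a single point.\<close>
  obtain q0 :: "('v + 'e) free_star \<Rightarrow> real" where q0: "\<And>a. q0 a = 0"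
    by (rule that[of "\<lambda>_. 0"]) simp
  have 0: "cstar_seminorm ?G q0" by (simp add: cstar_seminorm_def q0)
  then interpret z: free_seminorm ?G q0 by (rule free_seminorm.intro)
  have "ck_family H (free_completion ?G q0) (\<lambda>v. completion_gen ?G q0 (Inl v)) (\<lambda>e. completion_gen ?G q0 (Inr e))"
  proof (rule ck_family_trivial[OF z.cstar_algebra _ fin])
    fix x y assume "x \<in> carrier (free_completion ?G q0)" "y \<in> carrier (free_completion ?G q0)"
    then show "x = y" by (elim z.carrier_cases) (simp add: z.cls_eq_iff q0)
  qed (simp_all add: z.completion_gen_const G)
  then show ne: "hadmissible H \<noteq> {}" using 0 by (auto simp: hadmissible_def)
  show "cstar_seminorm ?G (huniv_norm H)"
    unfolding huniv_norm_def [abs_def]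
  proof (rule cstar_seminorm_SUP[OF _ ne])
    fix a assume a: "a \<in> free_carrier ?G"
    show "bdd_above ((\<lambda>q. q a) ` hadmissible H)"
    proof (rule bdd_aboveI2)
      fix q assume q: "q \<in> hadmissible H"
      then interpret free_seminorm ?G q by (simp add: hadmissible_def free_seminorm.intro)
      interpret cstar_algebra C by (rule cstar_algebra)
      \<comment> \<open>In every admissible completion a generator is a projection or a partial
        isometry, hence of norm at most 1.\<close>
      have "q (free_gen x) \<le> 1" if x: "x \<in> ?G" for x
      proof -
        have "cnorm C (const (free_gen x)) \<le> 1"
        proof (cases x)
          case (Inl v)
          then show ?thesis using q x by (intro cnorm_projection_le_1)
            (auto simp: hadmissible_def ck_family_def G simp flip: completion_gen_const)
        next
          case (Inr e)
          then show ?thesis using q x by (intro cnorm_partial_isometry_le_1)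
            (auto simp: hadmissible_def ck_family_def G simp flip: completion_gen_const)
        qed
        then show ?thesis using x by (simp add: const_def cnorm_const)
      qed
      then show "q a \<le> (\<Sum>w\<in>Poly_Mapping.keys a. cmod (Poly_Mapping.lookup a w))"
        using a by (rule q_le_coefficients)
    qed
  qed (simp add: hadmissible_def)
qed

text \<open>The order relations are evaluated in the completion of each admissible seminorm, where
  they are known, and only the resulting edge identities are carried over to the supremum.\<close>

theorem hcstar_edge_family:
  fixes H :: "('v, 'e) hypergraph"
  assumes fin: "finite_hypergraph H" and qp: "only_quasi_perfect_paths H"
    and ns: "\<not> (\<exists>v\<in>hverts H. hsink H v)"
  shows "edge_family (hcstar H) (hedges H) (htransition H) (hiso H)"
proof -
  have "edge_family (free_completion (hgens H) q) (hedges H) (htransition H) (\<lambda>e. completion_gen (hgens H) q (Inr e))"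
    if "q \<in> hadmissible H" for q
  proof -
    interpret free_seminorm "hgens H" q using that by (simp add: hadmissible_def free_seminorm.intro)
    show ?thesis using that by (intro ck_family_edge_family[OF cstar_algebra fin qp ns]) (auto simp: hadmissible_def)
  qed
  then have "edge_family (free_completion (hgens H) (\<lambda>a. SUP q\<in>hadmissible H. q a)) (hedges H) (htransition H)
      (\<lambda>e. completion_gen (hgens H) (\<lambda>a. SUP q\<in>hadmissible H. q a) (Inr e))"
    using huniv_norm_facts[OF fin] fin unfolding huniv_norm_def [abs_def]
    by (intro edge_family_transfer) (auto simp: hadmissible_def finite_hypergraph_def hgens_def)
  then show ?thesis by (simp add: hcstar_def hiso_def [abs_def] huniv_norm_def [abs_def])
qed

section \<open>The core and the grading\<close>

context edge_family
begin

declare s_closed [simp]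

definition p :: "'e \<Rightarrow> 'a" where "p e = s e \<otimes> adj A (s e)"

definition u :: 'a where "u = finsum A p E"

lemma p_closed [simp]: "e \<in> E \<Longrightarrow> p e \<in> carrier A"
  by (simp add: p_def)

lemma u_closed [simp]: "u \<in> carrier A"
  unfolding u_def by (rule finsum_closed) simp

lemma p_adj: "e \<in> E \<Longrightarrow> adj A (p e) = p e"
  by (simp add: p_def distribs)

lemma u_adj: "adj A u = u"
proof -
  have "adj A u = (\<Oplus>e\<in>E. adj A (p e))"
    unfolding u_def using finite_E by (rule adj_finsum) simp
  also have "\<dots> = u" unfolding u_def by (rule finsum_cong') (simp_all add: p_adj)
  finally show ?thesis .
qed

lemma p_s: "e \<in> E \<Longrightarrow> f \<in> E \<Longrightarrow> p e \<otimes> s f = (if e = f then s f else \<zero>)"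
  using s_isometry[of f] s_orth[of e f] by (auto simp: p_def mult_assoc)

lemma u_s: "f \<in> E \<Longrightarrow> u \<otimes> s f = s f"
  unfolding u_def using finite_E
  by (subst finsum_mult) (auto intro!: finsum_delta[of _ f] simp: p_s)

lemma s_u: "e \<in> E \<Longrightarrow> s e \<otimes> u = s e"
  using s_unit[of e] by (simp add: u_def p_def [abs_def])

lemma adj_s_u: "e \<in> E \<Longrightarrow> adj A (s e) \<otimes> u = adj A (s e)"
  using arg_cong[OF u_s[of e], of "adj A"] by (simp add: adj_mult u_adj)

lemma u_adj_s: "e \<in> E \<Longrightarrow> u \<otimes> adj A (s e) = adj A (s e)"
  using arg_cong[OF s_u[of e], of "adj A"] by (simp add: adj_mult u_adj)

lemma p_p: "e \<in> E \<Longrightarrow> f \<in> E \<Longrightarrow> p e \<otimes> p f = (if e = f then p f else \<zero>)"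
  using p_s[of e f] mult_assoc[of "p e" "s f" "adj A (s f)"] by (auto simp: p_def [of f])

text \<open>The corner \<open>u A u\<close>. On it an element is recovered from its compressions by
  the edges, since \<open>u\<close> is the sum of the s_e s_e*.\<close>

definition corner :: "'a set" where
  "corner = {x \<in> carrier A. u \<otimes> x = x \<and> x \<otimes> u = x}"

lemma corner_closed: "x \<in> corner \<Longrightarrow> x \<in> carrier A"
  and u_corner: "x \<in> corner \<Longrightarrow> u \<otimes> x = x"
  by (auto simp: corner_def)

lemma corner_zero: "\<zero> \<in> corner" by (simp add: corner_def)

lemma corner_add: "x \<in> corner \<Longrightarrow> y \<in> corner \<Longrightarrow> x \<oplus> y \<in> corner"
  by (simp add: corner_def mult_l_distr mult_r_distr)

lemma corner_smult: "x \<in> corner \<Longrightarrow> c \<odot> x \<in> corner"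
  by (simp add: corner_def smult_mult_l smult_mult_r)

lemma corner_mult: "x \<in> corner \<Longrightarrow> y \<in> corner \<Longrightarrow> x \<otimes> y \<in> corner"
  unfolding corner_def by (simp add: mult_assoc) (simp add: mult_assoc [symmetric])

lemma corner_adj: "x \<in> corner \<Longrightarrow> adj A x \<in> corner"
proof -
  assume x: "x \<in> corner"
  have "u \<otimes> adj A x = adj A (x \<otimes> u)" "adj A x \<otimes> u = adj A (u \<otimes> x)"
    using corner_closed[OF x] by (simp_all add: adj_mult u_adj)
  then show ?thesis using x by (simp add: corner_def)
qed

lemma corner_s: "e \<in> E \<Longrightarrow> s e \<in> corner" and corner_adj_s: "e \<in> E \<Longrightarrow> adj A (s e) \<in> corner"
  by (simp_all add: corner_def u_s s_u u_adj_s adj_s_u)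

lemma left_decomposition:
  assumes x: "x \<in> corner" shows "x = (\<Oplus>e\<in>E. s e \<otimes> (adj A (s e) \<otimes> x))"
proof -
  have "x = u \<otimes> x" using u_corner[OF x] by simp
  also have "\<dots> = (\<Oplus>e\<in>E. p e \<otimes> x)"
    unfolding u_def using finite_E corner_closed[OF x] by (intro finsum_mult) auto
  also have "\<dots> = (\<Oplus>e\<in>E. s e \<otimes> (adj A (s e) \<otimes> x))"
    using corner_closed[OF x] by (intro finsum_cong') (auto simp: p_def mult_assoc)
  finally show ?thesis .
qed

text \<open>The span of the \<open>p f\<close>: such an \<open>x\<close> equals \<open>u x\<close>,
  the sum of the \<open>c p f\<close>. Scalar action on each \<open>p f\<close>, the same on both
  sides, replaces the span so that closure can be checked one edge at a time.\<close>

definition diag :: "'a set" where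
  "diag = {x \<in> corner. \<forall>f\<in>E. \<exists>c. p f \<otimes> x = c \<odot> p f \<and> x \<otimes> p f = c \<odot> p f}"

text \<open>\<open>K m n\<close> consists of the \<open>x\<close> for which \<open>s\<^sub>\<mu>* x s\<^sub>\<nu>\<close> is diagonal for all paths \<open>\<mu>\<close> and \<open>\<nu>\<close> of
  lengths \<open>m\<close> and \<open>n\<close>; \<open>Kright n\<close> is the case \<open>m = 0\<close>.\<close>

primrec Kright :: "nat \<Rightarrow> 'a set" where
  "Kright 0 = diag"
| "Kright (Suc n) = {x \<in> corner. \<forall>f\<in>E. x \<otimes> s f \<in> Kright n}"

primrec K :: "nat \<Rightarrow> nat \<Rightarrow> 'a set" where
  "K 0 n = Kright n"
| "K (Suc m) n = {x \<in> corner. \<forall>e\<in>E. adj A (s e) \<otimes> x \<in> K m n}"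

lemma Kright_corner: "Kright n \<subseteq> corner"
  by (cases n) (auto simp: diag_def)

lemma K_corner: "x \<in> K m n \<Longrightarrow> x \<in> corner"
  using Kright_corner by (cases m) auto

lemma K_carrier: "x \<in> K m n \<Longrightarrow> x \<in> carrier A"
  using K_corner corner_closed by blast

lemma diag_zero: "\<zero> \<in> diag"
  unfolding diag_def using corner_zero by (auto intro!: exI[of _ 0])

lemma diag_add: "x \<in> diag \<Longrightarrow> y \<in> diag \<Longrightarrow> x \<oplus> y \<in> diag"
  unfolding diag_def
proof (clarsimp simp: corner_add)
  fix f assume f: "f \<in> E" and xy: "x \<in> corner" "y \<in> corner"
    "\<forall>f\<in>E. \<exists>c. p f \<otimes> x = c \<odot> p f \<and> x \<otimes> p f = c \<odot> p f"
    "\<forall>f\<in>E. \<exists>c. p f \<otimes> y = c \<odot> p f \<and> y \<otimes> p f = c \<odot> p f"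
  then obtain c d where "p f \<otimes> x = c \<odot> p f" "x \<otimes> p f = c \<odot> p f" "p f \<otimes> y = d \<odot> p f" "y \<otimes> p f = d \<odot> p f"
    by blast
  then show "\<exists>c. p f \<otimes> (x \<oplus> y) = c \<odot> p f \<and> (x \<oplus> y) \<otimes> p f = c \<odot> p f"
    using f xy by (intro exI[of _ "c + d"]) (simp add: corner_closed mult_l_distr mult_r_distr smult_l_distr)
qed

lemma diag_smult: "x \<in> diag \<Longrightarrow> c \<odot> x \<in> diag"
  unfolding diag_def
proof (clarsimp simp: corner_smult)
  fix f assume f: "f \<in> E" and x: "x \<in> corner"
    "\<forall>f\<in>E. \<exists>c. p f \<otimes> x = c \<odot> p f \<and> x \<otimes> p f = c \<odot> p f"
  then obtain d where "p f \<otimes> x = d \<odot> p f" "x \<otimes> p f = d \<odot> p f" by blast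
  then show "\<exists>d. p f \<otimes> (c \<odot> x) = d \<odot> p f \<and> (c \<odot> x) \<otimes> p f = d \<odot> p f"
    using f x by (intro exI[of _ "c * d"]) (simp add: corner_closed smult_mult_l smult_mult_r smult_assoc)
qed

lemma diag_mult: "x \<in> diag \<Longrightarrow> y \<in> diag \<Longrightarrow> x \<otimes> y \<in> diag"
  unfolding diag_def
proof (clarsimp simp: corner_mult)
  fix f assume f: "f \<in> E" and xy: "x \<in> corner" "y \<in> corner"
    "\<forall>f\<in>E. \<exists>c. p f \<otimes> x = c \<odot> p f \<and> x \<otimes> p f = c \<odot> p f"
    "\<forall>f\<in>E. \<exists>c. p f \<otimes> y = c \<odot> p f \<and> y \<otimes> p f = c \<odot> p f"
  then obtain c d where cd: "p f \<otimes> x = c \<odot> p f" "x \<otimes> p f = c \<odot> p f" "p f \<otimes> y = d \<odot> p f" "y \<otimes> p f = d \<odot> p f"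
    by blast
  have "p f \<otimes> (x \<otimes> y) = c \<odot> (p f \<otimes> y)"
    using f xy cd by (simp add: corner_closed smult_mult_l flip: mult_assoc)
  moreover have "(x \<otimes> y) \<otimes> p f = d \<odot> (x \<otimes> p f)"
    using f xy cd by (simp add: corner_closed smult_mult_r mult_assoc)
  ultimately show "\<exists>c. p f \<otimes> (x \<otimes> y) = c \<odot> p f \<and> (x \<otimes> y) \<otimes> p f = c \<odot> p f"
    using f cd by (intro exI[of _ "c * d"]) (simp add: smult_assoc [symmetric] mult.commute)
qed

lemma diag_adj: "x \<in> diag \<Longrightarrow> adj A x \<in> diag"
  unfolding diag_def
proof (clarsimp simp: corner_adj)
  fix f assume f: "f \<in> E" and x: "x \<in> corner"
    "\<forall>f\<in>E. \<exists>c. p f \<otimes> x = c \<odot> p f \<and> x \<otimes> p f = c \<odot> p f"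
  then obtain d where d: "p f \<otimes> x = d \<odot> p f" "x \<otimes> p f = d \<odot> p f" by blast
  have "p f \<otimes> adj A x = adj A (x \<otimes> p f)" "adj A x \<otimes> p f = adj A (p f \<otimes> x)"
    using f x by (simp_all add: adj_mult corner_closed p_adj)
  then show "\<exists>d. p f \<otimes> adj A x = d \<odot> p f \<and> adj A x \<otimes> p f = d \<odot> p f"
    using f d by (intro exI[of _ "cnj d"]) (simp add: adj_smult p_adj)
qed

text \<open>By \<open>s_transition\<close>, s_e* s_e acts on each \<open>p f\<close> as the scalar 0
  or 1 given by \<open>T e f\<close>.\<close>

lemma diag_source_projection: "e \<in> E \<Longrightarrow> adj A (s e) \<otimes> s e \<in> diag"
  unfolding diag_def
proof (clarsimp simp: corner_mult corner_s corner_adj_s)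
  fix f assume e: "e \<in> E" and f: "f \<in> E"
  have "adj A (s e) \<otimes> s e \<otimes> p f = adj A (s e) \<otimes> (s e \<otimes> s f) \<otimes> adj A (s f)"
    using e f by (simp add: p_def mult_assoc)
  also have "\<dots> = (if T e f then 1 else 0) \<odot> p f"
    using e f by (simp add: s_transition p_def smult_one)
  finally have 1: "adj A (s e) \<otimes> s e \<otimes> p f = (if T e f then 1 else 0) \<odot> p f" .
  have "p f \<otimes> (adj A (s e) \<otimes> s e) = adj A (adj A (s e) \<otimes> s e \<otimes> p f)"
    using e f by (simp add: distribs p_adj)
  also have "\<dots> = (if T e f then 1 else 0) \<odot> p f"
    unfolding 1 using f by (simp add: adj_smult p_adj)
  finally show "\<exists>c. p f \<otimes> (adj A (s e) \<otimes> s e) = c \<odot> p f \<and> adj A (s e) \<otimes> s e \<otimes> p f = c \<odot> p f"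
    using 1 by blast
qed

text \<open>As \<open>x s_f = c s_f\<close>, the compression is a multiple of s_e* s_f, which is
  zero or a source projection. This is the reason why the stages \<open>K m n\<close> grow with
  \<open>m\<close> and \<open>n\<close>.\<close>

lemma diag_compress:
  assumes x: "x \<in> diag" and e: "e \<in> E" and f: "f \<in> E"
  shows "adj A (s e) \<otimes> (x \<otimes> s f) \<in> diag"
proof -
  have xc: "x \<in> carrier A" using x corner_closed by (auto simp: diag_def)
  obtain c where c: "x \<otimes> p f = c \<odot> p f" using x f by (auto simp: diag_def)
  have "x \<otimes> s f = x \<otimes> p f \<otimes> s f" using xc f by (simp add: mult_assoc p_s)
  also have "\<dots> = c \<odot> s f" using f by (simp add: c smult_mult_l p_s)
  finally have "adj A (s e) \<otimes> (x \<otimes> s f) = c \<odot> (adj A (s e) \<otimes> s f)" using e f by (simp add: smult_mult_r)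
  then show ?thesis
    using e f s_orth[of e f] diag_source_projection[OF e] diag_smult diag_zero by (cases "e = f") auto
qed

section \<open>The stages and their products\<close>

lemma Kright_subspace:
  "\<zero> \<in> Kright n" "x \<in> Kright n \<Longrightarrow> y \<in> Kright n \<Longrightarrow> x \<oplus> y \<in> Kright n" "x \<in> Kright n \<Longrightarrow> c \<odot> x \<in> Kright n"
proof (induction n arbitrary: x y c)
  case 0
  { case 1 show ?case by (simp add: diag_zero) }
  { case 2 then show ?case by (simp add: diag_add) }
  { case 3 then show ?case by (simp add: diag_smult) }
next
  case (Suc n)
  { case 1 show ?case using Suc by (simp add: corner_zero) }
  { case 2 then show ?case using Suc by (simp add: corner_add mult_l_distr corner_closed) }
  { case 3 then show ?case using Suc by (simp add: corner_smult smult_mult_l corner_closed) }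
qed

lemma K_subspace:
  "\<zero> \<in> K m n" "x \<in> K m n \<Longrightarrow> y \<in> K m n \<Longrightarrow> x \<oplus> y \<in> K m n" "x \<in> K m n \<Longrightarrow> c \<odot> x \<in> K m n"
proof (induction m arbitrary: x y c)
  case 0
  { case 1 show ?case by (simp add: Kright_subspace) }
  { case 2 then show ?case by (simp add: Kright_subspace) }
  { case 3 then show ?case by (simp add: Kright_subspace) }
next
  case (Suc m)
  { case 1 show ?case using Suc by (simp add: corner_zero) }
  { case 2 then show ?case using Suc by (simp add: corner_add mult_r_distr corner_closed) }
  { case 3 then show ?case using Suc by (simp add: corner_smult smult_mult_r corner_closed) }
qed

lemma K_finsum:
  assumes "finite I" "\<And>i. i \<in> I \<Longrightarrow> g i \<in> K m n"
  shows "finsum A g I \<in> K m n"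
  using assms
proof (induction I rule: finite_induct)
  case (insert i I)
  then have "g \<in> I \<rightarrow> carrier A" "g i \<in> carrier A" using K_carrier by blast+
  then show ?case using insert by (simp add: finsum_insert K_subspace)
qed (simp add: finsum_empty K_subspace)

lemma Kright_adj_s: "x \<in> Kright n \<Longrightarrow> e \<in> E \<Longrightarrow> adj A (s e) \<otimes> x \<in> Kright (Suc n)"
proof (induction n arbitrary: x)
  case 0
  then have "x \<in> corner" by (simp add: diag_def)
  then show ?case using 0 diag_compress
    by (auto simp: corner_mult corner_adj_s mult_assoc corner_closed)
next
  case (Suc n)
  then have x: "x \<in> corner" by simp
  have "adj A (s e) \<otimes> x \<otimes> s f \<in> Kright (Suc n)" if "f \<in> E" for f
    using Suc.IH[of "x \<otimes> s f"] Suc.prems that x by (simp add: mult_assoc corner_closed)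
  then show ?case using x Suc.prems corner_mult corner_adj_s by (subst Kright.simps) blast
qed

text \<open>The stages of one degree \<open>m - n\<close> are nested, so two elements of the same
  degree always lie in a common stage.\<close>

lemma K_raise: "x \<in> K m n \<Longrightarrow> x \<in> K (Suc m) (Suc n)"
proof (induction m arbitrary: x)
  case 0
  then have "x \<in> corner" "\<forall>e\<in>E. adj A (s e) \<otimes> x \<in> K 0 (Suc n)"
    using Kright_corner Kright_adj_s by (auto simp del: Kright.simps)
  then show ?case by (subst K.simps) blast
next
  case (Suc m)
  then have "x \<in> corner" "\<forall>e\<in>E. adj A (s e) \<otimes> x \<in> K (Suc m) (Suc n)" by auto
  then show ?case by (subst K.simps) blast
qed

lemma K_raise_add: "x \<in> K m n \<Longrightarrow> x \<in> K (m + k) (n + k)"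
  by (induction k) (auto simp del: K.simps dest: K_raise)

text \<open>\<open>K\<close> is defined by stripping left edges before right ones; this gives access
  to the right end for arbitrary \<open>m\<close>, as taking adjoints requires.\<close>

lemma K_right: "x \<in> corner \<Longrightarrow> (\<And>f. f \<in> E \<Longrightarrow> x \<otimes> s f \<in> K m n) \<Longrightarrow> x \<in> K m (Suc n)"
proof (induction m arbitrary: x)
  case (Suc m)
  have "adj A (s e) \<otimes> x \<in> K m (Suc n)" if e: "e \<in> E" for e
  proof (rule Suc.IH)
    show "adj A (s e) \<otimes> x \<in> corner" using Suc.prems e by (simp add: corner_mult corner_adj_s)
    show "adj A (s e) \<otimes> x \<otimes> s f \<in> K m n" if "f \<in> E" for f
      using Suc.prems(2)[OF that] e that corner_closed[OF Suc.prems(1)] by (simp add: mult_assoc)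
  qed
  then show ?case using Suc.prems by simp
qed simp

lemma K_adj: "x \<in> K m n \<Longrightarrow> adj A x \<in> K n m"
proof (induction m arbitrary: x)
  case 0
  then have "x \<in> Kright n" by simp
  then show ?case
  proof (induction n arbitrary: x)
    case 0
    then show ?case by (simp add: diag_adj)
  next
    case (Suc n)
    then have x: "x \<in> corner" by simp
    have "adj A (s f) \<otimes> adj A x \<in> K n 0" if "f \<in> E" for f
      using Suc.IH[of "x \<otimes> s f"] Suc.prems that x by (simp add: adj_mult corner_closed)
    then show ?case using x by (simp add: corner_adj)
  qed
next
  case (Suc m)
  then have x: "x \<in> corner" by simp
  show ?case
  proof (rule K_right)
    fix e assume e: "e \<in> E"
    then have "adj A (adj A (s e) \<otimes> x) \<in> K n m" using Suc by simp
    then show "adj A x \<otimes> s e \<in> K n m" using e x by (simp add: adj_mult adj_adj corner_closed)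
  qed (use x in \<open>rule corner_adj\<close>)
qed

lemma diag_Kright: "x \<in> diag \<Longrightarrow> y \<in> Kright n \<Longrightarrow> x \<otimes> y \<in> Kright n"
proof (induction n arbitrary: y)
  case 0
  then show ?case by (simp add: diag_mult)
next
  case (Suc n)
  then have xy: "x \<in> corner" "y \<in> corner" by (auto simp: diag_def)
  have "x \<otimes> y \<otimes> s f \<in> Kright n" if "f \<in> E" for f
    using Suc.IH[OF Suc.prems(1), of "y \<otimes> s f"] Suc.prems that xy by (simp add: mult_assoc corner_closed)
  then show ?case using xy by (simp add: corner_mult)
qed

text \<open>Inserting \<open>u\<close> between the factors shortens both inner paths by one edge,
  which drives the induction for products.\<close>

lemma mult_decomposition:
  assumes "x \<in> corner" "y \<in> corner"
  shows "x \<otimes> y = (\<Oplus>e\<in>E. (x \<otimes> s e) \<otimes> (adj A (s e) \<otimes> y))"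
proof -
  have xy: "x \<in> carrier A" "y \<in> carrier A" using assms corner_closed by auto
  have "x \<otimes> y = x \<otimes> (\<Oplus>e\<in>E. s e \<otimes> (adj A (s e) \<otimes> y))" using left_decomposition[OF assms(2)] by simp
  also have "\<dots> = (\<Oplus>e\<in>E. x \<otimes> (s e \<otimes> (adj A (s e) \<otimes> y)))"
    using finite_E xy by (intro mult_finsum) auto
  also have "\<dots> = (\<Oplus>e\<in>E. (x \<otimes> s e) \<otimes> (adj A (s e) \<otimes> y))"
    using xy by (intro finsum_cong') (auto simp: mult_assoc)
  finally show ?thesis .
qed

lemma Kright_K: "x \<in> Kright m \<Longrightarrow> y \<in> K m n \<Longrightarrow> x \<otimes> y \<in> Kright n"
proof (induction m arbitrary: x y)
  case 0
  then show ?case by (simp add: diag_Kright)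
next
  case (Suc m)
  have "(\<Oplus>e\<in>E. (x \<otimes> s e) \<otimes> (adj A (s e) \<otimes> y)) \<in> K 0 n"
    using Suc finite_E by (intro K_finsum) auto
  then show ?case using mult_decomposition[of x y] Suc.prems by simp
qed

lemma K_mult: "x \<in> K l m \<Longrightarrow> y \<in> K m n \<Longrightarrow> x \<otimes> y \<in> K l n"
proof (induction l arbitrary: x)
  case 0
  then show ?case by (simp add: Kright_K)
next
  case (Suc l)
  then have xy: "x \<in> corner" "y \<in> corner" using K_corner by auto
  have "adj A (s e) \<otimes> (x \<otimes> y) \<in> K l n" if "e \<in> E" for e
    using Suc.IH[of "adj A (s e) \<otimes> x"] Suc.prems that xy by (simp add: mult_assoc corner_closed)
  then show ?case using xy by (simp add: corner_mult)
qed

lemma K_s: "e \<in> E \<Longrightarrow> s e \<in> K (Suc 0) 0"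
  using s_orth diag_zero diag_source_projection by (auto simp: corner_s) metis

section \<open>The grading by degree\<close>

definition homogeneous :: "int \<Rightarrow> 'a set" where
  "homogeneous k = {x. \<exists>m n. int m - int n = k \<and> x \<in> K m n}"

lemma homogeneous_carrier: "x \<in> homogeneous k \<Longrightarrow> x \<in> carrier A"
  using K_carrier by (auto simp: homogeneous_def)

lemma homogeneous_zero: "\<zero> \<in> homogeneous k"
proof -
  have "int (nat k) - int (nat (- k)) = k" by simp
  then show ?thesis unfolding homogeneous_def using K_subspace(1) by blast
qed

lemma homogeneous_smult: "x \<in> homogeneous k \<Longrightarrow> c \<odot> x \<in> homogeneous k"
  unfolding homogeneous_def using K_subspace(3) by blast

lemma homogeneous_add: "x \<in> homogeneous k \<Longrightarrow> y \<in> homogeneous k \<Longrightarrow> x \<oplus> y \<in> homogeneous k"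
proof -
  assume "x \<in> homogeneous k" "y \<in> homogeneous k"
  then obtain m n m' n' where *: "int m - int n = k" "x \<in> K m n" "int m' - int n' = k" "y \<in> K m' n'"
    by (auto simp: homogeneous_def)
  have "x \<in> K (m + m') (n + m')" using *(2) by (rule K_raise_add)
  moreover have "y \<in> K (m' + m) (n' + m)" using *(4) by (rule K_raise_add)
  moreover have "n' + m = n + m'" "m' + m = m + m'" using * by auto
  ultimately have "x \<oplus> y \<in> K (m + m') (n + m')" using K_subspace(2) by metis
  moreover have "int (m + m') - int (n + m') = k" using * by simp
  ultimately show ?thesis unfolding homogeneous_def by blast
qed

lemma homogeneous_adj: "x \<in> homogeneous k \<Longrightarrow> adj A x \<in> homogeneous (- k)"
  unfolding homogeneous_def using K_adj by force

lemma homogeneous_mult: "x \<in> homogeneous k \<Longrightarrow> y \<in> homogeneous l \<Longrightarrow> x \<otimes> y \<in> homogeneous (k + l)"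
proof -
  assume "x \<in> homogeneous k" "y \<in> homogeneous l"
  then obtain m n m' n' where *: "int m - int n = k" "x \<in> K m n" "int m' - int n' = l" "y \<in> K m' n'"
    by (auto simp: homogeneous_def)
  \<comment> \<open>Both factors are raised until the inner indices agree at
    \<open>n + m'\<close>.\<close>
  have "x \<in> K (m + m') (n + m')" using *(2) by (rule K_raise_add)
  moreover have "y \<in> K (n + m') (n' + n)" using K_raise_add[OF *(4), of n] by (simp add: add.commute)
  ultimately have "x \<otimes> y \<in> K (m + m') (n' + n)" by (rule K_mult)
  moreover have "int (m + m') - int (n' + n) = k + l" using * by simp
  ultimately show ?thesis unfolding homogeneous_def by blast
qed

lemma homogeneous_s: "e \<in> E \<Longrightarrow> s e \<in> homogeneous 1"
proof -
  assume "e \<in> E"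
  moreover have "int (Suc 0) - int 0 = 1" by simp
  ultimately show ?thesis unfolding homogeneous_def using K_s by blast
qed

text \<open>Sums may repeat a degree and are collected later. The bound \<open>n\<close> is recorded
  because it limits the number of degrees to \<open>2 n + 1\<close> and adds up in products.\<close>

inductive_set graded :: "nat \<Rightarrow> 'a set" for n :: nat where
  zero: "\<zero> \<in> graded n"
| add: "x \<in> homogeneous k \<Longrightarrow> \<bar>k\<bar> \<le> int n \<Longrightarrow> y \<in> graded n \<Longrightarrow> x \<oplus> y \<in> graded n"

lemma graded_carrier: "x \<in> graded n \<Longrightarrow> x \<in> carrier A"
  by (induction rule: graded.induct) (auto simp: homogeneous_carrier)

lemma homogeneous_graded: "x \<in> homogeneous k \<Longrightarrow> \<bar>k\<bar> \<le> int n \<Longrightarrow> x \<in> graded n"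
  using graded.add[OF _ _ graded.zero, of x k n] homogeneous_carrier[of x k] by simp

lemma graded_mono: "x \<in> graded m \<Longrightarrow> m \<le> n \<Longrightarrow> x \<in> graded n"
  by (induction rule: graded.induct) (auto intro!: graded.intros)

lemma graded_add: "x \<in> graded n \<Longrightarrow> y \<in> graded n \<Longrightarrow> x \<oplus> y \<in> graded n"
proof (induction rule: graded.induct)
  case (add x k z)
  then show ?case
    using graded.add[of x k n "z \<oplus> y"] by (simp add: a_assoc homogeneous_carrier graded_carrier)
qed (simp add: graded_carrier)

lemma graded_smult: "x \<in> graded n \<Longrightarrow> c \<odot> x \<in> graded n"
proof (induction rule: graded.induct)
  case (add x k z)
  then show ?case
    by (simp add: smult_r_distr homogeneous_carrier graded_carrier graded.add[OF homogeneous_smult])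
qed (simp add: graded.zero)

lemma graded_adj: "x \<in> graded n \<Longrightarrow> adj A x \<in> graded n"
proof (induction rule: graded.induct)
  case (add x k z)
  then show ?case
    by (simp add: adj_add homogeneous_carrier graded_carrier graded.add[OF homogeneous_adj])
qed (simp add: graded.zero)

lemma graded_mult: "x \<in> graded m \<Longrightarrow> y \<in> graded n \<Longrightarrow> x \<otimes> y \<in> graded (m + n)"
proof (induction rule: graded.induct)
  case (add x k z)
  have "x \<otimes> y \<in> graded (m + n)" using add.prems
  proof (induction rule: graded.induct)
    case (add w l v)
    then show ?case using \<open>x \<in> homogeneous k\<close> \<open>\<bar>k\<bar> \<le> int m\<close>
      by (simp add: mult_r_distr homogeneous_carrier graded_carrier graded.add[OF homogeneous_mult])
  qed (use add in \<open>simp add: graded.zero homogeneous_carrier\<close>)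
  then show ?case using add by (simp add: mult_l_distr homogeneous_carrier graded_carrier graded_add)
qed (simp add: graded.zero graded_carrier)

lemma graded_components:
  "x \<in> graded n \<Longrightarrow> \<exists>b. (\<forall>k. b k \<in> homogeneous k) \<and> x = finsum A b {- int n..int n}"
proof (induction rule: graded.induct)
  case zero
  show ?case using homogeneous_zero by (intro exI[of _ "\<lambda>_. \<zero>"]) (simp add: finsum_zero)
next
  case (add x k y)
  then obtain b where b: "\<And>k. b k \<in> homogeneous k" "y = finsum A b {- int n..int n}" by blast
  define d where "d l = (if l = k then x else \<zero>)" for l
  have d: "d l \<in> homogeneous l" for l using add homogeneous_zero by (simp add: d_def)
  have c: "b \<in> X \<rightarrow> carrier A" "d \<in> X \<rightarrow> carrier A" for X using b d homogeneous_carrier by blast+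
  have "finsum A d {- int n..int n} = x"
    using add homogeneous_carrier by (intro finsum_delta[of _ k]) (auto simp: d_def)
  then have "x \<oplus> y = finsum A (\<lambda>l. d l \<oplus> b l) {- int n..int n}"
    using c b(2) by (subst finsum_addf) auto
  then show ?case using b d homogeneous_add by (intro exI[of _ "\<lambda>l. d l \<oplus> b l"]) auto
qed

end

section \<open>Injectivity\<close>

text \<open>The closure \<open>L\<close> of a subalgebra closed under adjoints is a C*-subalgebra,
  so it contains the one generated by \<open>X\<close>.\<close>

lemma (in cstar_algebra) cstar_generated_dense:
  assumes D: "D \<subseteq> carrier A" "\<zero> \<in> D" "\<And>x y. x \<in> D \<Longrightarrow> y \<in> D \<Longrightarrow> x \<oplus> y \<in> D"
    "\<And>x y. x \<in> D \<Longrightarrow> y \<in> D \<Longrightarrow> x \<otimes> y \<in> D" "\<And>x. x \<in> D \<Longrightarrow> adj A x \<in> D" "\<And>x c. x \<in> D \<Longrightarrow> c \<odot> x \<in> D"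
    and X: "X \<subseteq> D" and x: "x \<in> cstar_generated A X" and e: "e > 0"
  shows "\<exists>d\<in>D. cnorm A (x \<ominus> d) < e"
proof -
  define L where "L = {x \<in> carrier A. \<forall>e>0. \<exists>d\<in>D. cnorm A (x \<ominus> d) < e}"
  have LI: "x \<in> L" if "x \<in> carrier A" "\<And>e. e > 0 \<Longrightarrow> \<exists>d\<in>D. cnorm A (x \<ominus> d) < e" for x
    using that by (simp add: L_def)
  have LE: "\<exists>d. d \<in> D \<and> d \<in> carrier A \<and> cnorm A (x \<ominus> d) < e" if "x \<in> L" "e > 0" for x e
    using that D(1) unfolding L_def by blast
  have Lc: "x \<in> carrier A" if "x \<in> L" for x using that by (simp add: L_def)
  have DL: "D \<subseteq> L"
  proof
    fix d assume d: "d \<in> D"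
    then have "d \<in> carrier A" using D(1) by blast
    then show "d \<in> L" using d by (intro LI bexI[of _ d]) (simp_all add: minus_eq r_neg)
  qed
  have "cstar_subalgebra A L"
    unfolding cstar_subalgebra_def
  proof (intro conjI ballI allI impI)
    show "L \<subseteq> carrier A" using Lc by blast
    show "\<zero> \<in> L" using D(2) DL by blast
  next
    fix x y assume x: "x \<in> L" and y: "y \<in> L"
    note c = Lc[OF x] Lc[OF y]
    show "x \<oplus> y \<in> L"
    proof (rule LI)
      fix e :: real assume e: "e > 0"
      obtain d where d: "d \<in> D" "d \<in> carrier A" "cnorm A (x \<ominus> d) < e / 2" using LE[OF x half_gt_zero[OF e]] by blast
      obtain d' where d': "d' \<in> D" "d' \<in> carrier A" "cnorm A (y \<ominus> d') < e / 2" using LE[OF y half_gt_zero[OF e]] by blast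
      have "(x \<oplus> y) \<ominus> (d \<oplus> d') = (x \<ominus> d) \<oplus> (y \<ominus> d')" using c d d' by (simp add: distribs group_simps)
      moreover have "cnorm A ((x \<ominus> d) \<oplus> (y \<ominus> d')) < e"
        using cnorm_triangle[of "x \<ominus> d" "y \<ominus> d'"] c d d' by simp
      ultimately show "\<exists>d\<in>D. cnorm A ((x \<oplus> y) \<ominus> d) < e" using D(3)[OF d(1) d'(1)] by (intro bexI[of _ "d \<oplus> d'"]) simp_all
    qed (use c in simp)
    show "x \<otimes> y \<in> L"
    proof (rule LI)
      fix e :: real assume e: "e > 0"
      \<comment> \<open>With both approximations within \<open>r \<le> 1\<close>, the error of the
        product is at most \<open>r\<close> times the sum of the norms plus 1; the 2 in
        \<open>S\<close> makes this strictly less than \<open>r * S \<le> e\<close>.\<close>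
      define S where "S = cnorm A x + cnorm A y + 2"
      have S: "S \<ge> 2" using c by (simp add: S_def cnorm_nonneg)
      define r where "r = min 1 (e / S)"
      have r: "r > 0" "r \<le> 1" "r * S \<le> e" using e S by (auto simp: r_def min_def field_simps)
      obtain d where d: "d \<in> D" "d \<in> carrier A" "cnorm A (x \<ominus> d) < r" using LE[OF x r(1)] by blast
      obtain d' where d': "d' \<in> D" "d' \<in> carrier A" "cnorm A (y \<ominus> d') < r" using LE[OF y r(1)] by blast
      have "d = x \<ominus> (x \<ominus> d)" using c d by (simp add: distribs group_simps)
      then have nd: "cnorm A d \<le> cnorm A x + 1" using cnorm_diff[of x "x \<ominus> d"] c d r by simp
      have "x \<otimes> y \<ominus> d \<otimes> d' = (x \<ominus> d) \<otimes> y \<oplus> d \<otimes> (y \<ominus> d')" using c d d' by (simp add: distribs group_simps)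
      then have "cnorm A (x \<otimes> y \<ominus> d \<otimes> d') \<le> cnorm A ((x \<ominus> d) \<otimes> y) + cnorm A (d \<otimes> (y \<ominus> d'))"
        using c d d' by (simp add: cnorm_triangle)
      also have "\<dots> \<le> cnorm A (x \<ominus> d) * cnorm A y + cnorm A d * cnorm A (y \<ominus> d')"
        using c d d' by (intro add_mono cnorm_mult) auto
      also have "\<dots> \<le> r * cnorm A y + (cnorm A x + 1) * r"
        using c d d' nd r by (intro add_mono mult_mono) (auto simp: cnorm_nonneg add_nonneg_nonneg)
      also have "\<dots> < r * S" using r by (simp add: S_def algebra_simps)
      finally have "cnorm A (x \<otimes> y \<ominus> d \<otimes> d') < e" using r by simp
      then show "\<exists>d\<in>D. cnorm A (x \<otimes> y \<ominus> d) < e" using D(4)[OF d(1) d'(1)] by blast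
    qed (use c in simp)
  next
    fix x assume x: "x \<in> L"
    note c = Lc[OF x]
    show "adj A x \<in> L"
    proof (rule LI)
      fix e :: real assume e: "e > 0"
      obtain d where d: "d \<in> D" "d \<in> carrier A" "cnorm A (x \<ominus> d) < e" using LE[OF x e] by blast
      have "adj A x \<ominus> adj A d = adj A (x \<ominus> d)" using c d by (simp add: distribs)
      then have "cnorm A (adj A x \<ominus> adj A d) < e" using c d by simp
      then show "\<exists>d\<in>D. cnorm A (adj A x \<ominus> d) < e" using D(5)[OF d(1)] by blast
    qed (use c in simp)
    fix t
    show "t \<odot> x \<in> L"
    proof (rule LI)
      fix e :: real assume e: "e > 0"
      have t: "cmod t + 1 > 0" by (simp add: add_nonneg_pos)
      obtain d where d: "d \<in> D" "d \<in> carrier A" "cnorm A (x \<ominus> d) < e / (cmod t + 1)"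
        using LE[OF x divide_pos_pos[OF e t]] by blast
      have "t \<odot> x \<ominus> t \<odot> d = t \<odot> (x \<ominus> d)" using c d by (simp add: distribs)
      then have "cnorm A (t \<odot> x \<ominus> t \<odot> d) \<le> (cmod t + 1) * cnorm A (x \<ominus> d)"
        using c d by (simp add: cnorm_smult distrib_right cnorm_nonneg)
      also have "\<dots> < e" using d(3) t by (simp add: pos_less_divide_eq mult.commute)
      finally show "\<exists>d\<in>D. cnorm A (t \<odot> x \<ominus> d) < e" using D(6)[OF d(1)] by blast
    qed (use c in simp)
  next
    fix Y l assume Y: "\<forall>n. Y n \<in> L" and l: "l \<in> carrier A" and lim: "(\<lambda>n. cnorm A (Y n \<ominus> l)) \<longlonglongrightarrow> 0"
    show "l \<in> L"
    proof (rule LI[OF l])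
      fix e :: real assume e: "e > 0"
      obtain N where N: "\<forall>n\<ge>N. norm (cnorm A (Y n \<ominus> l) - 0) < e / 2" using LIMSEQ_D[OF lim half_gt_zero[OF e]] by blast
      have YN: "Y N \<in> L" using Y by simp
      obtain d where d: "d \<in> D" "d \<in> carrier A" "cnorm A (Y N \<ominus> d) < e / 2" using LE[OF YN half_gt_zero[OF e]] by blast
      have "cnorm A (l \<ominus> d) \<le> cnorm A (l \<ominus> Y N) + cnorm A (Y N \<ominus> d)"
        using l d Lc[OF YN] by (intro cnorm_diff_triangle)
      moreover have "cnorm A (l \<ominus> Y N) = cnorm A (Y N \<ominus> l)" using l Lc[OF YN] by (intro cnorm_diff_commute)
      moreover have "cnorm A (Y N \<ominus> l) < e / 2" using N by (auto dest: abs_le_D1)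
      ultimately have "cnorm A (l \<ominus> d) < e" using d(3) by linarith
      then show "\<exists>d\<in>D. cnorm A (l \<ominus> d) < e" using d(1) by blast
    qed
  qed
  then have "x \<in> L" using x X DL unfolding cstar_generated_def by blast
  then show ?thesis using LE[OF _ e] by blast
qed

text \<open>The hypotheses in terms of edges only: \<open>s_nonzero\<close> stands for the
  non-vanishing of the vertex projections, and equivariance becomes scaling of the images of
  edges.\<close>

locale gauge_invariant_hom = cstar_hom A B \<phi> + F: edge_family A E T s
  for A :: "('a, 'm) cstar_scheme" (structure) and B :: "('b, 'n) cstar_scheme" and \<phi> :: "'a \<Rightarrow> 'b"
    and E :: "'e set" and T :: "'e \<Rightarrow> 'e \<Rightarrow> bool" and s :: "'e \<Rightarrow> 'a" +
  fixes \<beta> :: "complex \<Rightarrow> 'b \<Rightarrow> 'b"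
  assumes s_nonzero: "e \<in> E \<Longrightarrow> \<phi> (s e) \<noteq> \<zero>\<^bsub>B\<^esub>"
    and \<beta>_hom: "z \<in> circle \<Longrightarrow> \<beta> z \<in> star_hom B B"
    and \<beta>_s: "z \<in> circle \<Longrightarrow> e \<in> E \<Longrightarrow> \<beta> z (\<phi> (s e)) = z \<odot>\<^bsub>B\<^esub> \<phi> (s e)"
    and generated: "cstar_generated A (s ` E) = carrier A"
begin

section \<open>Lower bounds on the stages of the core\<close>

lemma \<beta>_cstar_hom: "z \<in> circle \<Longrightarrow> cstar_hom B B (\<beta> z)"
  by (intro cstar_hom.intro cstar_hom_axioms.intro B.cstar_algebra_axioms \<beta>_hom)

lemma cnorm_s: "e \<in> E \<Longrightarrow> cnorm A (s e) \<le> 1"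
  using F.s_isometry[of e]
  by (intro A.cnorm_partial_isometry_le_1) (simp add: cstar_partial_isometry_def A.mult_assoc)

text \<open>The image of \<open>p e\<close> is a non-zero projection, hence of norm 1, so each
  diagonal entry \<open>c\<close> of \<open>x\<close> has modulus at most the norm of
  \<open>\<phi> x\<close>. Summation over the edges gives \<open>card E\<close>.\<close>

lemma diag_bounded_below:
  assumes x: "x \<in> F.diag"
  shows "cnorm A x \<le> real (card E) * cnorm B (\<phi> x)"
proof -
  have xc: "x \<in> carrier A" "F.u \<otimes> x = x" using x F.corner_closed F.u_corner by (auto simp: F.diag_def)
  have "x = finsum A F.p E \<otimes> x" using xc by (simp flip: F.u_def)
  also have "\<dots> = (\<Oplus>e\<in>E. F.p e \<otimes> x)" using xc F.finite_E by (intro A.finsum_mult) auto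
  also have "cnorm A \<dots> \<le> (\<Sum>e\<in>E. cnorm A (F.p e \<otimes> x))" using xc F.finite_E by (intro A.cnorm_finsum) auto
  also have "\<dots> \<le> (\<Sum>e\<in>E. cnorm B (\<phi> x))"
  proof (rule sum_mono)
    fix e assume e: "e \<in> E"
    obtain c where c: "F.p e \<otimes> x = c \<odot> F.p e" using x e by (auto simp: F.diag_def)
    have pe: "F.p e \<in> carrier A" "adj A (F.p e) = F.p e" "F.p e \<otimes> F.p e = F.p e"
      using e by (simp_all add: F.p_adj F.p_p)
    define P where "P = \<phi> (F.p e)"
    have P: "P \<in> carrier B" "adj B P = P" "P \<otimes>\<^bsub>B\<^esub> P = P"
      using pe by (simp_all add: P_def flip: adj mult)
    have "P \<noteq> \<zero>\<^bsub>B\<^esub>"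
    proof
      assume "P = \<zero>\<^bsub>B\<^esub>"
      then have "\<phi> (s e) \<otimes>\<^bsub>B\<^esub> adj B (\<phi> (s e)) = \<zero>\<^bsub>B\<^esub>" using e by (simp add: P_def F.p_def mult adj)
      then have "(cnorm B (\<phi> (s e)))\<^sup>2 = 0" using B.cnorm_self_mult[of "\<phi> (s e)"] e by simp
      then show False using s_nonzero[OF e] e by (simp add: B.cnorm_eq_0)
    qed
    then have "cnorm B P \<noteq> 0" "(cnorm B P)\<^sup>2 = cnorm B P"
      using P B.cstar_identity[of P] by (simp_all add: B.cnorm_eq_0)
    then have P1: "cnorm B P = 1" by (simp add: power2_eq_square)
    have "cnorm A (F.p e \<otimes> x) \<le> cmod c"
      using pe A.cnorm_projection_le_1[of "F.p e"]
      by (simp add: c A.cnorm_smult cstar_projection_def mult_left_le)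
    also have "cmod c = cnorm B (P \<otimes>\<^bsub>B\<^esub> \<phi> x)"
      using pe xc P P1 by (simp add: P_def c smult B.cnorm_smult flip: mult)
    also have "\<dots> \<le> cnorm B P * cnorm B (\<phi> x)" using P xc by (intro B.cnorm_mult) auto
    finally show "cnorm A (F.p e \<otimes> x) \<le> cnorm B (\<phi> x)" using P1 by simp
  qed
  finally show ?thesis by simp
qed

lemma finsum_bounded_below:
  assumes "\<And>e. e \<in> E \<Longrightarrow> g e \<in> carrier A" "C \<ge> 0"
    "\<And>e. e \<in> E \<Longrightarrow> cnorm A (g e) \<le> C * cnorm B (\<phi> x)" "x = finsum A g E"
  shows "cnorm A x \<le> (real (card E) * C) * cnorm B (\<phi> x)"
proof -
  have "cnorm A x \<le> (\<Sum>e\<in>E. cnorm A (g e))"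
    unfolding assms(4) using assms(1) F.finite_E by (intro A.cnorm_finsum) auto
  also have "\<dots> \<le> (\<Sum>e\<in>E. C * cnorm B (\<phi> x))" using assms(3) by (rule sum_mono)
  finally show ?thesis by simp
qed

lemma cnorm_mult_contraction:
  assumes "a \<in> carrier A" "b \<in> carrier A" "cnorm A a \<le> 1"
  shows "cnorm A (a \<otimes> b) \<le> cnorm A b" "cnorm B (\<phi> (a \<otimes> b)) \<le> cnorm B (\<phi> b)"
proof -
  have B1: "cnorm B (\<phi> a) \<le> 1" using contractive[OF assms(1)] assms(3) by simp
  have le: "x * y \<le> y" if "x \<le> 1" "0 \<le> y" for x y :: real
    using that mult_right_mono[of x 1 y] by simp
  show "cnorm A (a \<otimes> b) \<le> cnorm A b"
    using A.cnorm_mult[OF assms(1,2)] le[OF assms(3) A.cnorm_nonneg[OF assms(2)]] by linarith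
  show "cnorm B (\<phi> (a \<otimes> b)) \<le> cnorm B (\<phi> b)"
    using B.cnorm_mult[of "\<phi> a" "\<phi> b"] le[OF B1 B.cnorm_nonneg[of "\<phi> b"]] assms by (simp add: mult)
qed

text \<open>Reassembling \<open>x\<close> from its compressions costs a factor \<open>card E\<close>
  per left edge. The right index is a parameter, so the step serves both ends.\<close>

lemma K_bounded_below_step:
  assumes "\<exists>C\<ge>0. \<forall>x\<in>F.K 0 n. cnorm A x \<le> C * cnorm B (\<phi> x)"
  shows "\<exists>C\<ge>0. \<forall>x\<in>F.K m n. cnorm A x \<le> C * cnorm B (\<phi> x)"
proof (induction m)
  case (Suc m)
  then obtain C where C: "C \<ge> 0" "\<And>x. x \<in> F.K m n \<Longrightarrow> cnorm A x \<le> C * cnorm B (\<phi> x)" by blast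
  have "cnorm A x \<le> (real (card E) * C) * cnorm B (\<phi> x)" if x: "x \<in> F.K (Suc m) n" for x
  proof (rule finsum_bounded_below[OF _ C(1)])
    have xc: "x \<in> F.corner" "x \<in> carrier A" using x F.corner_closed by auto
    show "x = (\<Oplus>e\<in>E. s e \<otimes> (adj A (s e) \<otimes> x))" using xc(1) by (rule F.left_decomposition)
    fix e assume e: "e \<in> E"
    show "s e \<otimes> (adj A (s e) \<otimes> x) \<in> carrier A" using xc e by simp
    have "cnorm A (s e \<otimes> (adj A (s e) \<otimes> x)) \<le> cnorm A (adj A (s e) \<otimes> x)"
      using xc e cnorm_s by (intro cnorm_mult_contraction(1)) auto
    also have "\<dots> \<le> C * cnorm B (\<phi> (adj A (s e) \<otimes> x))" using x e by (intro C(2)) simp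
    also have "\<dots> \<le> C * cnorm B (\<phi> x)"
      using xc e cnorm_s C(1) by (intro mult_left_mono cnorm_mult_contraction(2)) auto
    finally show "cnorm A (s e \<otimes> (adj A (s e) \<otimes> x)) \<le> C * cnorm B (\<phi> x)" .
  qed
  then show ?case using C(1) by (intro exI[of _ "real (card E) * C"]) simp
qed (rule assms)

text \<open>The step leads from \<open>K 0 0\<close> to \<open>K n 0\<close>, adjoints lead to
  \<open>K 0 n\<close>, and the step again leads to \<open>K m n\<close>.\<close>

lemma K_bounded_below: "\<exists>C\<ge>0. \<forall>x\<in>F.K m n. cnorm A x \<le> C * cnorm B (\<phi> x)"
proof (rule K_bounded_below_step)
  have "\<exists>C\<ge>0. \<forall>x\<in>F.K 0 0. cnorm A x \<le> C * cnorm B (\<phi> x)"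
    using diag_bounded_below by (intro exI[of _ "real (card E)"]) simp
  then obtain C where C: "C \<ge> 0" "\<And>x. x \<in> F.K n 0 \<Longrightarrow> cnorm A x \<le> C * cnorm B (\<phi> x)"
    using K_bounded_below_step by blast
  have "cnorm A x \<le> C * cnorm B (\<phi> x)" if "x \<in> F.K 0 n" for x
    using C(2)[OF F.K_adj[OF that]] F.K_carrier[OF that] by (simp add: adj)
  then show "\<exists>C\<ge>0. \<forall>x\<in>F.K 0 n. cnorm A x \<le> C * cnorm B (\<phi> x)" using C(1) by blast
qed

text \<open>Although \<open>x\<close> may have any degree, x* x and its powers lie in the single
  stage \<open>K n n\<close>, so one constant serves all powers.\<close>

lemma homogeneous_isometric:
  assumes "x \<in> F.homogeneous k" shows "cnorm B (\<phi> x) = cnorm A x"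
proof -
  obtain m n where x: "x \<in> F.K m n" using assms by (auto simp: F.homogeneous_def)
  obtain C where C: "C \<ge> 0" "\<And>x. x \<in> F.K n n \<Longrightarrow> cnorm A x \<le> C * cnorm B (\<phi> x)" using K_bounded_below by blast
  have it: "A.sqiter (adj A x \<otimes> x) j \<in> F.K n n" for j
    by (induction j) (auto intro: F.K_mult F.K_adj x)
  show ?thesis
  proof (rule isometric_if_polynomially_bounded_below[OF F.K_carrier[OF x]])
    fix j
    let ?y = "A.sqiter (adj A x \<otimes> x) j"
    have "cnorm A ?y \<le> C * 1 * cnorm B (\<phi> ?y)" using C(2)[OF it] by simp
    also have "\<dots> \<le> C * 2 ^ j * cnorm B (\<phi> ?y)"
      using C(1) F.K_carrier[OF it[of j]] by (intro mult_right_mono mult_left_mono B.cnorm_nonneg) auto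
    finally show "cnorm A ?y \<le> C * 2 ^ j * cnorm B (\<phi> ?y)" .
  qed
qed

section \<open>The circle action on homogeneous elements\<close>

lemma \<beta>_finsum:
  assumes z: "z \<in> circle" and g: "\<And>e. e \<in> E \<Longrightarrow> g e \<in> carrier A"
    and \<beta>g: "\<And>e. e \<in> E \<Longrightarrow> \<beta> z (\<phi> (g e)) = c \<odot>\<^bsub>B\<^esub> \<phi> (g e)" and x: "x = finsum A g E"
  shows "\<beta> z (\<phi> x) = c \<odot>\<^bsub>B\<^esub> \<phi> x"
proof -
  interpret b: cstar_hom B B "\<beta> z" using z by (rule \<beta>_cstar_hom)
  have dec: "\<phi> x = (\<Oplus>\<^bsub>B\<^esub>e\<in>E. \<phi> (g e))" unfolding x using g F.finite_E by (intro finsum) auto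
  have "\<beta> z (\<phi> x) = (\<Oplus>\<^bsub>B\<^esub>e\<in>E. \<beta> z (\<phi> (g e)))" unfolding dec using g F.finite_E by (intro b.finsum) auto
  also have "\<dots> = (\<Oplus>\<^bsub>B\<^esub>e\<in>E. c \<odot>\<^bsub>B\<^esub> \<phi> (g e))" using g \<beta>g by (intro B.finsum_cong') auto
  also have "\<dots> = c \<odot>\<^bsub>B\<^esub> \<phi> x" unfolding dec using g F.finite_E by (intro B.smult_finsum[symmetric]) auto
  finally show ?thesis .
qed

lemma \<beta>_diag:
  assumes z: "z \<in> circle" and x: "x \<in> F.diag" shows "\<beta> z (\<phi> x) = 1 \<odot>\<^bsub>B\<^esub> \<phi> x"
proof (rule \<beta>_finsum[OF z])
  interpret b: cstar_hom B B "\<beta> z" using z by (rule \<beta>_cstar_hom)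
  have zz: "z * cnj z = 1" using z by (simp add: circle_def complex_norm_square [symmetric])
  have \<beta>p: "\<beta> z (\<phi> (F.p e)) = \<phi> (F.p e)" if "e \<in> E" for e
  proof -
    have "\<beta> z (\<phi> (F.p e)) = (z \<odot>\<^bsub>B\<^esub> \<phi> (s e)) \<otimes>\<^bsub>B\<^esub> adj B (z \<odot>\<^bsub>B\<^esub> \<phi> (s e))"
      using that z by (simp add: F.p_def mult adj b.mult b.adj \<beta>_s)
    also have "\<dots> = (z * cnj z) \<odot>\<^bsub>B\<^esub> (\<phi> (s e) \<otimes>\<^bsub>B\<^esub> adj B (\<phi> (s e)))"
      using that by (simp add: B.distribs mult.commute)
    finally show ?thesis using that by (simp add: zz B.smult_one F.p_def mult adj)
  qed
  have xc: "x \<in> carrier A" "F.u \<otimes> x = x" using x F.corner_closed F.u_corner by (auto simp: F.diag_def)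
  have "x = finsum A F.p E \<otimes> x" using xc by (simp flip: F.u_def)
  also have "\<dots> = (\<Oplus>e\<in>E. F.p e \<otimes> x)" using xc F.finite_E by (intro A.finsum_mult) auto
  finally show "x = (\<Oplus>e\<in>E. F.p e \<otimes> x)" .
  fix e assume e: "e \<in> E"
  show "F.p e \<otimes> x \<in> carrier A" using e xc by simp
  obtain c where "F.p e \<otimes> x = c \<odot> F.p e" using x e by (auto simp: F.diag_def)
  then show "\<beta> z (\<phi> (F.p e \<otimes> x)) = 1 \<odot>\<^bsub>B\<^esub> \<phi> (F.p e \<otimes> x)"
    using e by (simp add: smult b.smult \<beta>p B.smult_one)
qed

text \<open>The factor \<open>c\<close> is left open for two uses: 1 on the diagonal, and then,
  after taking adjoints, \<open>cnj z ^ n\<close> on \<open>K 0 n\<close>.\<close>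

lemma \<beta>_K_step:
  assumes z: "z \<in> circle" and base: "\<And>x. x \<in> F.K 0 n \<Longrightarrow> \<beta> z (\<phi> x) = c \<odot>\<^bsub>B\<^esub> \<phi> x"
  shows "x \<in> F.K m n \<Longrightarrow> \<beta> z (\<phi> x) = (z ^ m * c) \<odot>\<^bsub>B\<^esub> \<phi> x"
proof (induction m arbitrary: x)
  case 0
  then show ?case using base by simp
next
  case (Suc m)
  interpret b: cstar_hom B B "\<beta> z" using z by (rule \<beta>_cstar_hom)
  have xc: "x \<in> F.corner" "x \<in> carrier A" using Suc.prems F.corner_closed by auto
  show ?case
  proof (rule \<beta>_finsum[OF z _ _ F.left_decomposition[OF xc(1)]])
    fix e assume e: "e \<in> E"
    show "s e \<otimes> (adj A (s e) \<otimes> x) \<in> carrier A" using e xc by simp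
    show "\<beta> z (\<phi> (s e \<otimes> (adj A (s e) \<otimes> x))) = (z ^ Suc m * c) \<odot>\<^bsub>B\<^esub> \<phi> (s e \<otimes> (adj A (s e) \<otimes> x))"
      using Suc.IH[of "adj A (s e) \<otimes> x"] Suc.prems xc e z
      by (simp add: mult [of "s e"] b.mult \<beta>_s B.distribs mult_ac)
  qed
qed

lemma \<beta>_K:
  assumes z: "z \<in> circle" and x: "x \<in> F.K m n"
  shows "\<beta> z (\<phi> x) = (z ^ m * cnj z ^ n) \<odot>\<^bsub>B\<^esub> \<phi> x"
proof (rule \<beta>_K_step[OF z _ x])
  interpret b: cstar_hom B B "\<beta> z" using z by (rule \<beta>_cstar_hom)
  fix y assume y: "y \<in> F.K 0 n"
  have yc: "y \<in> carrier A" by (rule F.K_carrier[OF y])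
  have "\<beta> z (\<phi> (adj A y)) = (z ^ n * 1) \<odot>\<^bsub>B\<^esub> \<phi> (adj A y)"
    using \<beta>_diag[OF z] by (intro \<beta>_K_step[OF z _ F.K_adj[OF y]]) simp
  then have "adj B (\<beta> z (\<phi> (adj A y))) = adj B (z ^ n \<odot>\<^bsub>B\<^esub> \<phi> (adj A y))" by simp
  then show "\<beta> z (\<phi> y) = cnj z ^ n \<odot>\<^bsub>B\<^esub> \<phi> y"
    using yc by (simp add: adj b.adj B.adj_smult B.adj_adj)
qed

lemma \<beta>_homogeneous:
  assumes z: "z \<in> circle" and x: "x \<in> F.homogeneous k"
  shows "\<beta> z (\<phi> x) = (z powi k) \<odot>\<^bsub>B\<^esub> \<phi> x"
proof -
  obtain m n where x: "x \<in> F.K m n" and k: "k = int m - int n" using x by (auto simp: F.homogeneous_def)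
  have z0: "z \<noteq> 0" using z by (auto simp: circle_def)
  have "z * cnj z = 1" using z by (simp add: circle_def complex_norm_square [symmetric])
  then have "cnj z = inverse z" using z0 by (simp add: field_simps)
  then have "z ^ m * cnj z ^ n = z powi k"
    using z0 by (simp add: k power_int_diff divide_inverse power_inverse)
  then show ?thesis using \<beta>_K[OF z x] by simp
qed

text \<open>Averaging \<open>w^(-j k) \<beta> (w^j)\<close> over the roots of unity \<open>w^j\<close> of order \<open>2 n + 1\<close> isolates the
  component of degree \<open>k\<close>.\<close>

lemma component_contractive:
  assumes b: "\<And>l. b l \<in> F.homogeneous l" and x: "x = finsum A b {- int n..int n}" and k: "\<bar>k\<bar> \<le> int n"
  shows "cnorm B (\<phi> (b k)) \<le> cnorm B (\<phi> x)"
proof -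
  \<comment> \<open>Degrees between \<open>- n\<close> and \<open>n\<close> differ by at most
    \<open>2 n\<close>, so they are distinguished modulo \<open>2 n + 1\<close>.\<close>
  define M where "M = 2 * n + 1"
  have M: "M > 0" by (simp add: M_def)
  define w where "w = cis (2 * pi / real M)"
  have wc: "w ^ j \<in> circle" for j by (simp add: w_def circle_def norm_power)
  have w0: "w \<noteq> 0" and w1: "cmod w = 1" by (simp_all add: w_def)
  have wM: "w ^ M = 1" using M by (simp add: w_def DeMoivre)
  \<comment> \<open>A natural number congruent to \<open>- k\<close> modulo \<open>M\<close>; it is
    nonnegative because \<open>\<bar>k\<bar> \<le> n < M\<close>.\<close>
  define q where "q = nat (int M - k)"
  define avg where "avg y = (\<Oplus>\<^bsub>B\<^esub>j\<in>{..<M}. (w ^ (j * q) / of_nat M) \<odot>\<^bsub>B\<^esub> \<beta> (w ^ j) y)" for y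
  have \<beta>c [simp]: "\<beta> (w ^ j) y \<in> carrier B" if "y \<in> carrier B" for j y
    using cstar_hom.closed[OF \<beta>_cstar_hom[OF wc] that] .
  have avgc: "avg y \<in> carrier B" if "y \<in> carrier B" for y
    unfolding avg_def using that by (intro B.finsum_closed) auto
  have avg_norm: "cnorm B (avg y) \<le> cnorm B y" if y: "y \<in> carrier B" for y
  proof -
    have "cnorm B (avg y) \<le> (\<Sum>j<M. cnorm B ((w ^ (j * q) / of_nat M) \<odot>\<^bsub>B\<^esub> \<beta> (w ^ j) y))"
      unfolding avg_def using y by (intro B.cnorm_finsum) auto
    also have "\<dots> \<le> (\<Sum>j<M. 1 / real M * cnorm B y)"
    proof (rule sum_mono)
      fix j
      have "cnorm B ((w ^ (j * q) / of_nat M) \<odot>\<^bsub>B\<^esub> \<beta> (w ^ j) y) = 1 / real M * cnorm B (\<beta> (w ^ j) y)"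
        using y by (simp add: B.cnorm_smult norm_divide norm_power w1)
      also have "\<dots> \<le> 1 / real M * cnorm B y"
        using y by (intro mult_left_mono cstar_hom.contractive[OF \<beta>_cstar_hom[OF wc]]) auto
      finally show "cnorm B ((w ^ (j * q) / of_nat M) \<odot>\<^bsub>B\<^esub> \<beta> (w ^ j) y) \<le> 1 / real M * cnorm B y" .
    qed
    also have "\<dots> = cnorm B y" using M by simp
    finally show ?thesis .
  qed
  have avg_add: "avg (y \<oplus>\<^bsub>B\<^esub> y') = avg y \<oplus>\<^bsub>B\<^esub> avg y'" if y: "y \<in> carrier B" "y' \<in> carrier B" for y y'
  proof -
    have "avg (y \<oplus>\<^bsub>B\<^esub> y') = (\<Oplus>\<^bsub>B\<^esub>j\<in>{..<M}. (w ^ (j * q) / of_nat M) \<odot>\<^bsub>B\<^esub> \<beta> (w ^ j) y \<oplus>\<^bsub>B\<^esub>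
        (w ^ (j * q) / of_nat M) \<odot>\<^bsub>B\<^esub> \<beta> (w ^ j) y')"
      unfolding avg_def using y
      by (intro B.finsum_cong') (auto simp: cstar_hom.add[OF \<beta>_cstar_hom[OF wc]] B.smult_r_distr)
    also have "\<dots> = avg y \<oplus>\<^bsub>B\<^esub> avg y'" unfolding avg_def using y by (intro B.finsum_addf) auto
    finally show ?thesis .
  qed
  have avg_b: "avg (\<phi> (b l)) = (if l = k then \<phi> (b l) else \<zero>\<^bsub>B\<^esub>)" if l: "\<bar>l\<bar> \<le> int n" for l
  proof -
    have bc: "\<phi> (b l) \<in> carrier B" using F.homogeneous_carrier[OF b] by simp
    define r where "r = nat (l + int M)"
    have r: "int r = l + int M" using l by (simp add: r_def M_def)
    have q: "int q = int M - k" using k by (simp add: q_def M_def)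
    have wr: "(w ^ j) powi l = w ^ (j * r)" for j
    proof -
      have "(w ^ j) powi (l + int M) = (w ^ j) powi l * (w ^ j) ^ M" using w0 by (simp add: power_int_add)
      also have "(w ^ j) ^ M = (w ^ M) ^ j" by (simp add: mult.commute flip: power_mult)
      also have "\<dots> = 1" by (simp add: wM)
      finally have "(w ^ j) powi l = (w ^ j) powi int r" by (simp add: r)
      then show ?thesis by (simp add: power_mult)
    qed
    have "avg (\<phi> (b l)) = (\<Oplus>\<^bsub>B\<^esub>j\<in>{..<M}. ((w ^ (q + r)) ^ j / of_nat M) \<odot>\<^bsub>B\<^esub> \<phi> (b l))"
      unfolding avg_def
    proof (rule B.finsum_cong')
      fix j assume "j \<in> {..<M}"
      have e: "w ^ (j * q) / of_nat M * ((w ^ j) powi l) = (w ^ (q + r)) ^ j / of_nat M"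
        by (simp add: wr power_mult [symmetric] power_add [symmetric] algebra_simps)
      show "(w ^ (j * q) / of_nat M) \<odot>\<^bsub>B\<^esub> \<beta> (w ^ j) (\<phi> (b l)) = ((w ^ (q + r)) ^ j / of_nat M) \<odot>\<^bsub>B\<^esub> \<phi> (b l)"
        by (simp only: \<beta>_homogeneous[OF wc b] B.smult_assoc[OF bc, symmetric] e)
    qed (use bc in auto)
    also have "\<dots> = (\<Sum>j<M. (w ^ (q + r)) ^ j / of_nat M) \<odot>\<^bsub>B\<^esub> \<phi> (b l)" using bc by (intro B.finsum_smult) auto
    also have "(\<Sum>j<M. (w ^ (q + r)) ^ j / of_nat M) = (if l = k then 1 else 0)"
    proof -
      have "int (q + r) = (l - k) + 2 * int M" using q r by simp
      then have "M dvd q + r \<longleftrightarrow> int M dvd (l - k) + 2 * int M" by (metis int_dvd_int_iff)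
      also have "\<dots> \<longleftrightarrow> int M dvd l - k" by (simp add: dvd_add_left_iff)
      also have "\<dots> \<longleftrightarrow> l = k"
      proof
        assume d: "int M dvd l - k"
        have "\<bar>l - k\<bar> < int M" using l k by (simp add: M_def)
        then show "l = k" using d zdvd_not_zless[of "l - k" "int M"] zdvd_not_zless[of "k - l" "int M"]
            dvd_diff_commute[of "int M" l k] by linarith
      qed simp
      finally have "M dvd q + r \<longleftrightarrow> l = k" .
      then show ?thesis
        using M sum_root_of_unity_powers[OF M, of "q + r"] by (simp add: w_def flip: sum_divide_distrib)
    qed
    finally show ?thesis using bc by (cases "l = k") (simp_all add: B.smult_one)
  qed
  have bc: "b l \<in> carrier A" for l using F.homogeneous_carrier[OF b] .
  have avg_sum: "avg (finsum B (\<lambda>l. \<phi> (b l)) L) = finsum B (\<lambda>l. avg (\<phi> (b l))) L" if "finite L" for L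
    using that
  proof (induction L rule: finite_induct)
    case empty
    have "avg \<zero>\<^bsub>B\<^esub> = \<zero>\<^bsub>B\<^esub>"
      unfolding avg_def by (intro B.finsum_eq_zero) (simp add: cstar_hom.zero[OF \<beta>_cstar_hom[OF wc]])
    then show ?case by (simp add: B.finsum_empty)
  next
    case (insert l L)
    then show ?case using bc by (simp add: B.finsum_insert avgc B.finsum_closed avg_add)
  qed
  have "avg (\<phi> x) = avg (finsum B (\<lambda>l. \<phi> (b l)) {- int n..int n})"
    unfolding x using bc by (simp add: finsum)
  also have "\<dots> = finsum B (\<lambda>l. avg (\<phi> (b l))) {- int n..int n}" by (rule avg_sum) simp
  also have "\<dots> = \<phi> (b k)"
    using k bc by (intro B.finsum_delta[of _ k]) (auto simp: avg_b)
  finally have "\<phi> (b k) = avg (\<phi> x)" by simp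
  then show ?thesis using avg_norm[of "\<phi> x"] x bc by (simp add: A.finsum_closed)
qed

text \<open>There are \<open>2 n + 1\<close> components; each has the same norm as its image, and
  the image is controlled by averaging.\<close>

lemma graded_bounded_below:
  assumes x: "x \<in> F.graded n"
  shows "cnorm A x \<le> real (2 * n + 1) * cnorm B (\<phi> x)"
proof -
  obtain b where b: "\<And>k. b k \<in> F.homogeneous k" and xb: "x = finsum A b {- int n..int n}"
    using F.graded_components[OF x] by blast
  have "cnorm A x \<le> (\<Sum>k = - int n..int n. cnorm A (b k))"
    unfolding xb using F.homogeneous_carrier[OF b] by (intro A.cnorm_finsum) auto
  also have "\<dots> \<le> (\<Sum>k = - int n..int n. cnorm B (\<phi> x))"
  proof (rule sum_mono)
    fix k assume "k \<in> {- int n..int n}"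
    then have "cnorm B (\<phi> (b k)) \<le> cnorm B (\<phi> x)" by (intro component_contractive[OF b xb]) auto
    then show "cnorm A (b k) \<le> cnorm B (\<phi> x)" using homogeneous_isometric[OF b] by simp
  qed
  also have "\<dots> = real (2 * n + 1) * cnorm B (\<phi> x)" by (simp add: nat_add_distrib)
  finally show ?thesis .
qed

text \<open>Degrees add up, so the power of x* x with exponent \<open>2 ^ j\<close> has degrees at
  most \<open>2 n * 2 ^ j\<close>. The constant then grows linearly in \<open>2 ^ j\<close>, which
  the power trick tolerates.\<close>

lemma graded_isometric:
  assumes x: "x \<in> F.graded n"
  shows "cnorm B (\<phi> x) = cnorm A x"
proof (rule isometric_if_polynomially_bounded_below[OF F.graded_carrier[OF x]])
  fix j
  let ?y = "A.sqiter (adj A x \<otimes> x) j"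
  have y: "?y \<in> F.graded ((2 * n) * 2 ^ j)"
  proof (induction j)
    case 0
    show ?case using F.graded_mult[OF F.graded_adj[OF x] x] by (simp add: mult_2)
  next
    case (Suc j)
    then show ?case using F.graded_mult[OF Suc Suc] by (simp add: algebra_simps)
  qed
  have "real (2 * ((2 * n) * 2 ^ j) + 1) \<le> real (4 * n + 1) * 2 ^ j" by (simp add: algebra_simps)
  then have "real (2 * ((2 * n) * 2 ^ j) + 1) * cnorm B (\<phi> ?y) \<le> real (4 * n + 1) * 2 ^ j * cnorm B (\<phi> ?y)"
    using F.graded_carrier[OF y] by (intro mult_right_mono B.cnorm_nonneg) auto
  then show "cnorm A ?y \<le> real (4 * n + 1) * 2 ^ j * cnorm B (\<phi> ?y)"
    using graded_bounded_below[OF y] by linarith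
qed

lemma graded_dense:
  assumes x: "x \<in> carrier A" and e: "e > 0"
  obtains n d where "d \<in> F.graded n" "cnorm A (x \<ominus> d) < e"
proof -
  let ?D = "\<Union>n. F.graded n"
  have "\<exists>d\<in>?D. cnorm A (x \<ominus> d) < e"
  proof (rule A.cstar_generated_dense[OF _ _ _ _ _ _ _ _ e])
    show "x \<in> cstar_generated A (s ` E)" using x by (simp add: generated)
    show "s ` E \<subseteq> ?D" using F.homogeneous_graded[OF F.homogeneous_s, of _ 1] by auto
    fix y z assume "y \<in> ?D" "z \<in> ?D"
    then obtain m n where yz: "y \<in> F.graded m" "z \<in> F.graded n" by blast
    then show "y \<otimes> z \<in> ?D" using F.graded_mult by blast
    have "y \<in> F.graded (max m n)" "z \<in> F.graded (max m n)" using yz by (auto intro: F.graded_mono)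
    then show "y \<oplus> z \<in> ?D" using F.graded_add by blast
  qed (auto intro: F.graded.zero F.graded_carrier F.graded_adj F.graded_smult)
  then show thesis using that by blast
qed

theorem injective: "inj_on \<phi> (carrier A)"
proof -
  have zero: "x = \<zero>" if x: "x \<in> carrier A" and 0: "\<phi> x = \<zero>\<^bsub>B\<^esub>" for x
  proof -
    have "cnorm A x \<le> 0"
    proof (rule field_le_epsilon)
      fix e :: real assume "e > 0"
      then have e: "e / 2 > 0" by simp
      obtain n d where d: "d \<in> F.graded n" "cnorm A (x \<ominus> d) < e / 2" using graded_dense[OF x e] .
      have dc: "d \<in> carrier A" by (rule F.graded_carrier[OF d(1)])
      \<comment> \<open>\<open>\<phi>\<close> preserves the norm of \<open>d\<close>, and since
        \<open>\<phi> x\<close> vanishes, \<open>\<phi> d\<close> and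
        \<open>\<phi> (x \<ominus> d)\<close> differ only in sign.\<close>
      have "cnorm A d = cnorm B (\<phi> (x \<ominus> d))"
        using graded_isometric[OF d(1)] x dc 0 by (simp add: diff B.minus_eq)
      also have "\<dots> \<le> cnorm A (x \<ominus> d)" using x dc by (intro contractive) simp
      finally have "cnorm A d \<le> cnorm A (x \<ominus> d)" .
      moreover have "x = (x \<ominus> d) \<oplus> d" using x dc by (simp add: A.distribs A.group_simps)
      then have "cnorm A x \<le> cnorm A (x \<ominus> d) + cnorm A d"
        using A.cnorm_triangle[of "x \<ominus> d" d] x dc by simp
      ultimately show "cnorm A x \<le> 0 + e" using d(2) by linarith
    qed
    then show ?thesis using A.cnorm_nonneg[OF x] A.cnorm_eq_0[OF x] by simp
  qed
  show ?thesis
  proof (rule inj_onI)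
    fix x y assume xy: "x \<in> carrier A" "y \<in> carrier A" "\<phi> x = \<phi> y"
    then have "\<phi> (x \<ominus> y) = \<zero>\<^bsub>B\<^esub>" by (simp add: diff B.minus_eq B.r_neg)
    then have "x \<ominus> y = \<zero>" using xy by (intro zero) simp_all
    then show "x = y" using xy A.diff_eq_zeroD by blast
  qed
qed

end

theorem theorem5p8:
  fixes H :: "('v, 'e) hypergraph"
    and B :: "'b cstar"
    and P :: "'v \<Rightarrow> 'b" and S :: "'e \<Rightarrow> 'b"
    and \<pi> :: "('v, 'e) hcstar_elem \<Rightarrow> 'b"
    and \<gamma> :: "complex \<Rightarrow> ('v, 'e) hcstar_elem \<Rightarrow> ('v, 'e) hcstar_elem"
    and \<beta> :: "complex \<Rightarrow> 'b \<Rightarrow> 'b"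
  assumes "finite_hypergraph H"
    and "only_quasi_perfect_paths H"
    and "\<not> (\<exists>v\<in>hverts H. hsink H v)"
    and "cstar_generated (hcstar H) (hiso H ` hedges H) = carrier (hcstar H)"
    and "cstar_algebra B"
    and "ck_family H B P S"
    and "\<forall>v\<in>hverts H. P v \<noteq> \<zero>\<^bsub>B\<^esub>"
    and "canonical_hom H B P S \<pi>"
    and "gauge_action H \<gamma>"
    and "circle_action B \<beta>"
    and "\<forall>z\<in>circle. \<forall>x\<in>carrier (hcstar H). \<pi> (\<gamma> z x) = \<beta> z (\<pi> x)"
  shows "inj_on \<pi> (carrier (hcstar H))"
proof -
  interpret F: edge_family "hcstar H" "hedges H" "htransition H" "hiso H"
    using assms(1-3) by (rule hcstar_edge_family)
  interpret B: cstar_algebra B by fact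
  interpret h: cstar_hom "hcstar H" B \<pi>
    using assms(8) by unfold_locales (simp add: canonical_hom_def)
  have \<pi>S: "\<pi> (hiso H e) = S e" if "e \<in> hedges H" for e using assms(8) that by (simp add: canonical_hom_def)
  interpret gauge_invariant_hom "hcstar H" B \<pi> "hedges H" "htransition H" "hiso H" \<beta>
  proof unfold_locales
    fix e assume e: "e \<in> hedges H"
    have sub: "hrange H e \<subseteq> hverts H" "finite (hrange H e)" "hrange H e \<noteq> {}"
      using assms(1) e by (auto simp: finite_hypergraph_def intro: finite_subset)
    then obtain v where v: "v \<in> hrange H e" "v \<in> hverts H" by blast
    have P: "\<And>v. v \<in> hverts H \<Longrightarrow> cstar_projection B (P v)"
      "\<And>v w. v \<in> hverts H \<Longrightarrow> w \<in> hverts H \<Longrightarrow> v \<noteq> w \<Longrightarrow> P v \<otimes>\<^bsub>B\<^esub> P w = \<zero>\<^bsub>B\<^esub>"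
      and SS: "adj B (S e) \<otimes>\<^bsub>B\<^esub> S e = (\<Oplus>\<^bsub>B\<^esub>v\<in>hrange H e. P v)"
      using assms(6) e by (auto simp: ck_family_def)
    \<comment> \<open>By HR1 the sum is S_e* S_e. Multiplication by \<open>P v\<close> for one
      \<open>v\<close> in the range returns \<open>P v \<noteq> 0\<close>, so neither the sum nor
      \<open>S e\<close> can vanish.\<close>
    have "finsum B P (hrange H e) \<otimes>\<^bsub>B\<^esub> P v = P v"
      using B.orth_sum_mult[of "hrange H e" P "hrange H e" v] P sub v by (auto simp: subset_iff)
    moreover have "P v \<noteq> \<zero>\<^bsub>B\<^esub>" "P v \<in> carrier B" using assms(7) v P(1) by (auto simp: cstar_projection_def)
    ultimately have "finsum B P (hrange H e) \<noteq> \<zero>\<^bsub>B\<^esub>" by auto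
    then show "\<pi> (hiso H e) \<noteq> \<zero>\<^bsub>B\<^esub>" using SS \<pi>S[OF e] by auto
  next
    fix z assume z: "z \<in> circle"
    then show "\<beta> z \<in> star_hom B B" using assms(10) by (simp add: circle_action_def star_aut_def)
    fix e assume e: "e \<in> hedges H"
    have "\<beta> z (\<pi> (hiso H e)) = \<pi> (\<gamma> z (hiso H e))" using assms(11) z e by simp
    also have "\<dots> = z \<odot>\<^bsub>B\<^esub> \<pi> (hiso H e)" using assms(9) z e by (simp add: gauge_action_def h.smult)
    finally show "\<beta> z (\<pi> (hiso H e)) = z \<odot>\<^bsub>B\<^esub> \<pi> (hiso H e)" .
  qed (fact assms(4))
  show ?thesis by (rule injective)
qed

end
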